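(* Let $d,r\in\mathbb{N}$, let $\lambda>1$, $a>0$, $b\in\mathbb{R}$, let $w(\boldsymbol{x})=\prod_{i=1}^d\exp(-a|x_i|^\lambda+b)$ for $\boldsymbol{x}\in\mathbb{R}^d$, and put $r_\lambda:=(1-1/\lambda)r$. Then $$ n^{-r_\lambda}(\log n)^{r_\lambda(d-1)}\ \ll\ \mathrm{Int}_n\big(\boldsymbol{W}^r_{1,w}(\mathbb{R}^d)\big)\ \ll\ n^{-r_\lambda}(\log n)^{(r_\lambda+1)(d-1)},\qquad n\ge 2, $$ where $\boldsymbol{W}^r_{1,w}(\mathbb{R}^d)$ is the unit ball of the weighted Sobolev space $W^r_{1,w}(\mathbb{R}^d)$ of mixed smoothness $r$, and the constants implied by $\ll$ do not depend on $n$.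
   Context: $L^1_w(\mathbb{R}^d)$ is the space of measurable functions $f$ on $\mathbb{R}^d$ with $\|f\|_{L^1_w(\mathbb{R}^d)}:=\int_{\mathbb{R}^d}|f(\boldsymbol{x})w(\boldsymbol{x})|\,d\boldsymbol{x}<\infty$. $W^r_{1,w}(\mathbb{R}^d)$ is the space of all $f\in L^1_w(\mathbb{R}^d)$ such that the weak partial derivative $D^{\boldsymbol{k}}f$ belongs to $L^1_w(\mathbb{R}^d)$ for every $\boldsymbol{k}\in\mathbb{N}_0^d$ with $|\boldsymbol{k}|_\infty:=\max_ik_i\le r$, with norm $\|f\|_{W^r_{1,w}(\mathbb{R}^d)}:=\sum_{|\boldsymbol{k}|_\infty\le r}\|D^{\boldsymbol{k}}f\|_{L^1_w(\mathbb{R}^d)}$. Every such $f$ coincides a.e. with a continuous function, and $f$ is always identified with this continuous representative, so that point values make sense. $\mathcal{Q}_n$ is the family of all quadratures $Q_kf=\sum_{i=1}^k\lambda_if(\boldsymbol{x}_i)$ with $k\le n$, nodes $\boldsymbol{x}_i\in\mathbb{R}^d$ (some nodes may coincide) and weights $\lambda_i\in\mathbb{R}$. For a set $\boldsymbol{F}$ of continuous functions on $\mathbb{R}^d$, $$\mathrm{Int}_n(\boldsymbol{F}):=\inf_{Q\in\mathcal{Q}_n}\ \sup_{f\in\boldsymbol{F}}\bigg|\int_{\mathbb{R}^d}f(\boldsymbol{x})w(\boldsymbol{x})\,d\boldsymbol{x}-Qf\bigg|.$$ $A_n\ll B_n$ means that there is a constant $C>0$ independent of $n$ with $A_n\le CB_n$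 for all $n$ under consideration. *)

theory Defs
  imports "HOL-Analysis.Analysis"
begin

text \<open>
  The space of dimension \<open>d\<close> is \<^typ>\<open>real ^ 'd\<close> with \<open>d = CARD('d)\<close>.
  Measurable and integrable refer to Lebesgue measure (\<^const>\<open>lebesgue\<close>).
\<close>

section \<open>Weighted $L^1$ spaces\<close>

definition L1w :: "(real ^ 'd \<Rightarrow> real) \<Rightarrow> (real ^ 'd \<Rightarrow> real) set" where
  "L1w w = {f. f \<in> borel_measurable lebesgue \<and> integrable lebesgue (\<lambda>x. \<bar>f x * w x\<bar>)}"

definition L1w_norm :: "(real ^ 'd \<Rightarrow> real) \<Rightarrow> (real ^ 'd \<Rightarrow> real) \<Rightarrow> real" where
  "L1w_norm w f = (\<integral>x. \<bar>f x * w x\<bar> \<partial>lebesgue)"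

section \<open>Test functions and classical mixed derivatives\<close>

definition partial :: "'d \<Rightarrow> (real ^ 'd \<Rightarrow> real) \<Rightarrow> real ^ 'd \<Rightarrow> real" where
  "partial i f x = frechet_derivative f (at x) (axis i 1)"

abbreviation partials :: "'d list \<Rightarrow> (real ^ 'd \<Rightarrow> real) \<Rightarrow> real ^ 'd \<Rightarrow> real" where
  "partials is f \<equiv> foldr partial is f"

text \<open>
  Total differentiability of every iterated partial derivative is the same as
  \<open>C\<^sup>\<infinity>\<close>: it makes all iterated partial derivatives continuous.
\<close>
definition smooth :: "(real ^ 'd \<Rightarrow> real) \<Rightarrow> bool" where
  "smooth f \<longleftrightarrow> (\<forall>is. \<forall>x. partials is f differentiable (at x))"

definition test_functions :: "(real ^ 'd \<Rightarrow> real) set" where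
  "test_functions = {\<phi>. smooth \<phi> \<and> compact (closure {x. \<phi> x \<noteq> 0})}"

text \<open>
  For a multi-index \<open>k\<close>, differentiate \<open>k $ i\<close> times in direction \<open>i\<close>. The index type
  carries no order, so an arbitrary enumeration of the directions is chosen; this operator
  is only applied to smooth functions, whose partial derivatives commute.
\<close>
definition mixed_deriv :: "nat ^ 'd \<Rightarrow> (real ^ 'd \<Rightarrow> real) \<Rightarrow> real ^ 'd \<Rightarrow> real" where
  "mixed_deriv k \<phi> = partials (SOME is. \<forall>i. count_list is i = k $ i) \<phi>"

section \<open>Weak derivatives\<close>

definition locally_integrable :: "(real ^ 'd \<Rightarrow> real) \<Rightarrow> bool" where
  "locally_integrable f \<longleftrightarrow> (\<forall>K. compact K \<longrightarrow> set_integrable lebesgue K f)"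

definition has_weak_deriv ::
  "(real ^ 'd \<Rightarrow> real) \<Rightarrow> nat ^ 'd \<Rightarrow> (real ^ 'd \<Rightarrow> real) \<Rightarrow> bool" where
  "has_weak_deriv f k g \<longleftrightarrow>
     locally_integrable f \<and> locally_integrable g \<and>
     (\<forall>\<phi>\<in>test_functions.
        (\<integral>x. f x * mixed_deriv k \<phi> x \<partial>lebesgue)
          = (-1) ^ (\<Sum>i\<in>UNIV. k $ i) * (\<integral>x. g x * \<phi> x \<partial>lebesgue))"

text \<open>
  The weak derivative, when it exists, is unique up to null sets, so the choice below
  influences neither membership in \<^const>\<open>L1w\<close> nor the value of \<^const>\<open>L1w_norm\<close>.
\<close>
definition weak_deriv :: "nat ^ 'd \<Rightarrow> (real ^ 'd \<Rightarrow> real) \<Rightarrow> real ^ 'd \<Rightarrow> real" where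
  "weak_deriv k f = (SOME g. has_weak_deriv f k g)"

section \<open>Weighted Sobolev spaces of mixed smoothness\<close>

definition multi_indices :: "nat \<Rightarrow> (nat ^ 'd) set" where
  "multi_indices r = {k. \<forall>i. k $ i \<le> r}"

definition W1w :: "nat \<Rightarrow> (real ^ 'd \<Rightarrow> real) \<Rightarrow> (real ^ 'd \<Rightarrow> real) set" where
  "W1w r w = {f \<in> L1w w. \<forall>k\<in>multi_indices r. \<exists>g\<in>L1w w. has_weak_deriv f k g}"

definition W1w_norm :: "nat \<Rightarrow> (real ^ 'd \<Rightarrow> real) \<Rightarrow> (real ^ 'd \<Rightarrow> real) \<Rightarrow> real" where
  "W1w_norm r w f = (\<Sum>k\<in>multi_indices r. L1w_norm w (weak_deriv k f))"

text \<open>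
  Elements of the Sobolev space are identified with their continuous representatives, so
  that point values make sense; hence the continuity requirement.
\<close>
definition W1w_unit_ball :: "nat \<Rightarrow> (real ^ 'd \<Rightarrow> real) \<Rightarrow> (real ^ 'd \<Rightarrow> real) set" where
  "W1w_unit_ball r w = {f \<in> W1w r w. continuous_on UNIV f \<and> W1w_norm r w f \<le> 1}"

section \<open>Optimal quadrature\<close>

definition quadratures :: "nat \<Rightarrow> ((real ^ 'd \<Rightarrow> real) \<Rightarrow> real) set" where
  "quadratures n = {Q. \<exists>k\<le>n. \<exists>(xs :: nat \<Rightarrow> real ^ 'd) (cs :: nat \<Rightarrow> real).
     Q = (\<lambda>f. \<Sum>i=1..k. cs i * f (xs i))}"

text \<open>
  Values are in \<^typ>\<open>ennreal\<close>, so that a supremum over an unbounded set of errors is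
  \<open>\<infinity>\<close> rather than an unspecified real number.
\<close>
definition Int_opt ::
  "(real ^ 'd \<Rightarrow> real) \<Rightarrow> (real ^ 'd \<Rightarrow> real) set \<Rightarrow> nat \<Rightarrow> ennreal" where
  "Int_opt w F n =
     (INF Q\<in>quadratures n. SUP f\<in>F. ennreal \<bar>(\<integral>x. f x * w x \<partial>lebesgue) - Q f\<bar>)"

end

theory Submission
  imports Defs
begin

text \<open>
  Write \<open>d\<close> for the dimension and \<open>p\<close> for \<open>(1 - 1 / lam) * r\<close>.

  The upper bound rests on a duality argument. The error of a quadrature is the pairing of \<open>f\<close> with the difference
  between the weight and a combination of point masses. After mollification this difference is a test function, and
  if it is a derivative of order \<open>r\<close> of a function bounded by \<open>\<epsilon>\<close> times the weight, then the definition
  of the weak derivative bounds the error by \<open>\<epsilon>\<close> times the norm of \<open>f\<close>. So \<open>f\<close> itself is never smoothed; it only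
  enters through its weak derivatives and, in the limit of vanishing mollification, through its values at the nodes.

  In dimension one the required representation is a Peano kernel. Composite interpolation with about \<open>2 ^ k\<close> cells of length
  \<open>h = 2 powr (- (1 - 1 / lam) * k)\<close> has a kernel of size \<open>h ^ r\<close> times the weight (\<open>half_line_quadrature\<close>): the cells reach as far as
  the scale \<open>\<bar>x\<bar> powr (1 - lam)\<close>, on which the weight varies at \<open>x\<close>, is at least of order \<open>h\<close>, and the tail is
  covered by extrapolation from the last cell. In dimension \<open>d\<close>, the differences of consecutive levels are multiplied and
  summed over \<open>sum k UNIV \<le> m\<close> (\<open>smolyak_quadrature\<close>). Because the norm is an \<open>L\<^sup>1\<close> norm, a tensor product of kernels
  bounded by multiples of the weights pairs with the mixed derivatives of \<open>f\<close> with the product of the bounds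
  (\<open>tensor_functional_bound\<close>). Hence the error is of order \<open>\<Sum>k. 2 powr (- p * sum k UNIV)\<close> over \<open>sum k UNIV > m\<close>,
  that is \<open>m ^ (d - 1) * 2 powr (- p * m)\<close>, while the number of nodes is of order \<open>m ^ (d - 1) * 2 ^ m\<close>.
  Eliminating \<open>m\<close> gives the bound.

  For the lower bound, a quadrature with \<open>n\<close> nodes cannot see a function supported in a box that contains no node.
  Since the weight varies at the scale \<open>\<bar>x\<bar> powr (1 - lam)\<close>, a bump fitted to a box with sides \<open>h i\<close> of that scale has an
  integral of order \<open>\<Prod>i. h i ^ r\<close> relative to its norm (\<open>fooling_function\<close>). The box at a point with coordinates
  about \<open>2 ^ j i\<close> gives \<open>2 powr (- lam * p * sum j UNIV)\<close>. There are about \<open>2 powr (lam * M)\<close> such disjoint boxes for each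
  of the about \<open>M ^ (d - 1)\<close> multi-indices with \<open>sum j UNIV = M\<close>, all equally good, and this count produces the logarithm (\<open>Int_opt_ge\<close>).

  Both parts use that weak derivatives are unique up to null sets (\<open>weak_deriv_unique\<close>), because the norm is defined through
  an arbitrary choice of them.
\<close>

section \<open>Smooth functions of one variable\<close>

definition smooth1 :: "(real \<Rightarrow> real) \<Rightarrow> bool" where
  "smooth1 u \<longleftrightarrow> (\<forall>k x. (deriv ^^ k) u differentiable (at x))"

text \<open>
  Smoothness follows from membership in a class of functions that is closed under differentiation; products, affine
  substitutions and the flat functions below are treated in this way.
\<close>

lemma smooth1_coinduct:
  assumes "P u" and "\<And>u. P u \<Longrightarrow> \<exists>u'. (\<forall>x. (u has_real_derivative u' x) (at x)) \<and> P u'"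
  shows "smooth1 u"
proof -
  have P: "P ((deriv ^^ k) u)" for k
  proof (induction k)
    case (Suc k)
    then obtain u' where u': "\<And>x. ((deriv ^^ k) u has_real_derivative u' x) (at x)" "P u'"
      using assms(2) by blast
    then have "deriv ((deriv ^^ k) u) = u'" by (auto intro: DERIV_imp_deriv)
    with u' show ?case by simp
  qed (use assms in simp)
  show ?thesis unfolding smooth1_def
    using assms(2)[OF P] by (metis real_differentiable_def)
qed

lemma smooth1_deriv: "smooth1 u \<Longrightarrow> smooth1 (deriv u)"
  unfolding smooth1_def by (metis funpow_Suc_right comp_apply)

lemma smooth1_derivs: "smooth1 u \<Longrightarrow> smooth1 ((deriv ^^ k) u)"
  by (induction k) (auto intro: smooth1_deriv)

lemma smooth1_DERIV: "smooth1 u \<Longrightarrow> (u has_real_derivative deriv u x) (at x)"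
  unfolding smooth1_def by (metis funpow_0 DERIV_deriv_iff_real_differentiable)

lemma smooth1_continuous: "smooth1 u \<Longrightarrow> continuous_on S u"
  by (meson smooth1_DERIV DERIV_isCont continuous_at_imp_continuous_on)

lemma smooth1_measurable: "smooth1 u \<Longrightarrow> u \<in> borel_measurable borel"
  by (simp add: smooth1_continuous borel_measurable_continuous_onI)

text \<open>
  The smallest convenient class that contains all products of smooth functions and is closed under differentiation.
\<close>

inductive product_sum :: "(real \<Rightarrow> real) \<Rightarrow> bool" where
  prod: "smooth1 u \<Longrightarrow> smooth1 v \<Longrightarrow> product_sum (\<lambda>x. u x * v x)"
| add: "product_sum f \<Longrightarrow> product_sum g \<Longrightarrow> product_sum (\<lambda>x. f x + g x)"

lemma smooth1_mult:
  assumes "smooth1 u" "smooth1 v"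
  shows "smooth1 (\<lambda>x. u x * v x)"
proof (rule smooth1_coinduct[of product_sum])
  show "product_sum (\<lambda>x. u x * v x)" using assms by (rule product_sum.prod)
next
  fix f assume "product_sum f"
  then show "\<exists>f'. (\<forall>x. (f has_real_derivative f' x) (at x)) \<and> product_sum f'"
  proof induction
    case (prod u v)
    have "((\<lambda>x. u x * v x) has_real_derivative deriv u x * v x + u x * deriv v x) (at x)" for x
      using smooth1_DERIV[OF prod(1), of x] smooth1_DERIV[OF prod(2), of x]
      by (auto intro!: derivative_eq_intros)
    moreover have "product_sum (\<lambda>x. deriv u x * v x + u x * deriv v x)"
      using prod by (intro product_sum.intros smooth1_deriv)
    ultimately show ?case
      by (intro exI[of _ "\<lambda>x. deriv u x * v x + u x * deriv v x"] conjI allI)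
  next
    case (add f g)
    then obtain f' g' where "\<And>x. (f has_real_derivative f' x) (at x)" "product_sum f'"
      "\<And>x. (g has_real_derivative g' x) (at x)" "product_sum g'" by blast
    then show ?case
      by (intro exI[of _ "\<lambda>x. f' x + g' x"]) (auto intro!: product_sum.add derivative_eq_intros)
  qed
qed

lemma smooth1_affine:
  assumes "smooth1 u"
  shows "smooth1 (\<lambda>x. c * u (p * x + q))"
    and "(deriv ^^ k) (\<lambda>x. c * u (p * x + q)) = (\<lambda>x. c * p ^ k * (deriv ^^ k) u (p * x + q))"
proof -
  have D: "((\<lambda>x. c * u (p * x + q)) has_real_derivative c * p * deriv u (p * x + q)) (at x)"
    if "smooth1 u" for u c x
  proof -
    have "((\<lambda>x. p * x + q) has_real_derivative p) (at x)"
      by (auto intro!: derivative_eq_intros)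
    from DERIV_cmult[OF DERIV_chain2[OF smooth1_DERIV[OF that] this], of c] show ?thesis
      by (simp add: mult_ac)
  qed
  show "smooth1 (\<lambda>x. c * u (p * x + q))"
  proof (rule smooth1_coinduct[of "\<lambda>f. \<exists>u c. smooth1 u \<and> f = (\<lambda>x. c * u (p * x + q))"])
    fix f assume "\<exists>u c. smooth1 u \<and> f = (\<lambda>x. c * u (p * x + q))"
    then obtain u c where f: "smooth1 u" "f = (\<lambda>x. c * u (p * x + q))" by blast
    show "\<exists>f'. (\<forall>x. (f has_real_derivative f' x) (at x)) \<and>
        (\<exists>u c. smooth1 u \<and> f' = (\<lambda>x. c * u (p * x + q)))"
      unfolding f(2) by (rule exI[of _ "\<lambda>x. (c * p) * deriv u (p * x + q)"])
        (intro conjI allI D f(1) exI[of _ "deriv u"] exI[of _ "c * p"] smooth1_deriv refl)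
  qed (use assms in blast)
  show "(deriv ^^ k) (\<lambda>x. c * u (p * x + q)) = (\<lambda>x. c * p ^ k * (deriv ^^ k) u (p * x + q))"
  proof (induction k)
    case (Suc k)
    show ?case
      by (rule ext, simp only: funpow.simps comp_apply Suc, rule DERIV_imp_deriv)
         (use D[OF smooth1_derivs[OF assms], of "c * p ^ k" k] in \<open>simp add: mult_ac\<close>)
  qed simp
qed

text \<open>
  For \<open>p = 1\<close> this is the standard smooth function \<open>exp (- 1 / x)\<close>, extended by 0 to the left. Its derivatives have the same
  form with other polynomials, so the family is closed under differentiation.
\<close>

definition flat :: "real poly \<Rightarrow> real \<Rightarrow> real" where
  "flat p x = (if x > 0 then poly p (1 / x) * exp (- (1 / x)) else 0)"

lemma poly_exp_tendsto_0: "((\<lambda>y. poly p y * exp (- y)) \<longlongrightarrow> (0::real)) at_top"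
proof (induction p)
  case (pCons c p)
  have "((\<lambda>y. y * (poly p y * exp (-y))) \<longlongrightarrow> (0::real)) at_top" for p
  proof -
    have "((\<lambda>y. \<Sum>i\<le>degree p. coeff p i * (y ^ Suc i / exp y)) \<longlongrightarrow> (\<Sum>i\<le>degree p. coeff p i * 0)) at_top"
      by (intro tendsto_intros tendsto_power_div_exp_0)
    then show ?thesis
      by (simp add: poly_altdef sum_distrib_left sum_distrib_right exp_minus field_simps)
  qed
  moreover have "((\<lambda>y. c * (y ^ 0 / exp y)) \<longlongrightarrow> c * 0) at_top"
    by (intro tendsto_intros tendsto_power_div_exp_0)
  ultimately have "((\<lambda>y. c * (y ^ 0 / exp y) + y * (poly p y * exp (-y))) \<longlongrightarrow> c * 0 + 0) at_top"
    by (intro tendsto_add)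
  then show ?case by (simp add: algebra_simps exp_minus field_simps)
qed simp

lemma flat_DERIV: "(flat p has_real_derivative flat ([:0,0,1:] * (p - pderiv p)) x) (at x)"
proof (cases "x = 0")
  case False
  have "((\<lambda>x. poly p (1 / x) * exp (- (1 / x))) has_real_derivative
      flat ([:0,0,1:] * (p - pderiv p)) x) (at x)" if "x > 0"
    using that
    by (auto intro!: derivative_eq_intros DERIV_chain2[OF poly_DERIV]
        simp: flat_def field_simps power2_eq_square)
  moreover have "((\<lambda>x. 0) has_real_derivative 0) (at x)" by simp
  ultimately show ?thesis
  proof (cases "x > 0")
    case True
    show ?thesis
      by (rule has_field_derivative_transform_within_open[OF _ open_greaterThan[of 0]])
         (use True \<open>x > 0 \<Longrightarrow> _\<close> in \<open>auto simp: flat_def\<close>)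
  next
    case F: False
    show ?thesis
      by (rule has_field_derivative_transform_within_open[where f = "\<lambda>_. 0", OF _ open_lessThan[of 0]])
         (use F False in \<open>auto simp: flat_def\<close>)
  qed
next
  case True
  have "((\<lambda>h. poly (pCons 0 p) (inverse h) * exp (- inverse h)) \<longlongrightarrow> 0) (at_right 0)"
    using poly_exp_tendsto_0[of "pCons 0 p"] filterlim_inverse_at_top_right
    by (rule filterlim_compose)
  then have "((\<lambda>h. flat p h / h) \<longlongrightarrow> 0) (at_right 0)"
    by (rule Lim_transform_eventually)
       (auto simp: eventually_at_filter flat_def field_simps intro!: always_eventually)
  moreover have "((\<lambda>h. flat p h / h) \<longlongrightarrow> 0) (at_left 0)"
    by (rule Lim_transform_eventually[OF tendsto_const])
       (auto simp: eventually_at_filter flat_def intro!: always_eventually)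
  ultimately have "((\<lambda>h. flat p h / h) \<longlongrightarrow> 0) (at 0)"
    by (rule filterlim_split_at_real[rotated])
  then show ?thesis using True by (simp add: DERIV_def flat_def)
qed

lemma smooth1_flat: "smooth1 (flat p)"
proof (rule smooth1_coinduct[of "\<lambda>f. \<exists>p. f = flat p"])
  fix f assume "\<exists>p. f = flat p"
  then obtain p where f: "f = flat p" by blast
  show "\<exists>f'. (\<forall>x. (f has_real_derivative f' x) (at x)) \<and> (\<exists>p. f' = flat p)"
    unfolding f by (intro exI[of _ "flat ([:0,0,1:] * (p - pderiv p))"] conjI allI flat_DERIV)
      (rule exI, rule refl)
qed blast

text \<open>
  The factor \<open>s\<close> steepens the flanks: as \<open>s\<close> grows, the bump increases to the indicator function of \<open>{p<..<q}\<close>.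
\<close>

definition bump :: "real \<Rightarrow> real \<Rightarrow> real \<Rightarrow> real \<Rightarrow> real" where
  "bump s p q x = flat 1 (s * (x - p)) * flat 1 (s * (q - x))"

lemma smooth1_bump: "smooth1 (bump s p q)"
proof -
  have "smooth1 (\<lambda>x. 1 * flat 1 (s * x + - s * p))" "smooth1 (\<lambda>x. 1 * flat 1 (-s * x + s * q))"
    by (intro smooth1_affine smooth1_flat)+
  from smooth1_mult[OF this] show ?thesis
    by (simp add: bump_def[abs_def] algebra_simps)
qed

lemma flat_1: "flat 1 x = (if x > 0 then exp (- (1 / x)) else 0)" by (simp add: flat_def)

lemma bump_nonneg: "bump s p q x \<ge> 0" by (simp add: bump_def flat_1)
lemma bump_le_1: "bump s p q x \<le> 1"
  unfolding bump_def by (rule mult_le_one) (auto simp: flat_1)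
lemma bump_pos: "s > 0 \<Longrightarrow> p < x \<Longrightarrow> x < q \<Longrightarrow> bump s p q x > 0" by (simp add: bump_def flat_1)
lemma bump_eq_0: "s > 0 \<Longrightarrow> x \<le> p \<or> q \<le> x \<Longrightarrow> bump s p q x = 0"
  by (auto simp: bump_def flat_1 zero_less_mult_iff)

lemma deriv_vanishes:
  assumes "\<And>x. x \<notin> {p..q} \<Longrightarrow> u x = 0" "x \<notin> {p..q}"
  shows "(deriv ^^ k) u x = (0::real)"
  using assms(2)
proof (induction k arbitrary: x)
  case 0
  then show ?case using assms(1) by simp
next
  case (Suc k)
  have "((deriv ^^ k) u has_real_derivative 0) (at x)"
    by (rule has_field_derivative_transform_within_open[where f = "\<lambda>_. 0" and S = "- {p..q}"])
       (use Suc in \<open>auto simp: open_Compl\<close>)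
  then show ?case by (simp add: DERIV_imp_deriv)
qed

lemma smooth1_bounded:
  assumes "smooth1 u" "\<And>x. x \<notin> {p..q} \<Longrightarrow> u x = 0"
  obtains B where "B > 0" "\<And>x. \<bar>(deriv ^^ k) u x\<bar> \<le> B"
proof -
  have "compact ((deriv ^^ k) u ` {p..q})"
    by (intro compact_continuous_image smooth1_continuous smooth1_derivs assms) auto
  then obtain B where B: "\<And>x. x \<in> {p..q} \<Longrightarrow> \<bar>(deriv ^^ k) u x\<bar> \<le> B"
    by (metis compact_imp_bounded bounded_iff imageI real_norm_def)
  show ?thesis
  proof (rule that[of "\<bar>B\<bar> + 1"])
    fix x show "\<bar>(deriv ^^ k) u x\<bar> \<le> \<bar>B\<bar> + 1"
    proof (cases "x \<in> {p..q}")
      case True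
      then show ?thesis using B[of x] by linarith
    next
      case False
      then have "(deriv ^^ k) u x = 0" using assms(2) by (rule deriv_vanishes[rotated])
      then show ?thesis by simp
    qed
  qed simp
qed

section \<open>Mollification\<close>

lemma integrable_bounded_support:
  fixes f :: "'a::euclidean_space \<Rightarrow> real"
  assumes "f \<in> borel_measurable borel" "\<And>x. \<bar>f x\<bar> \<le> B" "\<And>x. x \<notin> K \<Longrightarrow> f x = 0" "bounded K"
  shows "integrable lborel f"
proof -
  obtain a where K: "K \<subseteq> cbox (-a) a"
    using assms(4) bounded_subset_cbox_symmetric by blast
  have "integrable lborel (\<lambda>x. indicator (cbox (-a) a) x *\<^sub>R B)"
    by (rule borel_integrable_compact) auto
  then show ?thesis
  proof (rule Bochner_Integration.integrable_bound)
    show "AE x in lborel. norm (f x) \<le> norm (indicator (cbox (- a) a) x *\<^sub>R B)"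
    proof (rule AE_I2)
      fix x show "norm (f x) \<le> norm (indicator (cbox (- a) a) x *\<^sub>R B)"
        using assms(2)[of x] assms(3)[of x] K by (cases "x \<in> K") auto
    qed
  qed (use assms(1) in simp)
qed

definition mollifier :: "real \<Rightarrow> real \<Rightarrow> real" where
  "mollifier e x = bump 1 (-e) e x / (\<integral>y. bump 1 (-e) e y \<partial>lborel)"

lemma bump_integrable: "s > 0 \<Longrightarrow> integrable lborel (bump s p q)"
  by (rule integrable_bounded_support[where K = "{p..q}" and B = 1])
     (auto intro: smooth1_measurable smooth1_bump bump_eq_0 simp: bump_nonneg bump_le_1)

lemma bump_integral_pos:
  assumes "s > 0" "p < q"
  shows "(\<integral>x. bump s p q x \<partial>lborel) > 0"
proof -
  let ?m = "(p + q) / 2" and ?d = "(q - p) / 4"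
  have "continuous_on {p + ?d..q - ?d} (bump s p q)"
    by (intro smooth1_continuous smooth1_bump)
  then obtain x0 where x0: "x0 \<in> {p + ?d..q - ?d}" "\<And>x. x \<in> {p + ?d..q - ?d} \<Longrightarrow> bump s p q x0 \<le> bump s p q x"
    using continuous_attains_inf[of "{p + ?d..q - ?d}" "bump s p q"] assms by (auto simp: field_simps)
  have "0 < bump s p q x0 * (2 * ?d)"
    using bump_pos[OF assms(1), of p x0 q] x0(1) assms by (intro mult_pos_pos) (auto simp: field_simps)
  also have "\<dots> = (\<integral>x. indicator {p + ?d..q - ?d} x *\<^sub>R bump s p q x0 \<partial>lborel)"
    using assms by (simp add: field_simps)
  also have "\<dots> \<le> (\<integral>x. bump s p q x \<partial>lborel)"
  proof (rule integral_mono)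
    show "integrable lborel (\<lambda>x. indicator {p + ?d..q - ?d} x *\<^sub>R bump s p q x0)"
      by (rule borel_integrable_compact) auto
  qed (use x0 bump_integrable[OF assms(1)] in \<open>auto simp: indicator_def bump_nonneg\<close>)
  finally show ?thesis .
qed

lemma smooth1_mollifier: "smooth1 (mollifier e)"
  using smooth1_affine(1)[OF smooth1_bump[of 1 "-e" e], of "1 / (\<integral>y. bump 1 (-e) e y \<partial>lborel)" 1 0]
  by (simp add: mollifier_def[abs_def])

lemma mollifier_nonneg: "mollifier e x \<ge> 0"
  by (simp add: mollifier_def bump_nonneg)

lemma mollifier_eq_0: "e \<le> \<bar>x\<bar> \<Longrightarrow> mollifier e x = 0"
  using bump_eq_0[of 1 x "-e" e] by (cases "x \<ge> 0") (simp_all add: mollifier_def)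

lemma mollifier_integrable: "integrable lborel (mollifier e)"
  unfolding mollifier_def[abs_def] using bump_integrable[of 1] by auto

lemma mollifier_integral: "e > 0 \<Longrightarrow> (\<integral>x. mollifier e x \<partial>lborel) = 1"
  using bump_integral_pos[of 1 "-e" e] by (simp add: mollifier_def)

lemma mollifier_shift: "integrable lborel (\<lambda>y. mollifier e (x - y))" "(\<integral>y. mollifier e (x - y) \<partial>lborel) = (\<integral>y. mollifier e y \<partial>lborel)"
  using lborel_integrable_real_affine[OF mollifier_integrable, of "-1" e x]
        lborel_integral_real_affine[of "-1" "mollifier e" x] by auto

definition convolution :: "(real \<Rightarrow> real) \<Rightarrow> (real \<Rightarrow> real) \<Rightarrow> real \<Rightarrow> real" where
  "convolution \<kappa> \<phi> x = (\<integral>y. \<kappa> y * \<phi> (x - y) \<partial>lborel)"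

definition bounded_kernel :: "real \<Rightarrow> (real \<Rightarrow> real) \<Rightarrow> bool" where
  "bounded_kernel R \<kappa> \<longleftrightarrow> \<kappa> \<in> borel_measurable borel \<and> (\<exists>B. \<forall>y. \<bar>\<kappa> y\<bar> \<le> B) \<and> (\<forall>y. \<bar>y\<bar> > R \<longrightarrow> \<kappa> y = 0)"

lemma bounded_kernel_times_integrable:
  assumes "bounded_kernel R \<kappa>" "continuous_on UNIV g"
  shows "integrable lborel (\<lambda>y. \<kappa> y * g y)"
proof -
  from assms(1) obtain B where \<kappa>: "\<kappa> \<in> borel_measurable borel" "\<And>y. \<bar>\<kappa> y\<bar> \<le> B" "\<And>y. \<bar>y\<bar> > R \<Longrightarrow> \<kappa> y = 0"
    unfolding bounded_kernel_def by blast
  have "compact (g ` {-R..R})" using assms(2) by (intro compact_continuous_image) (auto intro: continuous_on_subset)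
  then obtain M where M: "\<And>y. y \<in> {-R..R} \<Longrightarrow> \<bar>g y\<bar> \<le> M"
    by (metis compact_imp_bounded bounded_iff imageI real_norm_def)
  show ?thesis
  proof (rule integrable_bounded_support[where K = "{-R..R}" and B = "B * \<bar>M\<bar>"])
    show "(\<lambda>y. \<kappa> y * g y) \<in> borel_measurable borel"
      using \<kappa>(1) borel_measurable_continuous_onI[OF assms(2)] by measurable
    fix x show "\<bar>\<kappa> x * g x\<bar> \<le> B * \<bar>M\<bar>"
    proof (cases "x \<in> {-R..R}")
      case True
      then have "\<bar>g x\<bar> \<le> \<bar>M\<bar>" using M[of x] by linarith
      then show ?thesis unfolding abs_mult using \<kappa>(2)[of x] by (intro mult_mono) auto
    next
      case False
      then have "\<kappa> x = 0" using \<kappa>(3)[of x] by auto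
      moreover have "B \<ge> 0" using \<kappa>(2)[of x] by linarith
      ultimately show ?thesis by simp
    qed
  next
    fix x assume "x \<notin> {-R..R}"
    then show "\<kappa> x * g x = 0" using \<kappa>(3)[of x] by auto
  qed simp
qed

lemma second_order_remainder:
  assumes "smooth1 \<phi>" "\<And>x. \<bar>(deriv ^^ 2) \<phi> x\<bar> \<le> M"
  shows "\<bar>\<phi> (z + s) - \<phi> z - s * deriv \<phi> z\<bar> \<le> M * s\<^sup>2"
proof -
  have lip: "\<bar>deriv \<phi> x - deriv \<phi> y\<bar> \<le> M * \<bar>x - y\<bar>" for x y
    using field_differentiable_bound[of UNIV "deriv \<phi>" "deriv (deriv \<phi>)" M x y]
      smooth1_DERIV[OF smooth1_deriv[OF assms(1)]] assms(2) by (simp add: numeral_2_eq_2)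
  have "\<bar>(\<phi> x - deriv \<phi> z * x) - (\<phi> z - deriv \<phi> z * z)\<bar> \<le> (M * \<bar>s\<bar>) * \<bar>x - z\<bar>" if "x = z + s" for x
  proof -
    have M: "M \<ge> 0" using assms(2)[of 0] by linarith
    have b: "\<bar>deriv \<phi> y - deriv \<phi> z\<bar> \<le> M * \<bar>s\<bar>" if "y \<in> cball z \<bar>s\<bar>" for y
      using lip[of y z] that mult_left_mono[OF _ M, of "\<bar>y - z\<bar>" "\<bar>s\<bar>"] by (auto simp: dist_real_def abs_minus_commute)
    have d: "((\<lambda>y. \<phi> y - deriv \<phi> z * y) has_field_derivative deriv \<phi> y - deriv \<phi> z) (at y within cball z \<bar>s\<bar>)" for y
      by (rule has_field_derivative_at_within)
        (use DERIV_diff[OF smooth1_DERIV[OF assms(1)] DERIV_cmult[OF DERIV_ident]] in simp)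
    have "norm ((\<phi> x - deriv \<phi> z * x) - (\<phi> z - deriv \<phi> z * z)) \<le> (M * \<bar>s\<bar>) * norm (x - z)"
      by (rule field_differentiable_bound[OF convex_cball[of z "\<bar>s\<bar>"] d]) (use b that in \<open>auto simp: dist_real_def\<close>)
    then show ?thesis by simp
  qed
  then have "\<bar>(\<phi> (z + s) - deriv \<phi> z * (z + s)) - (\<phi> z - deriv \<phi> z * z)\<bar> \<le> (M * \<bar>s\<bar>) * \<bar>s\<bar>"
    by fastforce
  moreover have "(\<phi> (z + s) - deriv \<phi> z * (z + s)) - (\<phi> z - deriv \<phi> z * z) = \<phi> (z + s) - \<phi> z - s * deriv \<phi> z"
    by (simp add: algebra_simps)
  moreover have "(M * \<bar>s\<bar>) * \<bar>s\<bar> = M * s\<^sup>2" by (simp add: power2_eq_square)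
  ultimately show ?thesis by simp
qed

text \<open>
  The difference quotients of \<open>\<phi>\<close> converge uniformly, by the bound on the second derivative, so differentiation may be
  interchanged with the integral.
\<close>

lemma convolution_DERIV:
  assumes \<kappa>: "bounded_kernel R \<kappa>" and \<phi>: "smooth1 \<phi>" "\<And>x. x \<notin> {p..q} \<Longrightarrow> \<phi> x = 0"
  shows "(convolution \<kappa> \<phi> has_real_derivative convolution \<kappa> (deriv \<phi>) x) (at x)"
proof -
  obtain M where M: "M > 0" "\<And>x. \<bar>(deriv ^^ 2) \<phi> x\<bar> \<le> M"
    using smooth1_bounded[OF \<phi>] by blast
  have shift: "continuous_on UNIV (\<lambda>y. u (x - y))" if "smooth1 u" for u x
    by (rule continuous_on_compose2[OF smooth1_continuous[OF that, of UNIV]]) (auto intro!: continuous_intros)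
  have I: "integrable lborel (\<lambda>y. \<kappa> y * u (x - y))" if "smooth1 u" for u x
    by (rule bounded_kernel_times_integrable[OF \<kappa>(1) shift[OF that]])
  have I1: "integrable lborel (\<lambda>y. \<bar>\<kappa> y\<bar>)"
    using bounded_kernel_times_integrable[OF \<kappa>(1), of "\<lambda>_. 1"] by simp
  define K where "K = (\<integral>y. \<bar>\<kappa> y\<bar> \<partial>lborel) * M"
  have rem: "\<bar>(convolution \<kappa> \<phi> (x + s) - convolution \<kappa> \<phi> x) / s - convolution \<kappa> (deriv \<phi>) x\<bar> \<le> K * \<bar>s\<bar>" if "s \<noteq> 0" for s
  proof -
    have "convolution \<kappa> \<phi> (x + s) - convolution \<kappa> \<phi> x - s * convolution \<kappa> (deriv \<phi>) x
      = (\<integral>y. \<kappa> y * (\<phi> (x - y + s) - \<phi> (x - y) - s * deriv \<phi> (x - y)) \<partial>lborel)"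
    proof -
      have "convolution \<kappa> \<phi> (x + s) - convolution \<kappa> \<phi> x - s * convolution \<kappa> (deriv \<phi>) x
        = (\<integral>y. \<kappa> y * \<phi> (x + s - y) - \<kappa> y * \<phi> (x - y) - s * (\<kappa> y * deriv \<phi> (x - y)) \<partial>lborel)"
        unfolding convolution_def by (simp add: I \<phi>(1) smooth1_deriv)
      then show ?thesis by (simp add: algebra_simps)
    qed
    also have "\<bar>\<dots>\<bar> \<le> (\<integral>y. \<bar>\<kappa> y\<bar> * (M * s\<^sup>2) \<partial>lborel)"
    proof (rule order_trans[OF integral_abs_bound], rule integral_mono)
      show "integrable lborel (\<lambda>y. \<bar>\<kappa> y * (\<phi> (x - y + s) - \<phi> (x - y) - s * deriv \<phi> (x - y))\<bar>)"
      proof -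
        have "integrable lborel (\<lambda>y. \<kappa> y * \<phi> (x + s - y) - \<kappa> y * \<phi> (x - y) - s * (\<kappa> y * deriv \<phi> (x - y)))"
          by (simp add: I \<phi>(1) smooth1_deriv)
        then show ?thesis by (intro integrable_abs) (simp add: algebra_simps)
      qed
      show "integrable lborel (\<lambda>y. \<bar>\<kappa> y\<bar> * (M * s\<^sup>2))" using I1 by simp
      show "\<bar>\<kappa> y * (\<phi> (x - y + s) - \<phi> (x - y) - s * deriv \<phi> (x - y))\<bar> \<le> \<bar>\<kappa> y\<bar> * (M * s\<^sup>2)" for y
        unfolding abs_mult by (intro mult_left_mono second_order_remainder[OF \<phi>(1) M(2)]) simp
    qed
    also have "\<dots> = K * s\<^sup>2" by (simp add: K_def)
    finally have *: "\<bar>convolution \<kappa> \<phi> (x + s) - convolution \<kappa> \<phi> x - s * convolution \<kappa> (deriv \<phi>) x\<bar> \<le> K * s\<^sup>2" .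
    have "\<bar>(convolution \<kappa> \<phi> (x + s) - convolution \<kappa> \<phi> x) / s - convolution \<kappa> (deriv \<phi>) x\<bar>
        = \<bar>convolution \<kappa> \<phi> (x + s) - convolution \<kappa> \<phi> x - s * convolution \<kappa> (deriv \<phi>) x\<bar> / \<bar>s\<bar>"
      unfolding abs_divide[symmetric] using that by (simp add: diff_divide_distrib)
    also have "\<dots> \<le> K * s\<^sup>2 / \<bar>s\<bar>" using * by (rule divide_right_mono) simp
    also have "\<dots> = K * \<bar>s\<bar>" using that by (simp add: power2_eq_square abs_if)
    finally show ?thesis .
  qed
  have "((\<lambda>s. (convolution \<kappa> \<phi> (x + s) - convolution \<kappa> \<phi> x) / s - convolution \<kappa> (deriv \<phi>) x) \<longlongrightarrow> 0) (at 0)"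
  proof (rule Lim_null_comparison)
    show "\<forall>\<^sub>F s in at 0. norm ((convolution \<kappa> \<phi> (x + s) - convolution \<kappa> \<phi> x) / s - convolution \<kappa> (deriv \<phi>) x) \<le> K * \<bar>s\<bar>"
      using rem by (auto simp: eventually_at_filter)
    have "((\<lambda>s. K * \<bar>s\<bar>) \<longlongrightarrow> K * \<bar>0\<bar>) (at 0)" by (intro tendsto_intros)
    then show "((\<lambda>s. K * \<bar>s\<bar>) \<longlongrightarrow> 0) (at 0)" by simp
  qed
  then show ?thesis by (simp add: DERIV_def LIM_zero_iff)
qed

lemma smooth1_convolution:
  assumes \<kappa>: "bounded_kernel R \<kappa>" and \<phi>: "smooth1 \<phi>" "\<And>x. x \<notin> {p..q} \<Longrightarrow> \<phi> x = 0"
  shows "smooth1 (convolution \<kappa> \<phi>)" and "(deriv ^^ k) (convolution \<kappa> \<phi>) = convolution \<kappa> ((deriv ^^ k) \<phi>)"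
proof -
  have D: "(convolution \<kappa> ((deriv ^^ k) \<phi>) has_real_derivative convolution \<kappa> ((deriv ^^ Suc k) \<phi>) x) (at x)" for k x
    using convolution_DERIV[OF \<kappa> smooth1_derivs[OF \<phi>(1)], of p q k x] deriv_vanishes[OF \<phi>(2)] by simp
  show eq: "(deriv ^^ k) (convolution \<kappa> \<phi>) = convolution \<kappa> ((deriv ^^ k) \<phi>)" for k
  proof (induction k)
    case (Suc k)
    then show ?case using D[of k] by (auto intro: DERIV_imp_deriv)
  qed simp
  show "smooth1 (convolution \<kappa> \<phi>)"
  proof -
    have "(deriv ^^ j) (convolution \<kappa> \<phi>) differentiable (at x)" for j x
      using D[of j x] unfolding eq[symmetric] real_differentiable_def by (rule exI)
    then show ?thesis by (simp add: smooth1_def)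
  qed
qed

lemma convolution_eq_0:
  assumes "bounded_kernel R \<kappa>" "\<And>x. e \<le> \<bar>x\<bar> \<Longrightarrow> \<phi> x = 0" "\<bar>x\<bar> > R + e"
  shows "convolution \<kappa> \<phi> x = 0"
proof -
  have z: "\<kappa> y * \<phi> (x - y) = 0" for y
  proof (cases "\<bar>y\<bar> > R")
    case True then show ?thesis using assms(1) by (simp add: bounded_kernel_def)
  next
    case False
    then have "e \<le> \<bar>x - y\<bar>" using assms(3) by linarith
    then show ?thesis using assms(2)[of "x - y"] by simp
  qed
  show ?thesis unfolding convolution_def z by simp
qed

text \<open>
  Mollification keeps a kernel below a multiple of a weight, provided that the weight at most doubles within the mollification radius.
\<close>

lemma convolution_mollifier_bound:
  assumes \<kappa>: "bounded_kernel R \<kappa>" "\<And>y. \<bar>\<kappa> y\<bar> \<le> C * W y" and "C \<ge> 0" "e > 0"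
    and W: "\<And>y. \<bar>y\<bar> \<le> R \<Longrightarrow> \<bar>x - y\<bar> \<le> e \<Longrightarrow> W y \<le> 2 * W x" "W x \<ge> 0"
  shows "\<bar>convolution \<kappa> (mollifier e) x\<bar> \<le> 2 * C * W x"
proof -
  have "\<bar>convolution \<kappa> (mollifier e) x\<bar> \<le> (\<integral>y. (2 * C * W x) * mollifier e (x - y) \<partial>lborel)"
    unfolding convolution_def
  proof (rule order_trans[OF integral_abs_bound], rule integral_mono)
    have "continuous_on UNIV (\<lambda>y. mollifier e (x - y))"
      by (rule continuous_on_compose2[OF smooth1_continuous[OF smooth1_mollifier, of UNIV]]) (auto intro!: continuous_intros)
    then show "integrable lborel (\<lambda>y. \<bar>\<kappa> y * mollifier e (x - y)\<bar>)"
      by (intro integrable_abs bounded_kernel_times_integrable[OF \<kappa>(1)])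
    show "integrable lborel (\<lambda>y. (2 * C * W x) * mollifier e (x - y))"
      using mollifier_shift by auto
    fix y
    consider "\<bar>y\<bar> > R" | "e \<le> \<bar>x - y\<bar>" | "\<bar>y\<bar> \<le> R" "\<bar>x - y\<bar> \<le> e" by linarith
    then show "\<bar>\<kappa> y * mollifier e (x - y)\<bar> \<le> (2 * C * W x) * mollifier e (x - y)"
    proof cases
      case 1
      then have "\<kappa> y = 0" using \<kappa>(1) by (simp add: bounded_kernel_def)
      then show ?thesis using assms mollifier_nonneg by simp
    next
      case 2 then show ?thesis by (simp add: mollifier_eq_0)
    next
      case 3
      then have "\<bar>\<kappa> y\<bar> \<le> C * (2 * W x)"
        using order_trans[OF \<kappa>(2)[of y] mult_left_mono[OF W(1)[of y] \<open>C \<ge> 0\<close>]] by simp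
      from mult_right_mono[OF this mollifier_nonneg[of e "x - y"]] show ?thesis
        by (simp add: abs_mult mollifier_nonneg mult_ac)
    qed
  qed
  also have "\<dots> = 2 * C * W x" using assms by (simp add: mollifier_shift(2) mollifier_integral)
  finally show ?thesis .
qed

section \<open>Peano kernels of interpolatory quadratures\<close>

definition lagrange_basis :: "nat \<Rightarrow> (nat \<Rightarrow> real poly) \<Rightarrow> bool" where
  "lagrange_basis r lg \<longleftrightarrow>
    (\<forall>p u. degree p < r \<longrightarrow> poly p u = (\<Sum>l<r. poly p (real l / real r) * poly (lg l) u))"

text \<open>
  The Lagrange polynomials of the nodes \<open>l / r\<close>: two polynomials of degree below \<open>r\<close> that agree at \<open>r\<close> points are equal.
\<close>

lemma lagrange_basis_exists:
  assumes "r \<ge> 1"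
  obtains lg where "lagrange_basis r lg"
proof -
  define z where "z l = real l / real r" for l
  have inj: "z i = z j \<longleftrightarrow> i = j" for i j using assms by (simp add: z_def)
  define lg where "lg l = (\<Prod>i\<in>{..<r} - {l}. smult (1 / (z l - z i)) [:- z i, 1:])" for l
  have deg: "degree (lg l) < r" if "l < r" for l
  proof -
    have "degree (lg l) \<le> (\<Sum>i\<in>{..<r} - {l}. degree (smult (1 / (z l - z i)) [:- z i, 1:]))"
      unfolding lg_def using degree_prod_sum_le[of "{..<r} - {l}" "\<lambda>i. smult (1 / (z l - z i)) [:- z i, 1:]"]
      by (simp add: o_def)
    also have "\<dots> \<le> (\<Sum>i\<in>{..<r} - {l}. 1)"
      by (intro sum_mono order_trans[OF degree_smult_le]) simp
    also have "\<dots> < r" using that by simp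
    finally show ?thesis .
  qed
  have eval: "poly (lg l) (z j) = (if j = l then 1 else 0)" if "j < r" "l < r" for j l
  proof (cases "j = l")
    case True
    have "poly (smult (1 / (z l - z i)) [:- z i, 1:]) (z l) = 1" if "i \<noteq> l" for i
    proof -
      have "z l \<noteq> z i" using inj[of l i] that by blast
      then show ?thesis by (simp flip: diff_divide_distrib)
    qed
    then have "(\<Prod>i\<in>{..<r} - {l}. poly (smult (1 / (z l - z i)) [:- z i, 1:]) (z l)) = 1"
      by (intro prod.neutral ballI) blast
    then show ?thesis using True by (simp add: lg_def poly_prod)
  next
    case False
    then have "(\<Prod>i\<in>{..<r} - {l}. poly (smult (1 / (z l - z i)) [:- z i, 1:]) (z j)) = 0"
      using that by (intro prod_zero) (auto intro!: bexI[of _ j])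
    then show ?thesis using False by (simp add: lg_def poly_prod)
  qed
  have "poly p u = (\<Sum>l<r. poly p (z l) * poly (lg l) u)" if "degree p < r" for p u
  proof -
    define q where "q = (\<Sum>l<r. smult (poly p (z l)) (lg l))"
    have "degree q \<le> r - 1" unfolding q_def
    proof (rule degree_sum_le)
      fix l assume "l \<in> {..<r}"
      then show "degree (smult (poly p (z l)) (lg l)) \<le> r - 1"
        using deg[of l] degree_smult_le[of "poly p (z l)" "lg l"] by simp
    qed simp
    then have dq: "degree q < r" using assms by simp
    have "poly p x = poly q x" if "x \<in> z ` {..<r}" for x
    proof -
      from that obtain j where j: "j < r" "x = z j" by auto
      have "poly q x = (\<Sum>l<r. if j = l then poly p (z l) else 0)"
        unfolding q_def poly_sum using j by (intro sum.cong) (auto simp: eval)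
      then show ?thesis using j by simp
    qed
    moreover have "card (z ` {..<r}) = r" by (subst card_image) (auto simp: inj_on_def inj)
    ultimately have "p = q" using dq that by (intro poly_eqI_degree[of "z ` {..<r}"]) auto
    then have "poly p u = poly q u" by simp
    also have "\<dots> = (\<Sum>l<r. poly p (z l) * poly (lg l) u)" by (simp add: q_def poly_sum)
    finally show ?thesis .
  qed
  then show ?thesis using that[of lg] by (simp add: z_def lagrange_basis_def)
qed

lemma power_le_fact_exp:
  assumes "(x::real) \<ge> 0" shows "x ^ i \<le> fact i * exp x"
proof -
  have "(\<Sum>n\<in>{i}. x ^ n /\<^sub>R fact n) \<le> (\<Sum>n. x ^ n /\<^sub>R fact n)"
    using assms by (intro sum_le_suminf summable_exp_generic) auto
  then show ?thesis by (simp add: exp_def field_simps)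
qed

lemma poly_le_exp:
  fixes c :: real
  assumes "c > 0"
  obtains C where "C > 0" "\<And>u. u \<ge> 0 \<Longrightarrow> \<bar>poly q u\<bar> \<le> C * exp (c * u)"
proof -
  define C where "C = 1 + (\<Sum>i\<le>degree q. \<bar>coeff q i\<bar> * (fact i / c ^ i))"
  show ?thesis
  proof (rule that[of C])
    have "(\<Sum>i\<le>degree q. \<bar>coeff q i\<bar> * (fact i / c ^ i)) \<ge> 0" using assms by (intro sum_nonneg) auto
    then show "C > 0" by (simp add: C_def)
    fix u :: real assume u: "u \<ge> 0"
    have "\<bar>poly q u\<bar> \<le> (\<Sum>i\<le>degree q. \<bar>coeff q i * u ^ i\<bar>)" unfolding poly_altdef by (rule sum_abs)
    also have "\<dots> \<le> (\<Sum>i\<le>degree q. \<bar>coeff q i\<bar> * (fact i / c ^ i * exp (c * u)))"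
    proof (rule sum_mono)
      fix i
      have "u ^ i = (c * u) ^ i / c ^ i" using assms by (simp add: power_mult_distrib)
      also have "\<dots> \<le> fact i * exp (c * u) / c ^ i"
        using assms u by (intro divide_right_mono power_le_fact_exp) auto
      finally show "\<bar>coeff q i * u ^ i\<bar> \<le> \<bar>coeff q i\<bar> * (fact i / c ^ i * exp (c * u))"
        unfolding abs_mult using u by (intro mult_left_mono) auto
    qed
    also have "\<dots> = (C - 1) * exp (c * u)"
      by (simp add: C_def sum_distrib_right mult.assoc)
    also have "\<dots> \<le> C * exp (c * u)" by (intro mult_right_mono) auto
    finally show "\<bar>poly q u\<bar> \<le> C * exp (c * u)" .
  qed
qed

lemma set_integrable_cont: "continuous_on {a..b::real} f \<Longrightarrow> set_integrable lborel {a..b} (f :: real \<Rightarrow> real)"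
  unfolding set_integrable_def by (rule borel_integrable_compact) auto

lemma exp_tail_integral:
  assumes "(s::real) > 0" "t \<le> L"
  shows "(LBINT y:{t..L}. exp (- s * (y - t))) \<le> 1 / s"
proof -
  have "(LBINT y:{t..L}. exp (- s * (y - t))) = - exp (- s * (L - t)) / s - - exp (- s * (t - t)) / s"
    unfolding set_lebesgue_integral_def
  proof (rule integral_FTC_atLeastAtMost[OF assms(2)])
    fix x
    have "((\<lambda>y. - exp (- s * (y - t)) / s) has_real_derivative exp (- s * (x - t))) (at x within {t..L})"
      using assms by (auto intro!: derivative_eq_intros)
    then show "((\<lambda>y. - exp (- s * (y - t)) / s) has_vector_derivative exp (- s * (x - t))) (at x within {t..L})"
      by (simp add: has_real_derivative_iff_has_vector_derivative)
  qed (auto intro!: continuous_intros)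
  also have "\<dots> = (1 - exp (- s * (L - t))) / s" by (simp add: diff_divide_distrib)
  also have "\<dots> \<le> 1 / s" using assms by (intro divide_right_mono) auto
  finally show ?thesis .
qed

lemma taylor_remainder_at_0:
  assumes "smooth1 g" "y \<ge> 0" "r \<ge> 1"
  shows "g y = (\<Sum>i<r. y ^ i / fact i * (deriv ^^ i) g 0)
    + (LBINT t:{0..y}. (y - t) ^ (r - 1) / fact (r - 1) * (deriv ^^ r) g t)"
proof -
  have "g y = (\<Sum>i<r. ((y - 0) ^ i / fact i) *\<^sub>R (deriv ^^ i) g 0)
    + integral {0..y} (\<lambda>t. ((y - t) ^ (r - 1) / fact (r - 1)) *\<^sub>R (deriv ^^ r) g t)"
  proof (rule Taylor_integral[of r "\<lambda>i. (deriv ^^ i) g"])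
    fix m t
    show "((deriv ^^ m) g has_vector_derivative (deriv ^^ Suc m) g t) (at t within {0..y})"
      using smooth1_DERIV[OF smooth1_derivs[OF assms(1)], of m t]
      by (simp add: has_real_derivative_iff_has_vector_derivative has_vector_derivative_at_within)
  qed (use assms in auto)
  moreover have "set_integrable lborel {0..y} (\<lambda>t. (y - t) ^ (r - 1) / fact (r - 1) * (deriv ^^ r) g t)"
    by (intro set_integrable_cont continuous_intros smooth1_continuous smooth1_derivs assms) auto
  ultimately show ?thesis
    by (simp add: set_borel_integral_eq_integral(2))
qed

definition peano :: "nat \<Rightarrow> real \<Rightarrow> real \<Rightarrow> real" where
  "peano r y t = (if 0 \<le> t \<and> t \<le> y then (y - t) ^ (r - 1) / fact (r - 1) else 0)"

lemma triangle_integrable: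
  fixes W :: "real \<Rightarrow> real"
  assumes "continuous_on UNIV W" "continuous_on UNIV G"
  shows "integrable (lborel \<Otimes>\<^sub>M lborel) (\<lambda>(t, y). indicator {0..L} y * W y * peano r y t * G t)"
proof -
  define S where "S = {(t, y). 0 \<le> t \<and> t \<le> y \<and> y \<le> (L::real)}"
  have "S \<subseteq> {0..L} \<times> {0..L}" by (auto simp: S_def)
  moreover have "closed S"
  proof -
    have "S = {p. 0 \<le> fst p} \<inter> {p. fst p \<le> snd p} \<inter> {p. snd p \<le> L}" by (auto simp: S_def)
    then show ?thesis by (auto intro!: closed_Int closed_Collect_le continuous_intros)
  qed
  ultimately have "compact S"
    using compact_Int_closed[OF compact_Times[OF compact_Icc compact_Icc], of S 0 L 0 L] by (simp add: Int_absorb1)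
  moreover have "continuous_on S (\<lambda>p. W (snd p) * ((snd p - fst p) ^ (r - 1) / fact (r - 1)) * G (fst p))"
    by (intro continuous_intros continuous_on_compose2[OF assms(1)] continuous_on_compose2[OF assms(2)]) auto
  ultimately have "integrable lborel (\<lambda>p. indicator S p *\<^sub>R (W (snd p) * ((snd p - fst p) ^ (r - 1) / fact (r - 1)) * G (fst p)))"
    by (rule borel_integrable_compact)
  also have "(\<lambda>p. indicator S p *\<^sub>R (W (snd p) * ((snd p - fst p) ^ (r - 1) / fact (r - 1)) * G (fst p)))
    = (\<lambda>(t, y). indicator {0..L} y * W y * peano r y t * G t)"
    by (auto simp: S_def peano_def indicator_def fun_eq_iff)
  finally show ?thesis by (simp add: lborel_prod)
qed

text \<open>
  \<open>\<kappa>\<close> represents the functional \<open>E\<close> through the derivative of order \<open>r\<close>. Every error functional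
  below is handled through such a representation, with the envelope \<open>V\<close> a multiple of the weight.
\<close>

definition peano_kernel ::
  "nat \<Rightarrow> real set \<Rightarrow> (real \<Rightarrow> real) \<Rightarrow> ((real \<Rightarrow> real) \<Rightarrow> real) \<Rightarrow> (real \<Rightarrow> real) \<Rightarrow> bool" where
  "peano_kernel r A V E \<kappa> \<longleftrightarrow> \<kappa> \<in> borel_measurable borel \<and> (\<forall>t. t \<notin> A \<longrightarrow> \<kappa> t = 0) \<and> (\<forall>t. \<bar>\<kappa> t\<bar> \<le> V t) \<and>
    (\<forall>g. smooth1 g \<longrightarrow> E g = (\<integral>t. \<kappa> t * (deriv ^^ r) g t \<partial>lborel))"

text \<open>
  In a cell scaled to start at 0, with all nodes in \<open>{0..<1}\<close>, the weight is comparable to its initial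
  value on \<open>{0..1}\<close> and decays exponentially from there on. This covers both the bounded cells, of
  length 1, and the outermost cell, which extends up to the truncation point.
\<close>

definition cell_weight :: "real \<Rightarrow> real \<Rightarrow> real \<Rightarrow> (real \<Rightarrow> real) \<Rightarrow> bool" where
  "cell_weight K \<gamma> L W \<longleftrightarrow> (\<forall>t. 0 \<le> t \<longrightarrow> t \<le> 1 \<longrightarrow> W 0 \<le> K * W t) \<and>
    (\<forall>t y. 0 \<le> t \<longrightarrow> t \<le> y \<longrightarrow> y \<le> L \<longrightarrow> W y \<le> K * W t * exp (- \<gamma> * (y - t)))"

text \<open>
  Interpolating at the nodes \<open>l / r\<close> of \<open>{0..<1}\<close> and extrapolating to the rest of the cell reproduces
  polynomials of degree below \<open>r\<close>, so only the Taylor remainder at 0 contributes to the error. By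
  Fubini the kernel at \<open>t\<close> is the error of the truncated power \<open>(y - t)\<^sub>+\<^bsup>r-1\<^esup> / (r-1)!\<close>. Its integral part
  is an integral over \<open>y > t\<close> and its node part vanishes for \<open>t > 1\<close>; exponential decay bounds
  both by the weight at \<open>t\<close>, uniformly in the length of the cell.
\<close>

lemma unit_cell_peano_kernel:
  fixes \<gamma> K :: real
  assumes r: "r \<ge> 1" and "\<gamma> > 0" "K > 0" and basis: "lagrange_basis r lg"
  obtains C where "C > 0"
    "\<And>L W. L \<ge> 1 \<Longrightarrow> continuous_on UNIV W \<Longrightarrow> (\<And>y. W y \<ge> 0) \<Longrightarrow> cell_weight K \<gamma> L W \<Longrightarrow>
      \<exists>\<kappa>. peano_kernel r {0..<L} (\<lambda>t. C * W t) (\<lambda>g. (LBINT y:{0..L}. W y * g y) -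
           (\<Sum>l<r. (LBINT y:{0..L}. W y * poly (lg l) y) * g (real l / real r))) \<kappa>"
proof -
  have lag: "poly p u = (\<Sum>l<r. poly p (real l / real r) * poly (lg l) u)" if "degree p < r" for p u
    using basis that by (simp add: lagrange_basis_def)
  have c: "\<gamma> / 2 > 0" using assms by simp
  obtain C1 where C1: "C1 > 0" "\<And>u. u \<ge> 0 \<Longrightarrow> u ^ (r - 1) \<le> C1 * exp (\<gamma> / 2 * u)"
  proof -
    obtain C where "C > 0" "\<And>u. u \<ge> 0 \<Longrightarrow> \<bar>poly (monom 1 (r - 1)) u\<bar> \<le> C * exp (\<gamma> / 2 * u)"
      using poly_le_exp[OF c] by blast
    then show ?thesis using that[of C] by (simp add: poly_monom)
  qed
  have "\<exists>C. C > 0 \<and> (\<forall>u\<ge>0. \<bar>poly (lg l) u\<bar> \<le> C * exp (\<gamma> / 2 * u))" for l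
    using poly_le_exp[OF c, of "lg l"] by metis
  then obtain c2 where c2: "\<And>l. c2 l > 0" "\<And>l u. u \<ge> 0 \<Longrightarrow> \<bar>poly (lg l) u\<bar> \<le> c2 l * exp (\<gamma> / 2 * u)"
    by metis
  define C where "C = K * C1 * (2 / \<gamma>) + (\<Sum>l<r. K * c2 l * (2 / \<gamma>) * K)"
  have "(\<Sum>l<r. K * c2 l * (2 / \<gamma>) * K) \<ge> 0" using assms c2(1) by (intro sum_nonneg) (auto simp: less_imp_le)
  then have "C > 0" unfolding C_def using assms C1 by (intro add_pos_nonneg mult_pos_pos) auto
  then show ?thesis
  proof (rule that[of C])
    fix L :: real and W :: "real \<Rightarrow> real"
    assume L: "L \<ge> 1" and Wc: "continuous_on UNIV W" and W0: "\<And>y. W y \<ge> 0" and W: "cell_weight K \<gamma> L W"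
    have W1: "\<And>t. 0 \<le> t \<Longrightarrow> t \<le> 1 \<Longrightarrow> W 0 \<le> K * W t"
      and Wexp: "\<And>t y. 0 \<le> t \<Longrightarrow> t \<le> y \<Longrightarrow> y \<le> L \<Longrightarrow> W y \<le> K * W t * exp (- \<gamma> * (y - t))"
      using W unfolding cell_weight_def by blast+
    have Wm: "W \<in> borel_measurable borel" using Wc by (rule borel_measurable_continuous_onI)
    have ints: "set_integrable lborel {t..L} (\<lambda>y. W y * q y)" if "continuous_on UNIV q" for q t
      using that Wc by (intro set_integrable_cont continuous_on_mult) (auto intro: continuous_on_subset)
    have decay: "W y * v \<le> K * W t * Cv * exp (- (\<gamma> / 2) * (y - t))"
      if "0 \<le> t" "t \<le> y" "y \<le> L" "v \<le> Cv * exp (\<gamma> / 2 * (y - t))" "Cv \<ge> 0" for y t v Cv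
    proof -
      have "W y * v \<le> W y * (Cv * exp (\<gamma> / 2 * (y - t)))" using that W0 by (intro mult_left_mono)
      also have "\<dots> \<le> K * W t * exp (- \<gamma> * (y - t)) * (Cv * exp (\<gamma> / 2 * (y - t)))"
        using that Wexp by (intro mult_right_mono) auto
      also have "\<dots> = K * W t * Cv * (exp (- \<gamma> * (y - t)) * exp (\<gamma> / 2 * (y - t)))" by simp
      also have "exp (- \<gamma> * (y - t)) * exp (\<gamma> / 2 * (y - t)) = exp (- (\<gamma> / 2) * (y - t))"
        by (simp add: algebra_simps flip: exp_add)
      finally show ?thesis .
    qed
    have tail: "(LBINT y:{t..L}. W y * v y) \<le> K * W t * Cv * (2 / \<gamma>)"
      if "0 \<le> t" "t \<le> L" "continuous_on UNIV v" "\<And>y. y \<ge> t \<Longrightarrow> v y \<le> Cv * exp (\<gamma> / 2 * (y - t))" "Cv \<ge> 0" for t v Cv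
    proof -
      have "(LBINT y:{t..L}. W y * v y) \<le> (LBINT y:{t..L}. K * W t * Cv * exp (- (\<gamma> / 2) * (y - t)))"
      proof (rule set_integral_mono)
        show "set_integrable lborel {t..L} (\<lambda>y. K * W t * Cv * exp (- (\<gamma> / 2) * (y - t)))"
          by (intro set_integrable_cont continuous_intros)
      qed (use that decay ints in auto)
      also have "\<dots> = K * W t * Cv * (LBINT y:{t..L}. exp (- (\<gamma> / 2) * (y - t)))" by simp
      also have "\<dots> \<le> K * W t * Cv * (1 / (\<gamma> / 2))"
        using that assms W0 c by (intro mult_left_mono exp_tail_integral) auto
      finally show ?thesis by simp
    qed
    define \<mu> where "\<mu> l = (LBINT y:{0..L}. W y * poly (lg l) y)" for l
    have polyc: "continuous_on UNIV (\<lambda>y. poly (lg l) y)" for l by (intro continuous_intros)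
    have \<mu>: "\<bar>\<mu> l\<bar> \<le> K * W 0 * c2 l * (2 / \<gamma>)" for l
    proof -
      have "\<bar>\<mu> l\<bar> \<le> (LBINT y:{0..L}. \<bar>W y * poly (lg l) y\<bar>)"
        unfolding \<mu>_def set_lebesgue_integral_def
        by (rule order_trans[OF integral_abs_bound]) (simp add: abs_mult)
      also have "\<dots> = (LBINT y:{0..L}. W y * \<bar>poly (lg l) y\<bar>)" using W0 by (simp add: abs_mult)
      also have "\<dots> \<le> K * W 0 * c2 l * (2 / \<gamma>)"
        using L c2 by (intro tail) (auto intro!: continuous_intros simp: less_imp_le)
      finally show ?thesis .
    qed
    define \<kappa>0 where "\<kappa>0 t = (\<integral>y. indicator {0..L} y * W y * peano r y t \<partial>lborel)" for t
    define \<kappa> where "\<kappa> t = \<kappa>0 t - (\<Sum>l<r. \<mu> l * peano r (real l / real r) t)" for t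
    have pm: "(\<lambda>t. peano r y t) \<in> borel_measurable borel" for y unfolding peano_def by measurable
    have \<kappa>0m: "\<kappa>0 \<in> borel_measurable borel"
    proof -
      have "(\<lambda>(t, y). indicator {0..L} y * W y * peano r y t) \<in> borel_measurable (lborel \<Otimes>\<^sub>M lborel)"
        using triangle_integrable[OF Wc, of "\<lambda>_. 1" L r] by (auto dest: borel_measurable_integrable)
      from lborel.borel_measurable_lebesgue_integral[OF this] show ?thesis
        by (simp add: \<kappa>0_def[abs_def])
    qed
    have \<kappa>m: "\<kappa> \<in> borel_measurable borel" unfolding \<kappa>_def using \<kappa>0m pm by measurable
    have out: "\<kappa> t = 0" if "t \<notin> {0..<L}" for t
    proof -
      have "AE y in lborel. indicator {0..L} y * W y * peano r y t = 0"
        using AE_lborel_singleton[of L] by eventually_elim (use that in \<open>auto simp: peano_def indicator_def\<close>)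
      then have "\<kappa>0 t = 0" unfolding \<kappa>0_def by (rule integral_eq_zero_AE)
      moreover have "peano r (real l / real r) t = 0" if "l < r" for l
      proof -
        have "real l / real r < 1" using that by simp
        then have "real l / real r < L" using L by linarith
        then show ?thesis using \<open>t \<notin> {0..<L}\<close> by (auto simp: peano_def)
      qed
      ultimately show ?thesis by (simp add: \<kappa>_def)
    qed
    have bound: "\<bar>\<kappa> t\<bar> \<le> C * W t" if t: "t \<in> {0..L}" for t
    proof -
      have "\<kappa>0 t = (LBINT y:{t..L}. W y * ((y - t) ^ (r - 1) / fact (r - 1)))"
        unfolding \<kappa>0_def set_lebesgue_integral_def using t
        by (intro Bochner_Integration.integral_cong) (auto simp: peano_def indicator_def)
      moreover have "\<dots> \<le> K * W t * C1 * (2 / \<gamma>)"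
      proof (rule tail)
        fix y assume "y \<ge> t"
        then have "(y - t) ^ (r - 1) / fact (r - 1) \<le> (y - t) ^ (r - 1) / 1"
          by (intro divide_left_mono) auto
        also have "\<dots> \<le> C1 * exp (\<gamma> / 2 * (y - t))" using C1(2)[of "y - t"] \<open>y \<ge> t\<close> by simp
        finally show "(y - t) ^ (r - 1) / fact (r - 1) \<le> C1 * exp (\<gamma> / 2 * (y - t))" .
      qed (use t C1 in \<open>auto intro!: continuous_intros\<close>)
      moreover have "\<kappa>0 t \<ge> 0" unfolding \<kappa>0_def
        by (intro Bochner_Integration.integral_nonneg) (auto simp: peano_def W0)
      ultimately have k0: "\<bar>\<kappa>0 t\<bar> \<le> K * W t * C1 * (2 / \<gamma>)" by simp
      have "\<bar>\<mu> l * peano r (real l / real r) t\<bar> \<le> K * c2 l * (2 / \<gamma>) * K * W t" if "l < r" for l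
      proof (cases "t \<le> real l / real r")
        case True
        have lr: "real l / real r \<le> 1" using that by simp
        have "\<bar>peano r (real l / real r) t\<bar> \<le> 1"
        proof -
          have "(real l / real r - t) ^ (r - 1) \<le> 1"
            using True t lr by (intro power_le_one) auto
          then show ?thesis using True t by (simp add: peano_def) (smt (verit) fact_ge_1)
        qed
        then have "\<bar>\<mu> l * peano r (real l / real r) t\<bar> \<le> K * W 0 * c2 l * (2 / \<gamma>) * 1"
          unfolding abs_mult using \<mu>[of l] assms W0 c2(1)[of l] by (intro mult_mono) auto
        also have "\<dots> = K * c2 l * (2 / \<gamma>) * W 0" by simp
        also have "\<dots> \<le> K * c2 l * (2 / \<gamma>) * (K * W t)"
          using W1[of t] t True lr assms c2(1)[of l] by (intro mult_left_mono) auto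
        finally show ?thesis by simp
      next
        case False
        then show ?thesis using assms c2(1)[of l] W0[of t] by (simp add: peano_def)
      qed
      then have "\<bar>\<Sum>l<r. \<mu> l * peano r (real l / real r) t\<bar> \<le> (\<Sum>l<r. K * c2 l * (2 / \<gamma>) * K * W t)"
        by (intro order_trans[OF sum_abs] sum_mono) auto
      moreover have "C * W t = K * W t * C1 * (2 / \<gamma>) + (\<Sum>l<r. K * c2 l * (2 / \<gamma>) * K * W t)"
        by (simp add: C_def algebra_simps sum_distrib_left)
      ultimately show ?thesis using k0 unfolding \<kappa>_def by linarith
    qed
    have eq: "(LBINT y:{0..L}. W y * g y) = (\<Sum>l<r. \<mu> l * g (real l / real r)) + (\<integral>t. \<kappa> t * (deriv ^^ r) g t \<partial>lborel)"
      if g: "smooth1 g" for g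
    proof -
      define G where "G = (deriv ^^ r) g"
      have Gc: "continuous_on UNIV G" unfolding G_def by (intro smooth1_continuous smooth1_derivs g)
      define P where "P = (\<Sum>i<r. monom ((deriv ^^ i) g 0 / fact i) i)"
      define Rem where "Rem y = (\<integral>t. peano r y t * G t \<partial>lborel)" for y
      have taylor: "g y = poly P y + Rem y" if "y \<ge> 0" for y
      proof -
        have "(LBINT t:{0..y}. (y - t) ^ (r - 1) / fact (r - 1) * (deriv ^^ r) g t) = Rem y"
          unfolding Rem_def set_lebesgue_integral_def G_def
          by (intro Bochner_Integration.integral_cong) (auto simp: peano_def indicator_def)
        then show ?thesis using taylor_remainder_at_0[OF g that r]
          by (simp add: P_def poly_sum poly_monom mult_ac)
      qed
      have "degree P \<le> r - 1" unfolding P_def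
        by (rule degree_sum_le) (auto intro!: order_trans[OF degree_monom_le])
      then have dP: "degree P < r" using r by simp
      have Pint: "(LBINT y:{0..L}. W y * poly P y) = (\<Sum>l<r. \<mu> l * poly P (real l / real r))"
      proof -
        have "(LBINT y:{0..L}. W y * poly P y) = (LBINT y:{0..L}. \<Sum>l<r. poly P (real l / real r) * (W y * poly (lg l) y))"
          by (subst lag[OF dP]) (simp add: sum_distrib_left mult_ac)
        also have "\<dots> = (\<Sum>l<r. LBINT y:{0..L}. poly P (real l / real r) * (W y * poly (lg l) y))"
          unfolding set_lebesgue_integral_def sum_distrib_left scaleR_sum_right
        proof (rule Bochner_Integration.integral_sum)
          fix l
          have "set_integrable lborel {0..L} (\<lambda>y. poly P (real l / real r) * (W y * poly (lg l) y))"
            using ints[OF polyc] by (intro set_integrable_mult_right) auto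
          then show "integrable lborel (\<lambda>x. indicat_real {0..L} x *\<^sub>R (poly P (real l / real r) * (W x * poly (lg l) x)))"
            by (simp add: set_integrable_def)
        qed
        also have "\<dots> = (\<Sum>l<r. \<mu> l * poly P (real l / real r))" by (simp add: \<mu>_def) (simp add: mult.commute)
        finally show ?thesis .
      qed
      have F: "integrable (lborel \<Otimes>\<^sub>M lborel) (\<lambda>(t, y). indicator {0..L} y * W y * peano r y t * G t)"
        by (rule triangle_integrable[OF Wc Gc])
      have Rint: "(LBINT y:{0..L}. W y * Rem y) = (\<integral>t. \<kappa>0 t * G t \<partial>lborel)"
      proof -
        have "(LBINT y:{0..L}. W y * Rem y) = (\<integral>y. \<integral>t. indicator {0..L} y * W y * peano r y t * G t \<partial>lborel \<partial>lborel)"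
          unfolding set_lebesgue_integral_def Rem_def by (simp add: mult.assoc)
        also have "\<dots> = (\<integral>t. \<integral>y. indicator {0..L} y * W y * peano r y t * G t \<partial>lborel \<partial>lborel)"
          by (rule lborel_pair.Fubini_integral[OF F])
        also have "\<dots> = (\<integral>t. \<kappa>0 t * G t \<partial>lborel)" unfolding \<kappa>0_def by simp
        finally show ?thesis .
      qed
      have k0i: "integrable lborel (\<lambda>t. \<kappa>0 t * G t)"
        using lborel_pair.integrable_fst'[OF F] by (simp add: \<kappa>0_def)
      have pi: "integrable lborel (\<lambda>t. peano r y t * G t)" for y
      proof -
        have "set_integrable lborel {0..y} (\<lambda>t. (y - t) ^ (r - 1) / fact (r - 1) * G t)"
          by (intro set_integrable_cont continuous_intros continuous_on_subset[OF Gc]) auto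
        moreover have "indicator {0..y} t *\<^sub>R ((y - t) ^ (r - 1) / fact (r - 1) * G t) = peano r y t * G t" for t
          by (auto simp: peano_def indicator_def)
        ultimately show ?thesis by (simp add: set_integrable_def)
      qed
      have gi: "set_integrable lborel {0..L} (\<lambda>y. W y * g y)" "set_integrable lborel {0..L} (\<lambda>y. W y * poly P y)"
        by (rule ints, rule smooth1_continuous[OF g]) (rule ints, intro continuous_intros)
      have "(LBINT y:{0..L}. W y * Rem y) = (LBINT y:{0..L}. W y * g y - W y * poly P y)"
        by (rule set_lebesgue_integral_cong) (auto simp: taylor algebra_simps)
      also have "\<dots> = (LBINT y:{0..L}. W y * g y) - (LBINT y:{0..L}. W y * poly P y)"
        using gi by simp
      finally have "(LBINT y:{0..L}. W y * g y) = (\<Sum>l<r. \<mu> l * poly P (real l / real r)) + (\<integral>t. \<kappa>0 t * G t \<partial>lborel)"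
        unfolding Pint Rint by simp
      moreover have "(\<integral>t. \<kappa> t * G t \<partial>lborel) = (\<integral>t. \<kappa>0 t * G t \<partial>lborel) - (\<Sum>l<r. \<mu> l * Rem (real l / real r))"
      proof -
        have "(\<integral>t. \<kappa> t * G t \<partial>lborel) = (\<integral>t. \<kappa>0 t * G t - (\<Sum>l<r. \<mu> l * (peano r (real l / real r) t * G t)) \<partial>lborel)"
          by (simp add: \<kappa>_def algebra_simps sum_distrib_left)
        also have "\<dots> = (\<integral>t. \<kappa>0 t * G t \<partial>lborel) - (\<Sum>l<r. \<mu> l * Rem (real l / real r))"
          using k0i pi by (simp add: Rem_def)
        finally show ?thesis .
      qed
      moreover have "\<mu> l * g (real l / real r) = \<mu> l * poly P (real l / real r) + \<mu> l * Rem (real l / real r)" for l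
        by (subst taylor) (simp_all add: algebra_simps)
      ultimately show ?thesis by (simp add: G_def sum.distrib)
    qed
    have "\<bar>\<kappa> t\<bar> \<le> C * W t" for t
      using bound[of t] out[of t] W0[of t] \<open>C > 0\<close> by (cases "t \<in> {0..<L}") auto
    then show "\<exists>\<kappa>. peano_kernel r {0..<L} (\<lambda>t. C * W t) (\<lambda>g. (LBINT y:{0..L}. W y * g y) -
           (\<Sum>l<r. (LBINT y:{0..L}. W y * poly (lg l) y) * g (real l / real r))) \<kappa>"
      using \<kappa>m out eq unfolding peano_kernel_def by (intro exI[of _ \<kappa>]) (simp add: \<mu>_def)
  qed
qed

text \<open>
  The quadrature weights of the outermost cell are such moments, with the truncation point \<open>L n\<close> as upper limit. Their
  convergence makes the final quadrature independent of the truncation.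
\<close>

lemma moment_converges:
  fixes W :: "real \<Rightarrow> real" and L :: "nat \<Rightarrow> real"
  assumes "\<gamma> > 0" "K > 0" "continuous_on UNIV W" "\<And>y. W y \<ge> 0"
    and "\<And>y. 0 \<le> y \<Longrightarrow> W y \<le> K * exp (- \<gamma> * y)" and "filterlim L at_top sequentially"
  shows "convergent (\<lambda>n. LBINT y:{0..L n}. W y * poly q y)"
proof -
  obtain C where C: "C > 0" "\<And>u. u \<ge> 0 \<Longrightarrow> \<bar>poly q u\<bar> \<le> C * exp (\<gamma> / 2 * u)"
    using poly_le_exp[of "\<gamma> / 2"] assms(1) by (metis half_gt_zero)
  have Wm[measurable]: "W \<in> borel_measurable borel" using assms(3) by (rule borel_measurable_continuous_onI)
  have [measurable]: "(\<lambda>y. poly q y) \<in> borel_measurable borel"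
    by (intro borel_measurable_continuous_onI continuous_intros)
  have "set_integrable lebesgue {0..} (\<lambda>y::real. exp (- (\<gamma> / 2) * y))"
    using integrable_on_exp_minus_to_infinity[of "\<gamma> / 2" 0] assms(1)
    by (intro nonnegative_absolutely_integrable_1) auto
  then have E: "integrable lborel (\<lambda>y::real. indicator {0..} y * exp (- (\<gamma> / 2) * y))"
    unfolding set_integrable_def by (subst (asm) integrable_completion) auto
  have "(\<lambda>n. \<integral>y. indicator {0..L n} y *\<^sub>R (W y * poly q y) \<partial>lborel) \<longlonglongrightarrow> (\<integral>y. indicator {0..} y *\<^sub>R (W y * poly q y) \<partial>lborel)"
  proof (rule integral_dominated_convergence[where w = "\<lambda>y. (K * C) * (indicator {0..} y * exp (- (\<gamma> / 2) * y))"])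
    show "AE y in lborel. (\<lambda>n. indicat_real {0..L n} y *\<^sub>R (W y * poly q y)) \<longlonglongrightarrow> indicat_real {0..} y *\<^sub>R (W y * poly q y)"
    proof (rule AE_I2)
      fix y :: real
      have "\<forall>\<^sub>F n in sequentially. y \<le> L n"
        using assms(6) by (simp add: filterlim_at_top)
      then have "\<forall>\<^sub>F n in sequentially. indicat_real {0..L n} y *\<^sub>R (W y * poly q y) = indicat_real {0..} y *\<^sub>R (W y * poly q y)"
        by eventually_elim (auto simp: indicator_def)
      then show "(\<lambda>n. indicat_real {0..L n} y *\<^sub>R (W y * poly q y)) \<longlonglongrightarrow> indicat_real {0..} y *\<^sub>R (W y * poly q y)"
        by (rule tendsto_eventually)
    qed
    show "AE y in lborel. norm (indicat_real {0..L n} y *\<^sub>R (W y * poly q y)) \<le> (K * C) * (indicat_real {0..} y * exp (- (\<gamma> / 2) * y))" for n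
    proof (rule AE_I2)
      fix y :: real
      show "norm (indicat_real {0..L n} y *\<^sub>R (W y * poly q y)) \<le> (K * C) * (indicat_real {0..} y * exp (- (\<gamma> / 2) * y))"
      proof (cases "y \<in> {0..L n}")
        case True
        have "\<bar>W y * poly q y\<bar> \<le> (K * exp (- \<gamma> * y)) * (C * exp (\<gamma> / 2 * y))"
          unfolding abs_mult using True assms C(2)[of y] by (intro mult_mono) auto
        also have "\<dots> = (K * C) * (exp (- \<gamma> * y) * exp (\<gamma> / 2 * y))" by simp
        also have "exp (- \<gamma> * y) * exp (\<gamma> / 2 * y) = exp (- (\<gamma> / 2) * y)" by (simp add: algebra_simps flip: exp_add)
        finally show ?thesis using True by simp
      next
        case False
        then show ?thesis using assms C by simp
      qed
    qed
  qed (use E in auto)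
  then show ?thesis unfolding set_lebesgue_integral_def by (rule convergentI)
qed

section \<open>The one-dimensional weight\<close>

text \<open>
  The weight of dimension one is a Freud weight. The condition \<open>lam > 1\<close> makes its decay faster than exponential, so that the
  scale \<open>\<bar>t\<bar> powr (1 - lam)\<close> on which it varies shrinks away from the origin.
\<close>

locale freud =
  fixes a b lam :: real
  assumes a: "a > 0" and lam: "lam > 1"
begin

definition w1 :: "real \<Rightarrow> real" where
  "w1 t = exp (- a * \<bar>t\<bar> powr lam + b)"

lemma w1_pos: "w1 t > 0" by (simp add: w1_def)

lemma w1_minus: "w1 (- t) = w1 t" by (simp add: w1_def)

lemma w1_le: "w1 t \<le> exp b"
  using a by (simp add: w1_def)

lemma w1_continuous: "continuous_on S w1"
proof -
  have "continuous_on UNIV (\<lambda>t::real. \<bar>t\<bar> powr lam)"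
    using lam by (intro continuous_on_powr' continuous_intros) auto
  then have "continuous_on UNIV w1"
    unfolding w1_def by (intro continuous_on_exp continuous_on_add continuous_on_mult continuous_on_const)
  then show ?thesis by (rule continuous_on_subset) simp
qed

lemma powr_mvt:
  fixes x y :: real
  assumes "0 \<le> x" "x \<le> y"
  shows "lam * x powr (lam - 1) * (y - x) \<le> y powr lam - x powr lam"
    and "y powr lam - x powr lam \<le> lam * y powr (lam - 1) * (y - x)"
proof -
  have "lam * x powr (lam - 1) * (y - x) \<le> y powr lam - x powr lam \<and>
      y powr lam - x powr lam \<le> lam * y powr (lam - 1) * (y - x)"
  proof (cases "x = y")
    case False
    then have "x < y" using assms by simp
    moreover have "continuous_on {x..y} (\<lambda>t. t powr lam)"
      using assms lam by (intro continuous_on_powr' continuous_intros) auto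
    moreover have D: "((\<lambda>t. t powr lam) has_real_derivative lam * t powr (lam - 1)) (at t)" if "x < t" for t
      using that assms by (intro has_real_derivative_powr) auto
    ultimately obtain l z where z: "x < z" "z < y" "((\<lambda>t. t powr lam) has_real_derivative l) (at z)"
        "y powr lam - x powr lam = (y - x) * l"
      using MVT[of x y "\<lambda>t. t powr lam"] real_differentiable_def by blast
    have "l = lam * z powr (lam - 1)" using DERIV_unique[OF z(3) D[OF z(1)]] .
    moreover have "x powr (lam - 1) \<le> z powr (lam - 1)" "z powr (lam - 1) \<le> y powr (lam - 1)"
      using z assms lam by (auto intro!: powr_mono2)
    ultimately show ?thesis using z lam by (simp add: mult.commute)
  qed simp
  then show "lam * x powr (lam - 1) * (y - x) \<le> y powr lam - x powr lam"
    "y powr lam - x powr lam \<le> lam * y powr (lam - 1) * (y - x)" by auto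
qed

lemma w1_decreasing: "0 \<le> x \<Longrightarrow> x \<le> y \<Longrightarrow> w1 y \<le> w1 x"
  using a lam by (auto simp: w1_def intro!: powr_mono2)

text \<open>
  Convexity of \<open>\<bar>t\<bar> powr lam\<close> yields this and the next lemma: over a length \<open>h\<close> that is small compared to the scale of the weight,
  the weight is constant up to a factor, and if \<open>h\<close> is at least the scale at \<open>c\<close>, it decays exponentially in units of \<open>h\<close> from there on.
\<close>

lemma w1_ratio_le:
  assumes "0 \<le> x" "x \<le> y" "y \<le> x + h" "h * y powr (lam - 1) \<le> M"
  shows "w1 x \<le> exp (a * lam * M) * w1 y"
proof -
  have "y powr lam - x powr lam \<le> lam * y powr (lam - 1) * h"
    using powr_mvt(2)[OF assms(1,2)] assms(3) lam
    by (elim order_trans) (intro mult_left_mono, auto)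
  also have "\<dots> \<le> lam * M" using assms(4) lam by (simp add: mult.commute)
  finally have "a * (y powr lam - x powr lam) \<le> a * (lam * M)" using a by (intro mult_left_mono) auto
  then show ?thesis using assms by (simp add: w1_def algebra_simps flip: exp_add)
qed

lemma w1_ratio_ge:
  assumes "0 < c" "h * c powr (lam - 1) \<ge> 1" "0 \<le> t" "t \<le> y" "h \<ge> 0"
  shows "w1 (c + h * y) \<le> w1 (c + h * t) * exp (- (a * lam) * (y - t))"
proof -
  have "1 * (y - t) \<le> (h * c powr (lam - 1)) * (y - t)"
    using assms by (intro mult_right_mono) auto
  then have "lam * (y - t) \<le> lam * ((h * c powr (lam - 1)) * (y - t))"
    using lam by simp
  also have "\<dots> = lam * c powr (lam - 1) * (h * (y - t))" by simp
  also have "\<dots> \<le> lam * (c + h * t) powr (lam - 1) * (h * (y - t))"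
    using assms lam by (intro mult_right_mono mult_left_mono powr_mono2) auto
  also have "\<dots> = lam * (c + h * t) powr (lam - 1) * ((c + h * y) - (c + h * t))" by (simp add: algebra_simps)
  also have "\<dots> \<le> (c + h * y) powr lam - (c + h * t) powr lam"
    using assms by (intro powr_mvt) (auto intro: mult_left_mono)
  finally have "a * (lam * (y - t)) \<le> a * ((c + h * y) powr lam - (c + h * t) powr lam)"
    using a by (intro mult_left_mono) auto
  then show ?thesis using assms by (simp add: w1_def algebra_simps flip: exp_add)
qed

end

lemma LBINT_rescale:
  fixes F :: "real \<Rightarrow> real"
  assumes "h > 0"
  shows "(LBINT y:{c..e}. F y) = h * (LBINT u:{0..(e - c) / h}. F (c + h * u))"
proof -
  have i: "indicator {c..e} (c + h * u) = (indicator {0..(e - c) / h} u :: real)" for u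
    using assms by (auto simp: indicator_def pos_le_divide_eq mult.commute zero_le_mult_iff)
  show ?thesis unfolding set_lebesgue_integral_def
    using lborel_integral_real_affine[of h "\<lambda>y. indicator {c..e} y *\<^sub>R F y" c] assms by (simp add: i)
qed

lemma LBINT_combine:
  fixes F :: "real \<Rightarrow> real"
  assumes "continuous_on UNIV F" "x \<le> y" "y \<le> z"
  shows "(LBINT t:{x..z}. F t) = (LBINT t:{x..y}. F t) + (LBINT t:{y..z}. F t)"
proof -
  have c: "continuous_on {p..q} F" for p q using assms(1) by (rule continuous_on_subset) simp
  have "(LBINT t:{p..q}. F t) = integral {p..q} F" for p q
    by (rule set_borel_integral_eq_integral(2)[OF set_integrable_cont[OF c]])
  then show ?thesis
    using Henstock_Kurzweil_Integration.integral_combine[OF assms(2,3) integrable_continuous_real[OF c]] by simp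
qed

lemma LBINT_split_sum:
  fixes F :: "real \<Rightarrow> real" and c :: "nat \<Rightarrow> real"
  assumes "continuous_on UNIV F" "\<And>j. c j \<le> c (Suc j)"
  shows "(LBINT t:{c 0..c n}. F t) = (\<Sum>j<n. LBINT t:{c j..c (Suc j)}. F t)"
proof (induction n)
  case 0
  have "set_lebesgue_integral lborel {c 0..c 0} F = 0" 
    using LBINT_combine[OF assms(1), of "c 0" "c 0" "c 0"] by simp
  then show ?case by simp
next
  case (Suc n)
  have "c 0 \<le> c n" using lift_Suc_mono_le[of c, OF assms(2)] by blast
  from LBINT_combine[OF assms(1) this assms(2)[of n]] Suc show ?case by simp
qed

context freud begin

definition cell_error :: "nat \<Rightarrow> (nat \<Rightarrow> real poly) \<Rightarrow> real \<Rightarrow> real \<Rightarrow> real \<Rightarrow> (real \<Rightarrow> real) \<Rightarrow> real" where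
  "cell_error r lg c h e g = (LBINT y:{c..e}. w1 y * g y) -
    (\<Sum>l<r. h * (LBINT u:{0..(e - c) / h}. w1 (c + h * u) * poly (lg l) u) * g (c + h * (real l / real r)))"

text \<open>
  Rescaling a cell of length \<open>h\<close> to the unit cell multiplies the derivative of order \<open>r\<close> by \<open>h ^ r\<close>, which is the gain of the quadrature.
\<close>

lemma cell_peano_kernel:
  assumes r: "r \<ge> 1" and "\<gamma> > 0" "K > 0" and basis: "lagrange_basis r lg"
  obtains C where "C > 0"
    "\<And>c h e. h > 0 \<Longrightarrow> c + h \<le> e \<Longrightarrow> cell_weight K \<gamma> ((e - c) / h) (\<lambda>u. w1 (c + h * u)) \<Longrightarrow>
      \<exists>\<kappa>. peano_kernel r {c..<e} (\<lambda>t. C * h ^ r * w1 t) (cell_error r lg c h e) \<kappa>"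
proof -
  obtain C where C: "C > 0" and unit: "\<And>L W. L \<ge> 1 \<Longrightarrow> continuous_on UNIV W \<Longrightarrow> (\<And>y. W y \<ge> 0) \<Longrightarrow> cell_weight K \<gamma> L W \<Longrightarrow>
      \<exists>\<kappa>. peano_kernel r {0..<L} (\<lambda>t. C * W t) (\<lambda>g. (LBINT y:{0..L}. W y * g y) -
           (\<Sum>l<r. (LBINT y:{0..L}. W y * poly (lg l) y) * g (real l / real r))) \<kappa>"
    using unit_cell_peano_kernel[OF assms] by blast
  show ?thesis
  proof (rule that[OF C])
    fix c h e assume h: "h > 0" "c + h \<le> e"
      and cw: "cell_weight K \<gamma> ((e - c) / h) (\<lambda>u. w1 (c + h * u))"
    define L where "L = (e - c) / h"
    define W where "W u = w1 (c + h * u)" for u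
    have Wc: "continuous_on UNIV W" unfolding W_def
      by (rule continuous_on_compose2[OF w1_continuous[of UNIV]]) (auto intro!: continuous_intros)
    have "L \<ge> 1" using h by (simp add: L_def field_simps)
    moreover have "W y \<ge> 0" for y using w1_pos[of "c + h * y"] by (simp add: W_def)
    ultimately obtain \<kappa> where "peano_kernel r {0..<L} (\<lambda>t. C * W t) (\<lambda>g. (LBINT y:{0..L}. W y * g y) -
           (\<Sum>l<r. (LBINT y:{0..L}. W y * poly (lg l) y) * g (real l / real r))) \<kappa>"
      using unit[OF _ Wc] cw unfolding L_def W_def by blast
    then have \<kappa>: "\<kappa> \<in> borel_measurable borel" "\<And>t. t \<notin> {0..<L} \<Longrightarrow> \<kappa> t = 0" "\<And>t. \<bar>\<kappa> t\<bar> \<le> C * W t"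
       "\<And>g. smooth1 g \<Longrightarrow> (LBINT y:{0..L}. W y * g y) -
           (\<Sum>l<r. (LBINT y:{0..L}. W y * poly (lg l) y) * g (real l / real r)) = (\<integral>t. \<kappa> t * (deriv ^^ r) g t \<partial>lborel)"
      unfolding peano_kernel_def by blast+
    define \<kappa>' where "\<kappa>' t = h ^ r * \<kappa> ((t - c) / h)" for t
    have 1: "\<kappa>' \<in> borel_measurable borel" unfolding \<kappa>'_def using \<kappa>(1) by measurable
    have 2: "\<kappa>' t = 0" if "t \<notin> {c..<e}" for t
    proof -
      have "(t - c) / h \<notin> {0..<L}" using that h by (auto simp: L_def field_simps)
      then show ?thesis by (simp add: \<kappa>'_def \<kappa>(2))
    qed
    have 3: "\<bar>\<kappa>' t\<bar> \<le> C * h ^ r * w1 t" for t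
    proof -
      have "h ^ r * \<bar>\<kappa> ((t - c) / h)\<bar> \<le> h ^ r * (C * w1 t)"
        using h \<kappa>(3)[of "(t - c) / h"] by (intro mult_left_mono) (auto simp: W_def)
      then show ?thesis using h by (simp add: \<kappa>'_def abs_mult mult_ac)
    qed
    have 4: "cell_error r lg c h e g = (\<integral>t. \<kappa>' t * (deriv ^^ r) g t \<partial>lborel)" if g: "smooth1 g" for g
    proof -
      have g': "smooth1 (\<lambda>u. g (c + h * u))" "(deriv ^^ r) (\<lambda>u. g (c + h * u)) = (\<lambda>u. h ^ r * (deriv ^^ r) g (c + h * u))"
        using smooth1_affine(1)[OF g, of 1 h c] smooth1_affine(2)[OF g, of r 1 h c] by (simp_all add: add.commute)
      have "(\<integral>t. \<kappa>' t * (deriv ^^ r) g t \<partial>lborel) = h * (\<integral>u. \<kappa> u * (h ^ r * (deriv ^^ r) g (c + h * u)) \<partial>lborel)"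
        using lborel_integral_real_affine[of h "\<lambda>t. \<kappa>' t * (deriv ^^ r) g t" c] h by (simp add: \<kappa>'_def mult_ac)
      moreover have "(LBINT y:{c..e}. w1 y * g y) = h * (LBINT u:{0..L}. W u * g (c + h * u))"
        using LBINT_rescale[OF h(1), of c e "\<lambda>y. w1 y * g y"] by (simp add: L_def W_def)
      moreover have "h * (\<integral>u. \<kappa> u * (h ^ r * (deriv ^^ r) g (c + h * u)) \<partial>lborel) = h * ((LBINT u:{0..L}. W u * g (c + h * u)) -
           (\<Sum>l<r. (LBINT y:{0..L}. W y * poly (lg l) y) * g (c + h * (real l / real r))))"
        using \<kappa>(4)[OF g'(1)] unfolding g'(2) by simp
      ultimately show ?thesis unfolding cell_error_def
        by (simp add: L_def W_def sum_distrib_left right_diff_distrib mult.assoc)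
    qed
    show "\<exists>\<kappa>. peano_kernel r {c..<e} (\<lambda>t. C * h ^ r * w1 t) (cell_error r lg c h e) \<kappa>"
      using 1 2 3 4 unfolding peano_kernel_def by blast
  qed
qed

end

section \<open>Quadrature on a half-line\<close>

context freud begin
text \<open>The order of the error of a quadrature with about \<open>2 ^ k\<close> nodes on the line.\<close>

definition rate :: "nat \<Rightarrow> nat \<Rightarrow> real" where
  "rate r k = 2 powr (- (1 - 1 / lam) * real r * real k)"

text \<open>
  The cell length \<open>h = 2 powr (- (1 - 1 / lam) * k)\<close> and the number \<open>2 ^ (k + 1)\<close> of cells are balanced so
  that the cells end at \<open>T = 2 * 2 powr (k / lam)\<close>, where the natural length scale \<open>T powr (1 - lam)\<close> of the weight
  is of order \<open>h\<close>: the weight is constant up to a factor on every inner cell, and it decays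
  exponentially at the scale \<open>h\<close> on the last one, which therefore may be extended up to the truncation
  point \<open>n\<close>. The error is of order \<open>h ^ r\<close>. Only the quadrature weights of the last cell depend on \<open>n\<close>.
\<close>

lemma half_line_quadrature:
  assumes r: "r \<ge> 1"
  obtains C where "C > 0"
    "\<And>k::nat. \<exists>(X :: nat \<times> nat \<Rightarrow> real) M (n0::nat). (\<forall>i. convergent (M i)) \<and>
      (\<forall>n\<ge>n0. \<exists>\<kappa>. peano_kernel r {0..real n} (\<lambda>t. C * rate r k * w1 t)
        (\<lambda>g. (LBINT y:{0..real n}. w1 y * g y) - (\<Sum>i\<in>{..<2 ^ (k + 1)} \<times> {..<r}. M i n * g (X i))) \<kappa>)"
proof -
  define \<gamma> where "\<gamma> = a * lam"
  \<comment> \<open>bounds the factor by which the weight drops over a cell, and also absorbs \<open>exp \<gamma>\<close> on the inner cells\<close>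
  define K where "K = exp (a * lam * 2 powr (lam - 1))"
  have \<gamma>: "\<gamma> > 0" using a lam by (simp add: \<gamma>_def)
  have K: "K > 0" by (simp add: K_def)
  have two: "2 powr (lam - 1) \<ge> 1" using lam by (intro ge_one_powr_ge_zero) auto
  have K\<gamma>: "exp \<gamma> \<le> K"
    using mult_left_mono[OF two, of "a * lam"] a lam by (simp add: \<gamma>_def K_def)
  have K1: "K \<ge> 1" using K\<gamma> \<gamma> one_le_exp_iff[of \<gamma>] by linarith
  obtain lg where basis: "lagrange_basis r lg" using lagrange_basis_exists[OF r] by blast
  obtain C where C: "C > 0" and cell: "\<And>c h e. h > 0 \<Longrightarrow> c + h \<le> e \<Longrightarrow> cell_weight K \<gamma> ((e - c) / h) (\<lambda>u. w1 (c + h * u)) \<Longrightarrow>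
      \<exists>\<kappa>. peano_kernel r {c..<e} (\<lambda>t. C * h ^ r * w1 t) (cell_error r lg c h e) \<kappa>"
    using cell_peano_kernel[OF r \<gamma> K basis] by blast
  show ?thesis
  proof (rule that[OF C])
    fix k :: nat
    define h where "h = 2 powr (- (1 - 1 / lam) * real k)"
    define N :: nat where "N = 2 ^ (k + 1)"
    have h: "h > 0" by (simp add: h_def)
    have hr: "rate r k = h ^ r"
      by (simp add: rate_def h_def powr_powr mult_ac flip: powr_realpow)
    have N: "real N = 2 * 2 powr real k" by (simp add: N_def powr_realpow)
    have N2: "N \<ge> 2" by (simp add: N_def)
    \<comment> \<open>half of the cells reach the point \<open>2 powr (k / lam)\<close>, where the scale of the weight is exactly \<open>h\<close>\<close>
    have half: "2 powr real k * h = 2 powr (real k / lam)"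
      using lam by (simp add: h_def field_simps flip: powr_add)
    have key: "h * (2 powr (real k / lam)) powr (lam - 1) = 1"
      using lam by (simp add: h_def powr_powr field_simps flip: powr_add)
    have top: "h * (real N * h) powr (lam - 1) = 2 powr (lam - 1)"
    proof -
      have "(real N * h) powr (lam - 1) = 2 powr (lam - 1) * (2 powr (real k / lam)) powr (lam - 1)"
        unfolding N mult.assoc half by (simp add: powr_mult)
      then show ?thesis using key by simp
    qed
    have last: "h * (real (N - 1) * h) powr (lam - 1) \<ge> 1"
    proof -
      have "1 \<le> 2 powr real k" by (intro ge_one_powr_ge_zero) auto
      moreover have "real (N - 1) = real N - 1" using N2 by simp
      ultimately have "2 powr real k \<le> real (N - 1)" using N by linarith
      then have "2 powr (real k / lam) \<le> real (N - 1) * h" unfolding half[symmetric] using h by (intro mult_right_mono) auto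
      then have "h * (2 powr (real k / lam)) powr (lam - 1) \<le> h * (real (N - 1) * h) powr (lam - 1)"
        using h lam by (intro mult_left_mono powr_mono2) auto
      then show ?thesis using key by simp
    qed
    define c where "c n j = (if j < N then real j * h else real n)" for n j :: nat
    define X where "X = (\<lambda>(j::nat, l::nat). real j * h + h * (real l / real r))"
    define M where "M = (\<lambda>(j, l) n. h * (LBINT u:{0..(c n (Suc j) - c n j) / h}. w1 (c n j + h * u) * poly (lg l) u))"
    define n0 where "n0 = nat \<lceil>real N * h\<rceil>"
    have n0: "real N * h \<le> real n" if "n \<ge> n0" for n
      using that unfolding n0_def by linarith
    have near: "w1 (real j * h) \<le> K * w1 (real j * h + h * t)" if "j < N" "0 \<le> t" "t \<le> 1" for j t
      unfolding K_def
    proof (rule w1_ratio_le[where h = h])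
      have "real j * h + h * t \<le> real N * h"
      proof -
        have "real j * h + h * t \<le> (real j + 1) * h" using that h by (simp add: algebra_simps)
        also have "\<dots> \<le> real N * h" using that h by (intro mult_right_mono) auto
        finally show ?thesis .
      qed
      then have "h * (real j * h + h * t) powr (lam - 1) \<le> h * (real N * h) powr (lam - 1)"
        using h that lam by (intro mult_left_mono powr_mono2) auto
      then show "h * (real j * h + h * t) powr (lam - 1) \<le> 2 powr (lam - 1)" using top by simp
    qed (use that h in auto)
    have weights_converge: "convergent (M i)" for i
    proof (cases i)
      case (Pair j l)
      show ?thesis
      proof (cases "Suc j = N")
        case False
        then have "j < N \<longleftrightarrow> Suc j < N" by auto
        show ?thesis
        proof (cases "j < N")
          case True
          then have "M i = (\<lambda>n. M i 0)" using False by (auto simp: M_def Pair c_def)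
          then show ?thesis by (metis convergent_const)
        next
          case F: False
          have "set_lebesgue_integral lborel {0..0::real} g = (0::real)" if "continuous_on UNIV g" for g
            using LBINT_combine[OF that, of 0 0 0] by simp
          moreover have "continuous_on UNIV (\<lambda>u. w1 (real n + h * u) * poly (lg l) u)" for n
            by (intro continuous_intros continuous_on_compose2[OF w1_continuous[of UNIV]]) auto
          ultimately have "M i = (\<lambda>n. 0)" using False F by (auto simp: M_def Pair c_def)
          then show ?thesis by (simp add: convergent_const)
        qed
      next
        case True
        then have j: "j < N" "\<not> Suc j < N" "j = N - 1" by auto
        define W where "W u = w1 (real j * h + h * u)" for u
        have "convergent (\<lambda>n. LBINT u:{0..(real n - real j * h) / h}. W u * poly (lg l) u)"
        proof (rule moment_converges[where \<gamma> = \<gamma> and K = "w1 (real j * h)"])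
          show "continuous_on UNIV W" unfolding W_def
            by (rule continuous_on_compose2[OF w1_continuous[of UNIV]]) (auto intro!: continuous_intros)
          show "W y \<ge> 0" for y using w1_pos by (simp add: W_def less_imp_le)
          show "W y \<le> w1 (real j * h) * exp (- \<gamma> * y)" if "0 \<le> y" for y
          proof -
            have "real j * h > 0" using j(3) N2 h by simp
            from w1_ratio_ge[OF this, of h 0 y] show ?thesis using last that h by (simp add: W_def \<gamma>_def j(3))
          qed
          show "filterlim (\<lambda>n. (real n - real j * h) / h) at_top sequentially"
            unfolding filterlim_at_top eventually_sequentially
          proof (intro allI exI impI)
            fix Z n assume "nat \<lceil>Z * h + real j * h\<rceil> \<le> n"
            then have "Z * h + real j * h \<le> real n" by linarith
            then show "Z \<le> (real n - real j * h) / h" using h by (simp add: pos_le_divide_eq)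
          qed
        qed (use \<gamma> w1_pos in auto)
        from convergent_mult[OF convergent_const[of h] this] show ?thesis
          using j by (simp add: M_def Pair c_def W_def)
      qed
    qed
    have main: "\<exists>\<kappa>. peano_kernel r {0..real n} (\<lambda>t. C * h ^ r * w1 t)
        (\<lambda>g. (LBINT y:{0..real n}. w1 y * g y) - (\<Sum>i\<in>{..<N} \<times> {..<r}. M i n * g (X i))) \<kappa>" if n: "n \<ge> n0" for n
    proof -
      have ch: "c n j + h \<le> c n (Suc j)" if "j < N" for j
      proof (cases "Suc j < N")
        case False
        then have "Suc j = N" using that by simp
        then have "real N = real j + 1" by auto
        then have "real j * h + h = real N * h" by (simp add: algebra_simps)
        then show ?thesis using n0[OF n] that False by (simp add: c_def)
      qed (simp add: c_def algebra_simps)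
      have mono: "c n j \<le> c n (Suc j)" for j
        using ch[of j] h by (cases "j < N") (auto simp: c_def)
      then have mono': "i \<le> j \<Longrightarrow> c n i \<le> c n j" for i j by (simp add: lift_Suc_mono_le)
      have decay: "w1 (c n j + h * y) \<le> K * w1 (c n j + h * t) * exp (- \<gamma> * (y - t))"
        if j: "j < N" and t: "0 \<le> t" "t \<le> y" "c n j + h * y \<le> c n (Suc j)" for j t y
      proof -
        show ?thesis
        proof (cases "Suc j < N")
          case True
          then have "h * y \<le> h * 1" using t j by (simp add: c_def algebra_simps)
          then have y: "y \<le> 1" using h by simp
          have "w1 (c n j + h * y) \<le> w1 (c n j + h * t)"
            using t h j by (intro w1_decreasing) (auto simp: c_def intro!: mult_left_mono)
          also have "\<dots> \<le> (K * exp (- \<gamma> * (y - t))) * w1 (c n j + h * t)"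
          proof -
            have "\<gamma> * (y - t) \<le> \<gamma> * 1" using y t \<gamma> by (intro mult_left_mono) auto
            then have "1 \<le> exp \<gamma> * exp (- \<gamma> * (y - t))" by (simp flip: exp_add)
            also have "\<dots> \<le> K * exp (- \<gamma> * (y - t))" using K\<gamma> by (intro mult_right_mono) auto
            finally show ?thesis using w1_pos[of "c n j + h * t"] by (simp add: mult_le_cancel_right1)
          qed
          finally show ?thesis by (simp add: mult_ac)
        next
          case False
          then have j': "j = N - 1" using j by simp
          have "c n j > 0" using j' N2 h by (simp add: c_def)
          then have "w1 (c n j + h * y) \<le> w1 (c n j + h * t) * exp (- \<gamma> * (y - t))"
            unfolding \<gamma>_def using t h last j j' by (intro w1_ratio_ge) (auto simp: c_def)
          also have "\<dots> \<le> K * (w1 (c n j + h * t) * exp (- \<gamma> * (y - t)))"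
            using mult_right_mono[OF K1, of "w1 (c n j + h * t) * exp (- \<gamma> * (y - t))"] w1_pos[of "c n j + h * t"]
            by (simp add: less_imp_le)
          finally show ?thesis by simp
        qed
      qed
      have "\<exists>\<kappa>. peano_kernel r {c n j..<c n (Suc j)} (\<lambda>t. C * h ^ r * w1 t) (cell_error r lg (c n j) h (c n (Suc j))) \<kappa>"
        if j: "j < N" for j
      proof (rule cell[OF h ch[OF j]])
        show "cell_weight K \<gamma> ((c n (Suc j) - c n j) / h) (\<lambda>u. w1 (c n j + h * u))"
          unfolding cell_weight_def
        proof (intro conjI allI impI)
          show "w1 (c n j + h * 0) \<le> K * w1 (c n j + h * t)" if "0 \<le> t" "t \<le> 1" for t
            using near[OF j that] j by (simp add: c_def)
          show "w1 (c n j + h * y) \<le> K * w1 (c n j + h * t) * exp (- \<gamma> * (y - t))"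
            if "0 \<le> t" "t \<le> y" "y \<le> (c n (Suc j) - c n j) / h" for t y
            using that h by (intro decay[OF j]) (simp_all add: field_simps)
        qed
      qed
      then obtain \<kappa> where "\<And>j. j < N \<Longrightarrow> peano_kernel r {c n j..<c n (Suc j)} (\<lambda>t. C * h ^ r * w1 t) (cell_error r lg (c n j) h (c n (Suc j))) (\<kappa> j)"
        by metis
      then have \<kappa>: "\<And>j. j < N \<Longrightarrow> \<kappa> j \<in> borel_measurable borel" "\<And>j t. j < N \<Longrightarrow> t \<notin> {c n j..<c n (Suc j)} \<Longrightarrow> \<kappa> j t = 0"
        "\<And>j t. j < N \<Longrightarrow> \<bar>\<kappa> j t\<bar> \<le> C * h ^ r * w1 t"
        "\<And>j g. j < N \<Longrightarrow> smooth1 g \<Longrightarrow> cell_error r lg (c n j) h (c n (Suc j)) g = (\<integral>t. \<kappa> j t * (deriv ^^ r) g t \<partial>lborel)"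
        unfolding peano_kernel_def by blast+
      have c0: "c n 0 = 0" "c n N = real n" using N2 by (auto simp: c_def)
      have out: "\<kappa> j t = 0" if "t \<notin> {0..real n}" "j < N" for t j
        using \<kappa>(2)[OF that(2), of t] that(1) mono'[of 0 j] mono'[of "Suc j" N] c0 that(2) by (cases "t \<in> {c n j..<c n (Suc j)}") auto
      have bk: "bounded_kernel (real n) (\<kappa> j)" if "j < N" for j
      proof -
        have "\<bar>\<kappa> j t\<bar> \<le> C * h ^ r * exp b" for t
          using \<kappa>(3)[OF that, of t] mult_left_mono[OF w1_le[of t], of "C * h ^ r"] C h by (auto intro: order_trans)
        moreover have "\<kappa> j y = 0" if "\<bar>y\<bar> > real n" for y
          using that by (intro out \<open>j < N\<close>) auto
        ultimately show ?thesis using \<kappa>(1)[OF that] unfolding bounded_kernel_def by blast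
      qed
      define \<kappa>' where "\<kappa>' t = (\<Sum>j<N. \<kappa> j t)" for t
      have "\<bar>\<kappa>' t\<bar> \<le> C * h ^ r * w1 t" for t
      proof (cases "\<exists>j<N. t \<in> {c n j..<c n (Suc j)}")
        case True
        then obtain j where j: "j < N" "t \<in> {c n j..<c n (Suc j)}" by blast
        have "\<kappa> i t = 0" if "i < N" "i \<noteq> j" for i
        proof (rule \<kappa>(2)[OF that(1)])
          show "t \<notin> {c n i..<c n (Suc i)}"
          proof (cases "i < j")
            case True
            then have "c n (Suc i) \<le> c n j" by (intro mono') simp
            then show ?thesis using j by auto
          next
            case False
            then have "c n (Suc j) \<le> c n i" using that by (intro mono') simp
            then show ?thesis using j by auto
          qed
        qed
        then have "\<kappa>' t = \<kappa> j t" unfolding \<kappa>'_def using j by (subst sum.remove[of _ j]) (auto intro!: sum.neutral)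
        then show ?thesis using \<kappa>(3)[OF j(1)] by simp
      next
        case False
        then have "\<kappa>' t = 0" unfolding \<kappa>'_def using \<kappa>(2) by (intro sum.neutral) auto
        then show ?thesis using C h w1_pos[of t] by (simp add: less_imp_le)
      qed
      moreover have "\<kappa>' \<in> borel_measurable borel" unfolding \<kappa>'_def using \<kappa>(1) by (intro borel_measurable_sum) auto
      moreover have "\<kappa>' t = 0" if "t \<notin> {0..real n}" for t unfolding \<kappa>'_def using out that by (intro sum.neutral) auto
      moreover have "(LBINT y:{0..real n}. w1 y * g y) - (\<Sum>i\<in>{..<N} \<times> {..<r}. M i n * g (X i))
          = (\<integral>t. \<kappa>' t * (deriv ^^ r) g t \<partial>lborel)" if g: "smooth1 g" for g
      proof -
        have "(LBINT y:{0..real n}. w1 y * g y) = (\<Sum>j<N. LBINT y:{c n j..c n (Suc j)}. w1 y * g y)"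
          using LBINT_split_sum[of "\<lambda>y. w1 y * g y" "c n" N] mono c0 w1_continuous smooth1_continuous[OF g]
          by (simp add: continuous_on_mult)
        also have "\<dots> = (\<Sum>j<N. (\<Sum>l<r. M (j, l) n * g (X (j, l))) + (\<integral>t. \<kappa> j t * (deriv ^^ r) g t \<partial>lborel))"
          using \<kappa>(4)[OF _ g] by (intro sum.cong) (auto simp: cell_error_def M_def X_def c_def algebra_simps)
        also have "\<dots> = (\<Sum>j<N. \<Sum>l<r. M (j, l) n * g (X (j, l))) + (\<Sum>j<N. \<integral>t. \<kappa> j t * (deriv ^^ r) g t \<partial>lborel)"
          by (rule sum.distrib)
        also have "(\<Sum>j<N. \<Sum>l<r. M (j, l) n * g (X (j, l))) = (\<Sum>i\<in>{..<N} \<times> {..<r}. M i n * g (X i))"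
          by (simp add: sum.cartesian_product split_def)
        also have "(\<Sum>j<N. \<integral>t. \<kappa> j t * (deriv ^^ r) g t \<partial>lborel) = (\<integral>t. \<kappa>' t * (deriv ^^ r) g t \<partial>lborel)"
          unfolding \<kappa>'_def sum_distrib_right
          by (rule Bochner_Integration.integral_sum[symmetric])
             (use bk in \<open>auto intro!: bounded_kernel_times_integrable smooth1_continuous smooth1_derivs g\<close>)
        finally show ?thesis by simp
      qed
      ultimately show ?thesis unfolding peano_kernel_def by (intro exI[of _ \<kappa>'] conjI allI impI) auto
    qed
    show "\<exists>(X :: nat \<times> nat \<Rightarrow> real) M (n0::nat). (\<forall>i. convergent (M i)) \<and>
      (\<forall>n\<ge>n0. \<exists>\<kappa>. peano_kernel r {0..real n} (\<lambda>t. C * rate r k * w1 t)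
        (\<lambda>g. (LBINT y:{0..real n}. w1 y * g y) - (\<Sum>i\<in>{..<2 ^ (k + 1)} \<times> {..<r}. M i n * g (X i))) \<kappa>)"
      using weights_converge main unfolding hr N_def by blast
  qed
qed

end

section \<open>Mollified differences of quadratures\<close>

lemma bounded_kernel_diff:
  assumes "bounded_kernel R \<kappa>" "bounded_kernel R \<kappa>'"
  shows "bounded_kernel R (\<lambda>t. \<kappa> t - \<kappa>' t)"
proof -
  from assms obtain B B' where B: "\<And>y. \<bar>\<kappa> y\<bar> \<le> B" "\<And>y. \<bar>\<kappa>' y\<bar> \<le> B'" unfolding bounded_kernel_def by blast
  have "\<bar>\<kappa> y - \<kappa>' y\<bar> \<le> B + B'" for y using B(1)[of y] B(2)[of y] by linarith
  then show ?thesis using assms unfolding bounded_kernel_def by auto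
qed

lemma bounded_kernel_scale:
  assumes "bounded_kernel R \<kappa>" shows "bounded_kernel R (\<lambda>t. c * \<kappa> t)"
proof -
  from assms obtain B where "\<And>y. \<bar>\<kappa> y\<bar> \<le> B" unfolding bounded_kernel_def by blast
  then have "\<bar>c * \<kappa> y\<bar> \<le> \<bar>c\<bar> * B" for y unfolding abs_mult by (intro mult_left_mono) auto
  then show ?thesis using assms unfolding bounded_kernel_def by auto
qed

lemma convolution_diff:
  assumes "bounded_kernel R \<kappa>" "bounded_kernel R \<kappa>'" "continuous_on UNIV \<phi>"
  shows "convolution (\<lambda>t. \<kappa> t - \<kappa>' t) \<phi> x = convolution \<kappa> \<phi> x - convolution \<kappa>' \<phi> x"
proof -
  have "continuous_on UNIV (\<lambda>y. \<phi> (x - y))"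
    by (rule continuous_on_compose2[OF assms(3)]) (auto intro!: continuous_intros)
  then show ?thesis unfolding convolution_def left_diff_distrib
    using assms by (intro Bochner_Integration.integral_diff bounded_kernel_times_integrable)
qed

lemma convolution_mollifier_close:
  assumes "bounded_kernel R \<kappa>" "e > 0" "\<And>y. \<bar>x - y\<bar> \<le> e \<Longrightarrow> \<bar>\<kappa> y - v\<bar> \<le> \<delta>"
  shows "\<bar>convolution \<kappa> (mollifier e) x - v\<bar> \<le> \<delta>"
proof -
  have c: "continuous_on UNIV (\<lambda>y. mollifier e (x - y))"
    by (rule continuous_on_compose2[OF smooth1_continuous[OF smooth1_mollifier, of UNIV]]) (auto intro!: continuous_intros)
  have I: "integrable lborel (\<lambda>y. \<kappa> y * mollifier e (x - y))" "integrable lborel (\<lambda>y. v * mollifier e (x - y))"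
    using bounded_kernel_times_integrable[OF assms(1) c] mollifier_shift(1) by auto
  have "convolution \<kappa> (mollifier e) x - v = (\<integral>y. \<kappa> y * mollifier e (x - y) - v * mollifier e (x - y) \<partial>lborel)"
    using I assms(2) by (simp add: convolution_def mollifier_shift(2) mollifier_integral)
  also have "\<bar>\<dots>\<bar> \<le> (\<integral>y. \<delta> * mollifier e (x - y) \<partial>lborel)"
  proof (rule order_trans[OF integral_abs_bound], rule integral_mono)
    fix y
    show "\<bar>\<kappa> y * mollifier e (x - y) - v * mollifier e (x - y)\<bar> \<le> \<delta> * mollifier e (x - y)"
    proof (cases "\<bar>x - y\<bar> \<le> e")
      case True
      have "\<bar>\<kappa> y * mollifier e (x - y) - v * mollifier e (x - y)\<bar> = \<bar>\<kappa> y - v\<bar> * mollifier e (x - y)"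
        by (simp add: mollifier_nonneg abs_mult flip: left_diff_distrib)
      then show ?thesis using assms(3)[OF True] by (simp add: mult_right_mono mollifier_nonneg)
    qed (simp add: mollifier_eq_0)
  qed (use I mollifier_shift(1) in auto)
  also have "\<dots> = \<delta>" using assms(2) by (simp add: mollifier_shift(2) mollifier_integral)
  finally show ?thesis .
qed

text \<open>
  The dual form of a Peano kernel: when \<open>D\<close> is paired with a function, integration by parts moves the
  derivative of order \<open>r\<close> to that function, and \<open>A\<close> and \<open>B\<close> become the kernels.
\<close>

definition smooth_split :: "nat \<Rightarrow> (real \<Rightarrow> real) \<Rightarrow> (real \<Rightarrow> real) \<Rightarrow> bool" where
  "smooth_split r V D \<longleftrightarrow> (\<exists>A B u. (\<forall>x. D x = A x + (deriv ^^ r) (B :: real \<Rightarrow> real) x) \<and> smooth1 A \<and> smooth1 B \<and>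
    (\<forall>x. \<bar>x\<bar> > u \<longrightarrow> A x = 0 \<and> B x = 0) \<and> (\<forall>x. \<bar>A x\<bar> \<le> V x \<and> \<bar>B x\<bar> \<le> V x))"

context freud begin

lemma peano_kernel_bounded:
  assumes "peano_kernel r {-R..R} (\<lambda>t. c * w1 t) E \<kappa>" "c \<ge> 0" shows "bounded_kernel R \<kappa>"
proof -
  have "\<bar>\<kappa> t\<bar> \<le> c * exp b" for t
    using assms mult_left_mono[OF w1_le[of t] assms(2)] unfolding peano_kernel_def by (meson order_trans)
  moreover have "\<kappa> t = 0" if "\<bar>t\<bar> > R" for t
  proof -
    have "t \<notin> {-R..R}" using that by auto
    then show ?thesis using assms(1) by (simp add: peano_kernel_def)
  qed
  ultimately show ?thesis using assms(1) unfolding bounded_kernel_def peano_kernel_def by blast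
qed

text \<open>
  The two half-lines are exchanged by the reflection \<open>t \<mapsto> - t\<close>, which multiplies the derivative of order
  \<open>r\<close> by \<open>(-1) ^ r\<close>; the Boolean component of a node index selects the half-line.
\<close>

lemma line_quadrature:
  assumes r: "r \<ge> 1"
  obtains C where "C > 0"
    "\<And>k::nat. \<exists>(X :: bool \<times> nat \<times> nat \<Rightarrow> real) M (n0::nat). (\<forall>i. convergent (M i)) \<and>
      (\<forall>n\<ge>n0. \<exists>\<kappa>. peano_kernel r {- real n..real n} (\<lambda>t. C * rate r k * w1 t) (\<lambda>g. (LBINT y:{- real n..real n}. w1 y * g y) -
           (\<Sum>i\<in>UNIV \<times> {..<2 ^ (k + 1)} \<times> {..<r}. M i n * g (X i))) \<kappa>)"
proof -
  obtain C where C: "C > 0" and half: "\<And>k::nat. \<exists>(X :: nat \<times> nat \<Rightarrow> real) M (n0::nat). (\<forall>i. convergent (M i)) \<and>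
      (\<forall>n\<ge>n0. \<exists>\<kappa>. peano_kernel r {0..real n} (\<lambda>t. C * rate r k * w1 t)
        (\<lambda>g. (LBINT y:{0..real n}. w1 y * g y) - (\<Sum>i\<in>{..<2 ^ (k + 1)} \<times> {..<r}. M i n * g (X i))) \<kappa>)"
    using half_line_quadrature[OF r] by blast
  show ?thesis
  proof (rule that[of "2 * C"])
    show "2 * C > 0" using C by simp
    fix k :: nat
    define q where "q = rate r k"
    have q: "q > 0" by (simp add: q_def rate_def)
    define J :: "(nat \<times> nat) set" where "J = {..<2 ^ (k + 1)} \<times> {..<r}"
    obtain X :: "nat \<times> nat \<Rightarrow> real" and M and n0 :: nat where M: "\<And>i. convergent (M i)"
      and ex: "\<And>n. n \<ge> n0 \<Longrightarrow> \<exists>\<kappa>. peano_kernel r {0..real n} (\<lambda>t. C * q * w1 t)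
        (\<lambda>g. (LBINT y:{0..real n}. w1 y * g y) - (\<Sum>i\<in>J. M i n * g (X i))) \<kappa>"
      using half[of k] unfolding q_def[symmetric] J_def[symmetric] by blast
    define X' where "X' = (\<lambda>(s, i). if s then X i else - X i)"
    have main: "\<exists>\<kappa>. peano_kernel r {- real n..real n} (\<lambda>t. 2 * C * q * w1 t)
        (\<lambda>g. (LBINT y:{- real n..real n}. w1 y * g y) - (\<Sum>i\<in>UNIV \<times> J. M (snd i) n * g (X' i))) \<kappa>" if n: "n \<ge> n0" for n
    proof -
      obtain \<kappa> where "peano_kernel r {0..real n} (\<lambda>t. C * q * w1 t)
        (\<lambda>g. (LBINT y:{0..real n}. w1 y * g y) - (\<Sum>i\<in>J. M i n * g (X i))) \<kappa>"
        using ex[OF n] by blast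
      then have \<kappa>: "\<kappa> \<in> borel_measurable borel" "\<And>t. t \<notin> {0..real n} \<Longrightarrow> \<kappa> t = 0" "\<And>t. \<bar>\<kappa> t\<bar> \<le> C * q * w1 t"
        "\<And>g. smooth1 g \<Longrightarrow> (LBINT y:{0..real n}. w1 y * g y) - (\<Sum>i\<in>J. M i n * g (X i)) = (\<integral>t. \<kappa> t * (deriv ^^ r) g t \<partial>lborel)"
        unfolding peano_kernel_def by blast+
      define \<kappa>m where "\<kappa>m t = (-1) ^ r * \<kappa> (- t)" for t
      have \<kappa>m: "\<kappa>m \<in> borel_measurable borel" "\<bar>\<kappa>m t\<bar> \<le> C * q * w1 t" for t
        using \<kappa>(1) \<kappa>(3)[of "-t"] unfolding \<kappa>m_def by (measurable, simp add: abs_mult w1_minus)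
      have out: "\<kappa> t = 0" "\<kappa>m t = 0" if "t \<notin> {- real n..real n}" for t
        using \<kappa>(2)[of t] \<kappa>(2)[of "- t"] that by (auto simp: \<kappa>m_def)
      have bk: "bounded_kernel (real n) \<kappa>" "bounded_kernel (real n) \<kappa>m"
        by (rule peano_kernel_bounded[where r = r and c = "C * q" and E = "\<lambda>g. \<integral>t. \<kappa> t * (deriv ^^ r) g t \<partial>lborel"]
            peano_kernel_bounded[where r = r and c = "C * q" and E = "\<lambda>g. \<integral>t. \<kappa>m t * (deriv ^^ r) g t \<partial>lborel"],
            use C q \<kappa> \<kappa>m out in \<open>simp_all add: peano_kernel_def\<close>)+
      define \<kappa>' where "\<kappa>' t = \<kappa> t - (-1) * \<kappa>m t" for t
      have "\<kappa>' \<in> borel_measurable borel" unfolding \<kappa>'_def using \<kappa>(1) \<kappa>m(1) by measurable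
      moreover have "\<kappa>' t = 0" if "t \<notin> {- real n..real n}" for t using out[OF that] by (simp add: \<kappa>'_def)
      moreover have "\<bar>\<kappa>' t\<bar> \<le> 2 * C * q * w1 t" for t
      proof -
        show ?thesis using \<kappa>(3)[of t] \<kappa>m(2)[of t] unfolding \<kappa>'_def by linarith
      qed
      moreover have "(LBINT y:{- real n..real n}. w1 y * g y) - (\<Sum>i\<in>UNIV \<times> J. M (snd i) n * g (X' i))
          = (\<integral>t. \<kappa>' t * (deriv ^^ r) g t \<partial>lborel)" if g: "smooth1 g" for g
      proof -
        define G where "G = (deriv ^^ r) g"
        have g': "smooth1 (\<lambda>y. g (- y))" "(deriv ^^ r) (\<lambda>y. g (- y)) = (\<lambda>y. (-1) ^ r * G (- y))"
          using smooth1_affine(1)[OF g, of 1 "-1" 0] smooth1_affine(2)[OF g, of r 1 "-1" 0] by (simp_all add: G_def)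
        have Gc: "continuous_on UNIV G" unfolding G_def by (intro smooth1_continuous smooth1_derivs g)
        have "(LBINT y:{- real n..0}. w1 y * g y) = (LBINT y:{0..real n}. w1 y * g (- y))"
        proof -
          have "indicator {- real n..0} (- y) = (indicator {0..real n} y :: real)" for y by (auto simp: indicator_def)
          then show ?thesis unfolding set_lebesgue_integral_def
            using lborel_integral_real_affine[of "-1" "\<lambda>y. indicator {- real n..0} y *\<^sub>R (w1 y * g y)" 0] by (simp add: w1_minus)
        qed
        moreover have "(LBINT y:{- real n..real n}. w1 y * g y) = (LBINT y:{- real n..0}. w1 y * g y) + (LBINT y:{0..real n}. w1 y * g y)"
          by (rule LBINT_combine[OF continuous_on_mult[OF w1_continuous smooth1_continuous[OF g]]]) auto
        moreover have "(\<integral>t. \<kappa> t * ((-1) ^ r * G (- t)) \<partial>lborel) = (\<integral>t. \<kappa>m t * G t \<partial>lborel)"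
          using lborel_integral_real_affine[of "-1" "\<lambda>t. \<kappa> t * ((-1) ^ r * G (- t))" 0] by (simp add: \<kappa>m_def mult_ac)
        moreover have "(\<integral>t. \<kappa>' t * G t \<partial>lborel) = (\<integral>t. \<kappa> t * G t \<partial>lborel) + (\<integral>t. \<kappa>m t * G t \<partial>lborel)"
          using bounded_kernel_times_integrable[OF bk(1) Gc] bounded_kernel_times_integrable[OF bk(2) Gc]
          by (simp add: \<kappa>'_def algebra_simps)
        moreover have "(\<Sum>i\<in>UNIV \<times> J. M (snd i) n * g (X' i)) = (\<Sum>i\<in>J. M i n * g (X i)) + (\<Sum>i\<in>J. M i n * g (- X i))"
        proof -
          have "(\<Sum>i\<in>UNIV \<times> J. M (snd i) n * g (X' i)) = (\<Sum>s\<in>UNIV. \<Sum>i\<in>J. M i n * g (X' (s, i)))"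
            by (simp add: sum.cartesian_product split_def)
          then show ?thesis by (simp add: UNIV_bool X'_def)
        qed
        ultimately show ?thesis using \<kappa>(4)[OF g] \<kappa>(4)[OF g'(1)] unfolding g'(2) by (simp add: G_def)
      qed
      ultimately show ?thesis unfolding peano_kernel_def by blast
    qed
    show "\<exists>(X :: bool \<times> nat \<times> nat \<Rightarrow> real) M (n0::nat). (\<forall>i. convergent (M i)) \<and>
      (\<forall>n\<ge>n0. \<exists>\<kappa>. peano_kernel r {- real n..real n} (\<lambda>t. 2 * C * rate r k * w1 t) (\<lambda>g. (LBINT y:{- real n..real n}. w1 y * g y) -
           (\<Sum>i\<in>UNIV \<times> {..<2 ^ (k + 1)} \<times> {..<r}. M i n * g (X i))) \<kappa>)"
      unfolding q_def[symmetric] J_def[symmetric]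
      by (rule exI[of _ X'], rule exI[of _ "\<lambda>i. M (snd i)"], rule exI[of _ n0]) (use M main in blast)
  qed
qed

lemma w1_doubling_radius:
  obtains e where "e > 0" "e \<le> 1 / (real n + 1)" "\<And>x y. \<bar>y\<bar> \<le> real n \<Longrightarrow> \<bar>x - y\<bar> \<le> e \<Longrightarrow> w1 y \<le> 2 * w1 x"
proof -
  let ?S = "{- (real n + 1)..real n + 1}"
  have "uniformly_continuous_on ?S w1"
    by (intro compact_uniformly_continuous w1_continuous) auto
  then obtain d where d: "d > 0" "\<And>x y. x \<in> ?S \<Longrightarrow> y \<in> ?S \<Longrightarrow> dist x y < d \<Longrightarrow> dist (w1 x) (w1 y) < w1 (real n + 1)"
    unfolding uniformly_continuous_on_def using w1_pos by metis
  show ?thesis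
  proof (rule that[of "min (d / 2) (1 / (real n + 1))"])
    show "0 < min (d / 2) (1 / (real n + 1))" using d(1) by simp
    fix x y assume y: "\<bar>y\<bar> \<le> real n" and xy: "\<bar>x - y\<bar> \<le> min (d / 2) (1 / (real n + 1))"
    have "1 / (real n + 1) \<le> 1" by simp
    then have x: "\<bar>x\<bar> \<le> real n + 1" using y xy by linarith
    have "dist x y < d" using xy d(1) by (simp add: dist_real_def)
    then have "dist (w1 x) (w1 y) < w1 (real n + 1)" using x y by (intro d(2)) auto
    moreover have "w1 (real n + 1) \<le> w1 \<bar>x\<bar>" using x by (intro w1_decreasing) auto
    moreover have "w1 \<bar>x\<bar> = w1 x" by (simp add: w1_def)
    ultimately show "w1 y \<le> 2 * w1 x" by (simp add: dist_real_def)
  qed simp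
qed

definition truncated_weight :: "nat \<Rightarrow> real \<Rightarrow> real" where
  "truncated_weight n y = indicator {- real n..real n} y * w1 y"

definition smoothed_weight :: "nat \<Rightarrow> real \<Rightarrow> real \<Rightarrow> real" where
  "smoothed_weight n e = convolution (truncated_weight n) (mollifier e)"

lemma truncated_weight_kernel: "bounded_kernel (real n) (truncated_weight n)" "\<bar>truncated_weight n y\<bar> \<le> 1 * w1 y"
proof -
    have *: "\<bar>truncated_weight n y\<bar> \<le> 1 * w1 y" for y
      using w1_pos[of y] by (simp add: truncated_weight_def indicator_def)
    have "w1 \<in> borel_measurable borel" by (intro borel_measurable_continuous_onI w1_continuous)
    then have "truncated_weight n \<in> borel_measurable borel" unfolding truncated_weight_def by measurable
    moreover have "\<bar>truncated_weight n y\<bar> \<le> exp b" for y using *[of y] w1_le[of y] by linarith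
    moreover have "truncated_weight n y = 0" if "\<bar>y\<bar> > real n" for y using that by (auto simp: truncated_weight_def indicator_def)
    ultimately show "bounded_kernel (real n) (truncated_weight n)" unfolding bounded_kernel_def by blast
    show "\<bar>truncated_weight n y\<bar> \<le> 1 * w1 y" by (rule *)
qed

text \<open>
  The mollification radius \<open>e n\<close> is chosen after the truncation point \<open>n\<close>, by uniform continuity of the weight on \<open>{- n - 1..n + 1}\<close>;
  no radius works on the whole line, since the weight varies faster and faster.
\<close>

lemma smoothed_weight_approximates:
  obtains e where "\<And>n. e n > 0" "e \<longlonglongrightarrow> 0" "\<And>n x y. \<bar>y\<bar> \<le> real n \<Longrightarrow> \<bar>x - y\<bar> \<le> e n \<Longrightarrow> w1 y \<le> 2 * w1 x"
    "\<And>n x. \<bar>smoothed_weight n (e n) x\<bar> \<le> 2 * w1 x" "\<And>x. (\<lambda>n. smoothed_weight n (e n) x) \<longlonglongrightarrow> w1 x"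
proof -
  have "\<exists>e. \<forall>n. e n > 0 \<and> e n \<le> 1 / (real n + 1) \<and> (\<forall>x y. \<bar>y\<bar> \<le> real n \<longrightarrow> \<bar>x - y\<bar> \<le> e n \<longrightarrow> w1 y \<le> 2 * w1 x)"
    by (rule choice_iff[THEN iffD1], rule allI) (use w1_doubling_radius in metis)
  then obtain e where e: "\<And>n. e n > 0" "\<And>n. e n \<le> 1 / (real n + 1)"
    "\<And>n x y. \<bar>y\<bar> \<le> real n \<Longrightarrow> \<bar>x - y\<bar> \<le> e n \<Longrightarrow> w1 y \<le> 2 * w1 x" by blast
  have "(\<lambda>n. 1 / (real n + 1)) \<longlonglongrightarrow> 0"
    using LIMSEQ_inverse_real_of_nat by (simp add: inverse_eq_divide add.commute)
  then have e0: "e \<longlonglongrightarrow> 0"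
    by (rule tendsto_sandwich[OF _ _ tendsto_const, rotated 2]) (use e in \<open>auto simp: less_imp_le\<close>)
  note \<omega> = truncated_weight_kernel
  have i_bound: "\<bar>convolution (truncated_weight n) (mollifier (e n)) x\<bar> \<le> 2 * w1 x" for n x
    using convolution_mollifier_bound[OF \<omega>(1) \<omega>(2) _ e(1), of n x] e(3)[of _ n x] w1_pos[of x] by (simp add: less_imp_le)
  have i_lim: "(\<lambda>n. convolution (truncated_weight n) (mollifier (e n)) x) \<longlonglongrightarrow> w1 x" for x
  proof (rule LIMSEQ_I)
    fix \<epsilon> :: real assume \<epsilon>: "\<epsilon> > 0"
    have "isCont w1 x" using w1_continuous[of UNIV] by (simp add: continuous_on_eq_continuous_at)
    then obtain d where d: "d > 0" "\<And>y. \<bar>y - x\<bar> < d \<Longrightarrow> \<bar>w1 y - w1 x\<bar> < \<epsilon> / 2"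
      unfolding continuous_at_eps_delta using \<epsilon> half_gt_zero[of \<epsilon>] by (metis real_norm_def dist_real_def)
    obtain n1 where n1: "\<And>n. n \<ge> n1 \<Longrightarrow> \<bar>e n\<bar> < d" using LIMSEQ_D[OF e0 d(1)] by auto
    have "norm (convolution (truncated_weight n) (mollifier (e n)) x - w1 x) < \<epsilon>" if n: "n \<ge> max n1 (nat \<lceil>\<bar>x\<bar> + 1\<rceil>)" for n
    proof -
      have "\<bar>convolution (truncated_weight n) (mollifier (e n)) x - w1 x\<bar> \<le> \<epsilon> / 2"
      proof (rule convolution_mollifier_close[OF \<omega>(1) e(1)])
        fix y assume y: "\<bar>x - y\<bar> \<le> e n"
        have "1 / (real n + 1) \<le> 1" by simp
        then have "\<bar>x - y\<bar> \<le> 1" using y e(2)[of n] by linarith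
        moreover have "\<bar>x\<bar> + 1 \<le> real n" using n by linarith
        ultimately have "\<bar>y\<bar> \<le> real n" by linarith
        then have "truncated_weight n y = w1 y" by (auto simp: truncated_weight_def indicator_def)
        moreover have "\<bar>y - x\<bar> < d" using y n1[of n] n e(1)[of n] by simp
        ultimately show "\<bar>truncated_weight n y - w1 x\<bar> \<le> \<epsilon> / 2" using d(2)[of y] by simp
      qed
      then show ?thesis using \<epsilon> by simp
    qed
    then show "\<exists>no. \<forall>n\<ge>no. norm (convolution (truncated_weight n) (mollifier (e n)) x - w1 x) < \<epsilon>" by blast
  qed
  show ?thesis
    by (rule that[of e]) (use e e0 i_bound i_lim in \<open>auto simp: smoothed_weight_def\<close>)
qed

text \<open>
  A scheme for level \<open>m\<close>: for every large truncation point \<open>n\<close>, the smoothed weight is a sum of functions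
  \<open>D 0, \<dots>, D (m + 1)\<close>. All but the last are combinations of mollified point masses at nodes independent of
  \<open>n\<close>, and \<open>D j\<close> pairs with a function and its derivative of order \<open>r\<close> through kernels of size
  \<open>rate r j * w1\<close>.
\<close>

definition smolyak_scheme ::
  "nat \<Rightarrow> real \<Rightarrow> nat \<Rightarrow> (nat \<Rightarrow> 'i set) \<Rightarrow> (nat \<Rightarrow> 'i \<Rightarrow> real) \<Rightarrow> (nat \<Rightarrow> nat \<Rightarrow> 'i \<Rightarrow> real) \<Rightarrow>
    (nat \<Rightarrow> 'i \<Rightarrow> real) \<Rightarrow> (nat \<Rightarrow> real) \<Rightarrow> nat \<Rightarrow> bool" where
  "smolyak_scheme r C m I Y c c' e n1 \<longleftrightarrow>
    (\<forall>j. finite (I j) \<and> card (I j) \<le> 8 * r * 2 ^ j) \<and> (\<forall>j i. (\<lambda>n. c n j i) \<longlonglongrightarrow> c' j i) \<and>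
    (\<forall>n. e n > 0) \<and> e \<longlonglongrightarrow> 0 \<and>
    (\<forall>n\<ge>n1. \<exists>D. (\<forall>j\<le>m. \<forall>x. D j x = (\<Sum>i\<in>I j. c n j i * mollifier (e n) (x - Y j i))) \<and>
       (\<forall>j\<le>m + 1. smooth_split r (\<lambda>x. C * rate r j * w1 x) (D j)) \<and>
       (\<forall>x. (\<Sum>j\<le>m + 1. D j x) = smoothed_weight n (e n) x)) \<and>
    (\<forall>n x. \<bar>smoothed_weight n (e n) x\<bar> \<le> 2 * w1 x) \<and>
    (\<forall>x. (\<lambda>n. smoothed_weight n (e n) x) \<longlonglongrightarrow> w1 x)"

text \<open>
  Let \<open>q s\<close> be the mollified quadrature of level \<open>s - 1\<close>, with \<open>q 0 = 0\<close> and with the smoothed weight \<open>i\<close>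
  itself at the top. The Peano kernel, applied to the mollifier, shows that \<open>i - q s\<close> is a derivative
  of order \<open>r\<close> of a mollified kernel for \<open>s > 0\<close>. Hence the differences \<open>D j = q (j + 1) - q j\<close>,
  which sum up to \<open>i\<close>, are such derivatives, up to the term \<open>i\<close> for \<open>j = 0\<close>. The mollification
  radius is chosen so small that averages of the weight over it are at most twice the weight.
\<close>

lemma smolyak_scheme_exists:
  assumes r: "r \<ge> 1"
  obtains C where "C > 0"
   "\<And>m. \<exists>(I :: nat \<Rightarrow> (bool \<times> bool \<times> nat \<times> nat) set) Y c c' e n1. smolyak_scheme r C m I Y c c' e n1"
proof -
  define p where "p = (1 - 1 / lam) * real r"
  have p: "p > 0" using r lam by (simp add: p_def)
  have rate: "rate r k = 2 powr (- p * real k)" for k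
    by (simp only: rate_def p_def mult_minus_left)
  obtain C where C: "C > 0" and line: "\<And>k::nat. \<exists>(X :: bool \<times> nat \<times> nat \<Rightarrow> real) M (n0::nat). (\<forall>i. convergent (M i)) \<and>
      (\<forall>n\<ge>n0. \<exists>\<kappa>. peano_kernel r {- real n..real n} (\<lambda>t. C * rate r k * w1 t) (\<lambda>g. (LBINT y:{- real n..real n}. w1 y * g y) -
           (\<Sum>i\<in>UNIV \<times> {..<2 ^ (k + 1)} \<times> {..<r}. M i n * g (X i))) \<kappa>)"
    using line_quadrature[OF r] by blast
  define J where "J k = (UNIV \<times> {..<2 ^ (k + 1)} \<times> {..<r} :: (bool \<times> nat \<times> nat) set)" for k :: nat
  have J: "finite (J k)" "card (J k) = 4 * r * 2 ^ k" for k by (auto simp: J_def)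
  define E where "E X M k n g = (LBINT y:{- real n..real n}. w1 y * g y) - (\<Sum>i\<in>J k. M i n * g (X i))" for X M k n g
  have "\<exists>X M n0. (\<forall>i. convergent (M i)) \<and>
      (\<forall>n\<ge>n0. \<exists>\<kappa>. peano_kernel r {- real n..real n} (\<lambda>t. C * rate r k * w1 t) (E X M k n) \<kappa>)" for k
    using line[of k] unfolding E_def J_def by blast
  then obtain X M n0 where M: "\<And>k i. convergent (M k i)" and ex: "\<And>k n. n \<ge> n0 k \<Longrightarrow>
      \<exists>\<kappa>. peano_kernel r {- real n..real n} (\<lambda>t. C * rate r k * w1 t) (E (X k) (M k) k n) \<kappa>"
    by metis
  obtain e where e: "\<And>n. e n > 0" "e \<longlonglongrightarrow> 0"
    "\<And>n x y. \<bar>y\<bar> \<le> real n \<Longrightarrow> \<bar>x - y\<bar> \<le> e n \<Longrightarrow> w1 y \<le> 2 * w1 x"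
    and sw: "\<And>n x. \<bar>smoothed_weight n (e n) x\<bar> \<le> 2 * w1 x" "\<And>x. (\<lambda>n. smoothed_weight n (e n) x) \<longlonglongrightarrow> w1 x"
    using smoothed_weight_approximates by blast
  note \<omega> = truncated_weight_kernel
  define C' where "C' = 2 + 2 * (C * (2 powr p + 1))"
  have C2: "C * (2 powr p + 1) > 0" using C by (intro mult_pos_pos) (auto intro: add_pos_pos)
  then have C': "C' > 0" by (simp add: C'_def)
  show ?thesis
  proof (rule that[OF C'])
    fix m :: nat
    define n1 where "n1 = Max (n0 ` {..m})"
    have n1: "n \<ge> n0 k" if "n \<ge> n1" "k \<le> m" for n k
      using that Max_ge[of "n0 ` {..m}" "n0 k"] unfolding n1_def by auto
    define I where "I j = {True} \<times> J j \<union> (if j = 0 then {} else {False} \<times> J (j - 1))" for j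
    define Y where "Y j = (\<lambda>(s, i). X (if s then j else j - 1) i)" for j
    define c where "c n j = (\<lambda>(s, i). if s then M j i n else - M (j - 1) i n)" for n j
    define c' where "c' j = (\<lambda>(s, i). if s then lim (M j i) else - lim (M (j - 1) i))" for j
    have I: "finite (I j) \<and> card (I j) \<le> 8 * r * 2 ^ j" for j
    proof -
      have "card (I j) \<le> card ({True} \<times> J j) + card (if j = 0 then {} else {False} \<times> J (j - 1))"
        unfolding I_def by (rule card_Un_le)
      also have "\<dots> \<le> 4 * r * 2 ^ j + 4 * r * 2 ^ j" by (cases j) (auto simp: J card_cartesian_product)
      finally show ?thesis by (auto simp: I_def J)
    qed
    have cc: "(\<lambda>n. c n j i) \<longlonglongrightarrow> c' j i" for j i
      using M by (cases i) (auto simp: c_def c'_def convergent_LIMSEQ_iff intro!: tendsto_minus)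
    have main: "\<exists>D. (\<forall>j\<le>m. \<forall>x. D j x = (\<Sum>i\<in>I j. c n j i * mollifier (e n) (x - Y j i))) \<and>
         (\<forall>j\<le>m + 1. smooth_split r (\<lambda>x. C' * rate r j * w1 x) (D j)) \<and>
         (\<forall>x. (\<Sum>j\<le>m + 1. D j x) = smoothed_weight n (e n) x)" if n: "n \<ge> n1" for n
    proof -
      obtain \<kappa> where \<kappa>P: "\<And>k. k \<le> m \<Longrightarrow> peano_kernel r {- real n..real n} (\<lambda>t. C * rate r k * w1 t) (E (X k) (M k) k n) (\<kappa> k)"
        using ex[OF n1[OF n]] by metis
      have \<kappa>: "bounded_kernel (real n) (\<kappa> k)" "\<bar>\<kappa> k t\<bar> \<le> C * 2 powr (- p * real k) * w1 t"
         "smooth1 g \<Longrightarrow> (LBINT y:{- real n..real n}. w1 y * g y) =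
           (\<Sum>i\<in>J k. M k i n * g (X k i)) + (\<integral>t. \<kappa> k t * (deriv ^^ r) g t \<partial>lborel)" if "k \<le> m" for k g t
        using \<kappa>P[OF that] peano_kernel_bounded[OF \<kappa>P[OF that]] C
        unfolding peano_kernel_def E_def rate by (auto simp: algebra_simps)
      let ?mollifier = "mollifier (e n)"
      define i where "i = smoothed_weight n (e n)"
      \<comment> \<open>both ends are extended by 0, so that the two boundary differences need no separate treatment\<close>
      define \<kappa>' where "\<kappa>' s t = (if s = 0 \<or> s > m + 1 then 0 else (-1) ^ r * \<kappa> (s - 1) t)" for s t
      define q where "q s x = (if s = 0 then 0 else if s > m + 1 then i x else \<Sum>l\<in>J (s - 1). M (s - 1) l n * ?mollifier (x - X (s - 1) l))" for s x
      have \<kappa>'b: "bounded_kernel (real n) (\<kappa>' s)" for s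
      proof (cases "s = 0 \<or> s > m + 1")
        case True
        then have "\<kappa>' s = (\<lambda>_. 0)" by (auto simp: \<kappa>'_def)
        then show ?thesis by (auto simp: bounded_kernel_def)
      next
        case False
        then have "\<kappa>' s = (\<lambda>t. (-1) ^ r * \<kappa> (s - 1) t)" by (auto simp: \<kappa>'_def)
        then show ?thesis using bounded_kernel_scale[OF \<kappa>(1)[of "s - 1"]] False by auto
      qed
      have \<kappa>'w: "\<bar>\<kappa>' s t\<bar> \<le> C * 2 powr p * 2 powr (- p * real s) * w1 t" for s t
      proof (cases "s = 0 \<or> s > m + 1")
        case True then show ?thesis using C w1_pos[of t] by (auto simp: \<kappa>'_def less_imp_le)
      next
        case False
        have "2 powr (- p * real (s - 1)) = 2 powr p * 2 powr (- p * real s)"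
          using False by (simp add: of_nat_diff algebra_simps flip: powr_add)
        moreover have "s - 1 \<le> m" using False by auto
        ultimately show ?thesis using \<kappa>(2)[of "s - 1" t] False by (simp add: \<kappa>'_def abs_mult mult_ac)
      qed
      have mol0: "\<And>x. x \<notin> {- e n..e n} \<Longrightarrow> ?mollifier x = 0" using e(1)[of n] by (intro mollifier_eq_0) auto
      have molD: "smooth1 (convolution \<kappa>0 ?mollifier)" "(deriv ^^ k) (convolution \<kappa>0 ?mollifier) = convolution \<kappa>0 ((deriv ^^ k) ?mollifier)"
        if "bounded_kernel (real n) \<kappa>0" for \<kappa>0 k
        by (rule smooth1_convolution[OF that smooth1_mollifier mol0]; assumption)+
      have ident: "i x = q s x + (deriv ^^ r) (convolution (\<kappa>' s) ?mollifier) x" if "s > 0" for s x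
      proof (cases "s > m + 1")
        case True
        have "\<kappa>' s = (\<lambda>_. 0)" using True by (auto simp: \<kappa>'_def)
        then have "(deriv ^^ r) (convolution (\<kappa>' s) ?mollifier) x = 0"
          using molD(2)[OF \<kappa>'b[of s], of r] by (simp add: convolution_def)
        then show ?thesis using True by (simp add: q_def)
      next
        case False
        define g where "g y = ?mollifier (x - y)" for y
        have g: "smooth1 g" "(deriv ^^ r) g = (\<lambda>y. (-1) ^ r * (deriv ^^ r) ?mollifier (x - y))"
          using smooth1_affine(1)[OF smooth1_mollifier, of 1 "e n" "-1" x] smooth1_affine(2)[OF smooth1_mollifier, of r 1 "e n" "-1" x]
          by (simp_all add: g_def[abs_def])
        have "i x = (LBINT y:{- real n..real n}. w1 y * g y)"
          unfolding i_def smoothed_weight_def convolution_def truncated_weight_def g_def set_lebesgue_integral_def by (simp add: mult.assoc)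
        also have "\<dots> = (\<Sum>l\<in>J (s - 1). M (s - 1) l n * g (X (s - 1) l)) + (\<integral>t. \<kappa> (s - 1) t * (deriv ^^ r) g t \<partial>lborel)"
          using False by (intro \<kappa>(3) g) auto
        also have "(\<integral>t. \<kappa> (s - 1) t * (deriv ^^ r) g t \<partial>lborel) = convolution (\<kappa>' s) ((deriv ^^ r) ?mollifier) x"
          unfolding convolution_def g(2) \<kappa>'_def using False that by (simp add: mult_ac)
        also have "\<dots> = (deriv ^^ r) (convolution (\<kappa>' s) ?mollifier) x" using molD(2)[OF \<kappa>'b] by simp
        finally show ?thesis using False that by (simp add: q_def g_def)
      qed
      define K where "K j t = \<kappa>' j t - \<kappa>' (Suc j) t" for j t
      have K: "bounded_kernel (real n) (K j)" for j unfolding K_def by (intro bounded_kernel_diff \<kappa>'b)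
      have Kw: "\<bar>K j t\<bar> \<le> C * (2 powr p + 1) * 2 powr (- p * real j) * w1 t" for j t
      proof -
        have "2 powr p * 2 powr (- p * real (Suc j)) = 2 powr (- p * real j)"
          by (simp add: algebra_simps flip: powr_add)
        then have "C * 2 powr p * 2 powr (- p * real (Suc j)) * w1 t = C * 2 powr (- p * real j) * w1 t"
          by (metis mult.assoc)
        then have "\<bar>K j t\<bar> \<le> C * 2 powr p * 2 powr (- p * real j) * w1 t + C * 2 powr (- p * real j) * w1 t"
          unfolding K_def using \<kappa>'w[of j t] \<kappa>'w[of "Suc j" t] by linarith
        then show ?thesis by (simp add: algebra_simps)
      qed
      define A where "A j = (if j = 0 then i else (\<lambda>_. 0))" for j :: nat
      define B where "B j = convolution (K j) ?mollifier" for j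
      define D where "D j x = q (Suc j) x - q j x" for j x
      have dB: "(deriv ^^ r) (B j) x = (deriv ^^ r) (convolution (\<kappa>' j) ?mollifier) x - (deriv ^^ r) (convolution (\<kappa>' (Suc j)) ?mollifier) x" for j x
        unfolding B_def molD(2)[OF K] molD(2)[OF \<kappa>'b] K_def
        by (rule convolution_diff[OF \<kappa>'b \<kappa>'b]) (intro smooth1_continuous smooth1_derivs smooth1_mollifier)
      have z: "(deriv ^^ r) (convolution (\<kappa>' 0) ?mollifier) x = 0" for x
        unfolding molD(2)[OF \<kappa>'b] by (simp add: convolution_def \<kappa>'_def)
      have D1: "D j x = A j x + (deriv ^^ r) (B j) x" for j x
      proof (cases "j = 0")
        case True
        then show ?thesis using ident[of "Suc 0" x] z[of x] by (simp add: D_def A_def dB q_def)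
      next
        case False
        then show ?thesis using ident[of "Suc j" x] ident[of j x] by (simp add: D_def A_def dB)
      qed
      have D2: "D j x = (\<Sum>l\<in>I j. c n j l * ?mollifier (x - Y j l))" if "j \<le> m" for j x
      proof -
        have t: "(\<Sum>l\<in>{s} \<times> S. f l) = (\<Sum>l\<in>S. f (s, l))" for s :: bool and S :: "(bool \<times> nat \<times> nat) set" and f :: "_ \<Rightarrow> real"
        proof -
          have "{s} \<times> S = Pair s ` S" by auto
          then show ?thesis by (simp add: sum.reindex inj_on_def)
        qed
        have "(\<Sum>l\<in>I j. c n j l * ?mollifier (x - Y j l)) = (\<Sum>l\<in>{True} \<times> J j. c n j l * ?mollifier (x - Y j l)) +
            (\<Sum>l\<in>(if j = 0 then {} else {False} \<times> J (j - 1)). c n j l * ?mollifier (x - Y j l))"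
          unfolding I_def by (rule sum.union_disjoint) (auto simp: J)
        also have "\<dots> = q (Suc j) x - q j x"
          using that by (simp add: t c_def Y_def q_def sum_negf)
        finally show ?thesis by (simp add: D_def)
      qed
      have "(\<Sum>j\<le>k. D j x) = q (Suc k) x" for k x
        by (induction k) (auto simp: D_def q_def)
      then have D3: "(\<Sum>j\<le>m + 1. D j x) = smoothed_weight n (e n) x" for x by (simp add: q_def i_def)
      have supp: "convolution \<kappa>0 ?mollifier x = 0" if "bounded_kernel (real n) \<kappa>0" "\<bar>x\<bar> > real n + e n" for \<kappa>0 x
        by (rule convolution_eq_0[OF that(1) _ that(2)]) (rule mollifier_eq_0)
      have D4: "smooth1 (A j) \<and> smooth1 (B j) \<and> (\<forall>x. \<bar>x\<bar> > real n + e n \<longrightarrow> A j x = 0 \<and> B j x = 0)" for j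
      proof -
        have "smooth1 (\<lambda>_. 0)" by (rule smooth1_coinduct[of "\<lambda>f. f = (\<lambda>_. 0)"]) auto
        then show ?thesis unfolding A_def B_def i_def smoothed_weight_def
          using molD(1)[OF K] molD(1)[OF \<omega>(1)] supp[OF K] supp[OF \<omega>(1)] by simp
      qed
      have D5: "\<bar>A j x\<bar> \<le> C' * 2 powr (- p * real j) * w1 x \<and> \<bar>B j x\<bar> \<le> C' * 2 powr (- p * real j) * w1 x" for j x
      proof
        have "2 * w1 x \<le> C' * w1 x" (is ?le) unfolding C'_def using C2 w1_pos[of x] by (intro mult_right_mono) auto
        then show "\<bar>A j x\<bar> \<le> C' * 2 powr (- p * real j) * w1 x"
        proof (cases "j = 0")
          case True
          then show ?thesis using order_trans[OF sw(1)[of n x] \<open>?le\<close>] by (simp add: A_def i_def)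
        next
          case False
          then show ?thesis using C' w1_pos[of x] by (simp add: A_def less_imp_le)
        qed
        have "\<bar>B j x\<bar> \<le> 2 * (C * (2 powr p + 1) * 2 powr (- p * real j)) * w1 x"
          unfolding B_def
          by (rule convolution_mollifier_bound[OF K Kw _ e(1) e(3)]) (use C2 w1_pos[of x] in \<open>auto simp: less_imp_le\<close>)
        also have "\<dots> \<le> C' * 2 powr (- p * real j) * w1 x"
        proof -
          have "2 * (C * (2 powr p + 1)) * (2 powr (- p * real j) * w1 x) \<le> C' * (2 powr (- p * real j) * w1 x)"
            unfolding C'_def using w1_pos[of x] by (intro mult_right_mono) auto
          then show ?thesis by (simp only: mult.assoc)
        qed
        finally show "\<bar>B j x\<bar> \<le> C' * 2 powr (- p * real j) * w1 x" .
      qed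
      have "smooth_split r (\<lambda>x. C' * rate r j * w1 x) (D j)" for j
        unfolding smooth_split_def rate using D1 D4 D5 by blast
      then show ?thesis using D2 D3 by blast
    qed
    show "\<exists>(I :: nat \<Rightarrow> (bool \<times> bool \<times> nat \<times> nat) set) Y c c' e n1. smolyak_scheme r C' m I Y c c' e n1"
      unfolding smolyak_scheme_def
      by (rule exI[of _ I], rule exI[of _ Y], rule exI[of _ c], rule exI[of _ c'], rule exI[of _ e], rule exI[of _ n1])
         (intro conjI allI impI I cc e(1,2) sw main)
  qed
qed

end

section \<open>Tensor products and uniqueness of weak derivatives\<close>

definition tensor :: "('d::finite \<Rightarrow> real \<Rightarrow> real) \<Rightarrow> real ^ 'd \<Rightarrow> real" where
  "tensor u x = (\<Prod>i\<in>UNIV. u i (x $ i))"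

lemma tensor_has_derivative:
  assumes "\<And>i. smooth1 (u i)"
  shows "(tensor u has_derivative (\<lambda>h. \<Sum>i\<in>UNIV. h $ i * deriv (u i) (x $ i) * (\<Prod>j\<in>UNIV - {i}. u j (x $ j)))) (at x)"
  unfolding tensor_def
  by (rule has_derivative_prod)
     (rule DERIV_compose_FDERIV[OF smooth1_DERIV[OF assms] bounded_linear_imp_has_derivative[OF bounded_linear_vec_nth]])

lemma partial_tensor:
  assumes "\<And>i. smooth1 (u i)"
  shows "partial i (tensor u) = tensor (u(i := deriv (u i)))"
proof
  fix x
  have "partial i (tensor u) x = (\<Sum>j\<in>UNIV. axis i 1 $ j * deriv (u j) (x $ j) * (\<Prod>l\<in>UNIV - {j}. u l (x $ l)))"
    unfolding partial_def by (simp add: frechet_derivative_at[OF tensor_has_derivative[where u = u and x = x, OF assms], symmetric])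
  also have "\<dots> = (\<Sum>j\<in>UNIV. if j = i then deriv (u j) (x $ j) * (\<Prod>l\<in>UNIV - {j}. u l (x $ l)) else 0)"
    by (intro sum.cong) (auto simp: axis_def)
  also have "\<dots> = deriv (u i) (x $ i) * (\<Prod>l\<in>UNIV - {i}. u l (x $ l))" by simp
  also have "\<dots> = tensor (u(i := deriv (u i))) x"
    unfolding tensor_def by (subst prod.remove[of UNIV i]) (auto intro!: arg_cong2[where f = "(*)"] prod.cong)
  finally show "partial i (tensor u) x = tensor (u(i := deriv (u i))) x" .
qed

lemma partials_tensor:
  assumes "\<And>i. smooth1 (u i)"
  shows "partials is (tensor u) = tensor (\<lambda>i. (deriv ^^ count_list is i) (u i))"
proof (induction "is")
  case (Cons a "is")
  have "partials (a # is) (tensor u) = partial a (tensor (\<lambda>i. (deriv ^^ count_list is i) (u i)))"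
    using Cons by simp
  also have "\<dots> = tensor ((\<lambda>i. (deriv ^^ count_list is i) (u i))(a := deriv ((deriv ^^ count_list is a) (u a))))"
    by (rule partial_tensor) (intro smooth1_derivs assms)
  also have "(\<lambda>i. (deriv ^^ count_list is i) (u i))(a := deriv ((deriv ^^ count_list is a) (u a)))
      = (\<lambda>i. (deriv ^^ count_list (a # is) i) (u i))"
    by (auto simp: fun_eq_iff)
  finally show ?case .
qed simp

lemma smooth_tensor:
  assumes "\<And>i. smooth1 (u i)" shows "smooth (tensor u)"
  unfolding smooth_def partials_tensor[OF assms]
proof (intro allI)
  fix "is" x
  show "tensor (\<lambda>i. (deriv ^^ count_list is i) (u i)) differentiable at x"
    by (rule differentiableI, rule tensor_has_derivative) (intro smooth1_derivs assms)
qed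

lemma tensor_support:
  fixes u :: "'d::finite \<Rightarrow> real \<Rightarrow> real"
  assumes "\<And>i x. \<bar>x\<bar> > B \<Longrightarrow> u i x = 0" "B \<ge> 0" "x \<notin> cball 0 (real CARD('d) * B)"
  shows "tensor u x = 0"
proof -
  have "\<exists>i. \<bar>x $ i\<bar> > B"
  proof (rule ccontr)
    assume "\<not> ?thesis"
    then have "(\<Sum>i\<in>UNIV. \<bar>x $ i\<bar>) \<le> (\<Sum>i\<in>(UNIV :: 'd set). B)" by (intro sum_mono) (auto simp: not_less)
    then have "norm x \<le> real CARD('d) * B" using norm_le_l1_cart[of x] by simp
    then show False using assms(3) by simp
  qed
  then obtain i where "\<bar>x $ i\<bar> > B" ..
  then have "u i (x $ i) = 0" using assms(1) by blast
  then show ?thesis unfolding tensor_def by (intro prod_zero) auto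
qed

lemma tensor_test_function:
  assumes "\<And>i. smooth1 (u i)" "\<And>i x. \<bar>x\<bar> > B \<Longrightarrow> u i x = 0" "B \<ge> 0"
  shows "tensor u \<in> test_functions"
proof -
  have "{x. tensor u x \<noteq> 0} \<subseteq> cball 0 (real CARD('a) * B)"
    using tensor_support[of B u] assms(2,3) by blast
  then have "bounded {x. tensor u x \<noteq> 0}" using bounded_cball bounded_subset by blast
  then show ?thesis using smooth_tensor[OF assms(1)] by (simp add: test_functions_def compact_closure)
qed

lemma exists_enumeration: "\<exists>is. \<forall>i::'d::finite. count_list is i = k $ i"
proof -
  have "\<exists>is. \<forall>i. count_list is i = (if i \<in> S then k $ i else 0)" if "finite S" for S
    using that
  proof (induction S)
    case empty
    show ?case by (rule exI[of _ "[]"]) simp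
  next
    case (insert a S)
    then obtain "is" where "\<forall>i. count_list is i = (if i \<in> S then k $ i else 0)" by blast
    moreover have "count_list (replicate n a) i = (if i = a then n else 0)" for n i
      by (induction n) auto
    ultimately show ?case using insert(2)
      by (intro exI[of _ "replicate (k $ a) a @ is"]) auto
  qed
  from this[of UNIV] show ?thesis by simp
qed

text \<open>
  Each factor only depends on its own coordinate, so only the number of differentiations per direction matters,
  and every enumeration of the directions gives the same result.
\<close>

lemma mixed_deriv_tensor:
  assumes "\<And>i. smooth1 (u i)"
  shows "mixed_deriv k (tensor u) = tensor (\<lambda>i. (deriv ^^ (k $ i)) (u i))"
proof -
  have "\<forall>i. count_list (SOME is. \<forall>i. count_list is i = k $ i) i = k $ i"
    by (rule someI_ex[OF exists_enumeration])
  then show ?thesis unfolding mixed_deriv_def partials_tensor[OF assms] by simp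
qed

lemma smooth_partials: "smooth f \<Longrightarrow> smooth (partials is f)"
proof -
  assume f: "smooth f"
  have "partials js (partials is f) differentiable (at x)" for js x
    using f[unfolded smooth_def, rule_format, of "js @ is" x] by simp
  then show ?thesis unfolding smooth_def by blast
qed

lemma smooth_continuous: "smooth f \<Longrightarrow> continuous_on S f"
proof -
  assume "smooth f"
  then have "partials [] f differentiable (at x)" for x unfolding smooth_def by blast
  then show ?thesis by (simp add: continuous_at_imp_continuous_on differentiable_imp_continuous_within)
qed

lemma tensor_continuous: "(\<And>i. smooth1 (u i)) \<Longrightarrow> continuous_on S (tensor u)"
  by (rule smooth_continuous[OF smooth_tensor])

lemma continuous_imp_lebesgue_measurable:
  "continuous_on UNIV f \<Longrightarrow> f \<in> borel_measurable lebesgue"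
  by (intro measurable_completion) (simp add: borel_measurable_continuous_onI)

lemma locally_integrable_times:
  fixes f u :: "real ^ 'd \<Rightarrow> real"
  assumes "locally_integrable f" "continuous_on UNIV u" "\<And>x. x \<notin> cball 0 R \<Longrightarrow> u x = 0"
  shows "integrable lebesgue (\<lambda>x. f x * u x)"
proof -
  have f: "integrable lebesgue (\<lambda>x. indicator (cball 0 R) x *\<^sub>R f x)"
    using assms(1) compact_cball unfolding locally_integrable_def set_integrable_def by blast
  have "compact (u ` cball 0 R)" using assms(2) by (intro compact_continuous_image) (auto intro: continuous_on_subset)
  then obtain M where M: "\<And>x. x \<in> cball 0 R \<Longrightarrow> \<bar>u x\<bar> \<le> M"
    by (metis compact_imp_bounded bounded_iff imageI real_norm_def)
  have eq: "f x * u x = (indicator (cball 0 R) x *\<^sub>R f x) * u x" for x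
    using assms(3)[of x] by (auto simp: indicator_def)
  have um: "u \<in> borel_measurable lebesgue" using assms(2) by (rule continuous_imp_lebesgue_measurable)
  show ?thesis
  proof (rule Bochner_Integration.integrable_bound)
    show "integrable lebesgue (\<lambda>x. \<bar>M\<bar> * (indicator (cball 0 R) x *\<^sub>R f x))" using f by simp
    show "(\<lambda>x. f x * u x) \<in> borel_measurable lebesgue"
      unfolding eq using borel_measurable_integrable[OF f] um by (rule borel_measurable_times)
    show "AE x in lebesgue. norm (f x * u x) \<le> norm (\<bar>M\<bar> * (indicator (cball 0 R) x *\<^sub>R f x))"
    proof (rule AE_I2)
      fix x show "norm (f x * u x) \<le> norm (\<bar>M\<bar> * (indicator (cball 0 R) x *\<^sub>R f x))"
      proof (cases "x \<in> cball 0 R")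
        case True
        then have "\<bar>u x\<bar> \<le> \<bar>M\<bar>" using M[of x] by linarith
        from mult_right_mono[OF this, of "\<bar>f x\<bar>"] show ?thesis using True by (simp add: abs_mult mult.commute)
      qed (simp add: assms(3))
    qed
  qed
qed

lemma tensor_integral:
  fixes u :: "'d::finite \<Rightarrow> real \<Rightarrow> real"
  assumes "\<And>i x. u i x \<ge> 0" "\<And>i. integrable lborel (u i)"
  shows "has_bochner_integral lborel (tensor u) (\<Prod>i\<in>UNIV. \<integral>x. u i x \<partial>lborel)"
proof -
  have m[measurable]: "u i \<in> borel_measurable borel" for i
    using borel_measurable_integrable[OF assms(2)[of i]] by simp
  have inj: "inj (\<lambda>i::'d. axis i (1::real))" by (auto simp: inj_on_def axis_eq_axis)
  have B: "(Basis :: (real ^ 'd) set) = range (\<lambda>i. axis i 1)" by (auto simp: Basis_vec_def)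
  define g where "g b = u (inv (\<lambda>i::'d. axis i (1::real)) b)" for b :: "real ^ 'd"
  have g: "g (axis i 1) = u i" for i by (simp add: g_def inv_f_f[OF inj])
  have "(\<integral>\<^sup>+x. ennreal (tensor u x) \<partial>lborel) = (\<integral>\<^sup>+x. (\<Prod>b\<in>Basis. ennreal (g b (x \<bullet> b))) \<partial>lborel)"
    unfolding B prod.reindex[OF inj] by (simp add: g tensor_def prod_ennreal assms(1) inner_axis)
  also have "\<dots> = (\<Prod>b\<in>Basis. (\<integral>\<^sup>+x. ennreal (g b x) \<partial>lborel))"
    by (rule nn_integral_lborel_prod) (auto simp: g_def)
  also have "\<dots> = (\<Prod>i\<in>UNIV. (\<integral>\<^sup>+x. ennreal (u i x) \<partial>lborel))"
    unfolding B prod.reindex[OF inj] by (simp add: g)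
  also have "\<dots> = (\<Prod>i\<in>UNIV. ennreal (\<integral>x. u i x \<partial>lborel))"
    by (intro prod.cong refl nn_integral_eq_integral assms) (simp add: assms(1))
  also have "\<dots> = ennreal (\<Prod>i\<in>UNIV. \<integral>x. u i x \<partial>lborel)"
    by (rule prod_ennreal) (simp add: assms(1))
  finally have nn: "(\<integral>\<^sup>+x. ennreal (tensor u x) \<partial>lborel) = ennreal (\<Prod>i\<in>UNIV. \<integral>x. u i x \<partial>lborel)" .
  show ?thesis
  proof (rule has_bochner_integral_nn_integral)
    show "tensor u \<in> borel_measurable lborel" unfolding tensor_def by measurable
    show "AE x in lborel. 0 \<le> tensor u x" by (simp add: tensor_def prod_nonneg assms(1))
    show "0 \<le> (\<Prod>i\<in>UNIV. \<integral>x. u i x \<partial>lborel)" by (intro prod_nonneg) (simp add: assms(1))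
  qed (rule nn)
qed

text \<open>
  The positive and the negative part are densities of measures that agree on boxes. Boxes are closed under intersection and
  generate the Borel sets, so the measures, and hence the densities, agree.
\<close>

lemma AE_zero_if_box_integrals_zero:
  fixes d :: "'a::euclidean_space \<Rightarrow> real"
  assumes d: "integrable lborel d" and box: "\<And>a b. (\<integral>x. indicator (box a b) x * d x \<partial>lborel) = 0"
  shows "AE x in lborel. d x = 0"
proof -
  define p where "p x = max (d x) 0" for x
  define m where "m x = max (- d x) 0" for x
  have p: "integrable lborel p" "\<And>x. p x \<ge> 0" unfolding p_def using d by auto
  have m: "integrable lborel m" "\<And>x. m x \<ge> 0" unfolding m_def using d by auto
  have [measurable]: "d \<in> borel_measurable borel" "p \<in> borel_measurable borel" "m \<in> borel_measurable borel"
    using d p(1) m(1) by (auto dest: borel_measurable_integrable)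
  have ind: "integrable lborel (\<lambda>x. indicator (box a b) x * f x)" if "integrable lborel f" for f :: "'a \<Rightarrow> real" and a b
    using integrable_mult_indicator[OF _ that, of "box a b"] by simp
  have em: "emeasure (density lborel f) (box a b) = ennreal (\<integral>x. indicator (box a b) x * f x \<partial>lborel)"
    if "integrable lborel f" "\<And>x. f x \<ge> 0" for f :: "'a \<Rightarrow> real" and a b
  proof -
    have "f \<in> borel_measurable borel" using that by (auto dest: borel_measurable_integrable)
    then have "emeasure (density lborel f) (box a b) = (\<integral>\<^sup>+x. ennreal (f x) * indicator (box a b) x \<partial>lborel)"
      by (intro emeasure_density) auto
    also have "\<dots> = (\<integral>\<^sup>+x. ennreal (indicator (box a b) x * f x) \<partial>lborel)"
      by (intro nn_integral_cong) (auto simp: indicator_def)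
    also have "\<dots> = ennreal (\<integral>x. indicator (box a b) x * f x \<partial>lborel)"
      using that by (intro nn_integral_eq_integral ind) auto
    finally show ?thesis .
  qed
  have "density lborel p = density lborel m"
  proof (rule measure_eqI_generator_eq[where E = "range (\<lambda>(a, b). box a b)" and \<Omega> = UNIV and A = "\<lambda>n. box (- (real n *\<^sub>R One)) (real n *\<^sub>R One)"])
    show "Int_stable (range (\<lambda>(a, b). box a b :: 'a set))"
      by (auto simp: Int_stable_def box_Int_box)
    show "sets (density lborel p) = sigma_sets UNIV (range (\<lambda>(a, b). box a b))"
      "sets (density lborel m) = sigma_sets UNIV (range (\<lambda>(a, b). box a b))"
      by (simp_all add: borel_eq_box)
    show "emeasure (density lborel p) X = emeasure (density lborel m) X" if "X \<in> range (\<lambda>(a, b). box a b)" for X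
    proof -
      from that obtain a b where X: "X = box a b" by auto
      have "d x = p x - m x" for x by (auto simp: p_def m_def)
      then have "0 = (\<integral>x. indicator (box a b) x * p x - indicator (box a b) x * m x \<partial>lborel)"
        using box[of a b] by (simp add: right_diff_distrib)
      also have "\<dots> = (\<integral>x. indicator (box a b) x * p x \<partial>lborel) - (\<integral>x. indicator (box a b) x * m x \<partial>lborel)"
        by (intro Bochner_Integration.integral_diff ind p m)
      finally show ?thesis by (simp add: X em p m)
    qed
    show "(\<Union>n. box (- (real n *\<^sub>R One)) (real n *\<^sub>R One)) = (UNIV :: 'a set)" by (rule UN_box_eq_UNIV)
    show "emeasure (density lborel p) (box (- (real n *\<^sub>R One)) (real n *\<^sub>R One)) \<noteq> \<infinity>" for n
      by (simp add: em p)
  qed auto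
  then have "AE x in lborel. ennreal (p x) = ennreal (m x)"
    by (intro sigma_finite_measure.density_unique[OF lborel.sigma_finite_measure_axioms]) auto
  then show ?thesis
  proof eventually_elim
    case (elim x)
    then have "p x = m x" using p m by simp
    then show "d x = 0" by (auto simp: p_def m_def max_def split: if_splits)
  qed
qed

lemma bump_tendsto_indicator:
  "(\<lambda>n. bump (real (Suc n)) p q x) \<longlonglongrightarrow> indicator {p<..<q} x"
proof (cases "p < x \<and> x < q")
  case True
  have f: "(\<lambda>n. flat 1 (real (Suc n) * y)) \<longlonglongrightarrow> 1" if "y > 0" for y
  proof -
    have "(\<lambda>n. exp (- (1 / y * inverse (real (Suc n))))) \<longlonglongrightarrow> exp (- (1 / y * 0))"
      by (intro tendsto_intros LIMSEQ_inverse_real_of_nat)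
    moreover have "flat 1 (real (Suc n) * y) = exp (- (1 / y * inverse (real (Suc n))))" for n
    proof -
      have "real (Suc n) * y > 0" using that by (intro mult_pos_pos) auto
      then show ?thesis by (simp add: flat_1 divide_inverse mult.commute del: of_nat_Suc)
    qed
    ultimately show ?thesis by simp
  qed
  have "(\<lambda>n. bump (real (Suc n)) p q x) \<longlonglongrightarrow> 1 * 1"
    unfolding bump_def using True by (intro tendsto_mult f) auto
  then show ?thesis using True by simp
next
  case False
  then have "bump (real (Suc n)) p q x = 0" for n by (intro bump_eq_0) auto
  then show ?thesis using False by simp
qed

text \<open>
  Tensor products of bumps are test functions that converge to the indicator functions of boxes, so the difference of two weak
  derivatives integrates to 0 over every box.
\<close>

lemma weak_deriv_unique:
  fixes f g g' :: "real ^ 'd \<Rightarrow> real"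
  assumes "has_weak_deriv f k g" "has_weak_deriv f k g'"
  shows "AE x in lebesgue. g x = g' x"
proof -
  have li: "locally_integrable g" "locally_integrable g'" using assms by (auto simp: has_weak_deriv_def)
  have test: "(\<integral>x. g x * \<phi> x \<partial>lebesgue) = (\<integral>x. g' x * \<phi> x \<partial>lebesgue)" if "\<phi> \<in> test_functions" for \<phi>
    using assms that by (auto simp: has_weak_deriv_def)
  have box: "(\<integral>x. indicator (box a b) x * (g x - g' x) \<partial>lebesgue) = 0" for a b :: "real ^ 'd"
  proof -
    define \<phi> where "\<phi> n = tensor (\<lambda>i. bump (real (Suc n)) (a $ i) (b $ i))" for n
    define B where "B = (\<Sum>i\<in>UNIV. \<bar>a $ i\<bar> + \<bar>b $ i\<bar>)"
    define R where "R = real CARD('d) * B"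
    have supp: "bump (real (Suc n)) (a $ i) (b $ i) x = 0" if "\<bar>x\<bar> > B" for n i x
    proof -
      have "\<bar>a $ i\<bar> + \<bar>b $ i\<bar> \<le> B" unfolding B_def by (rule member_le_sum) auto
      then show ?thesis using that by (intro bump_eq_0) auto
    qed
    have B: "B \<ge> 0" by (auto simp: B_def intro: sum_nonneg)
    have \<phi>t: "\<phi> n \<in> test_functions" for n unfolding \<phi>_def
      by (rule tensor_test_function[OF smooth1_bump supp B])
    have \<phi>s: "\<phi> n x = 0" if "x \<notin> cball 0 R" for n x
      using that tensor_support[OF supp B] by (simp add: \<phi>_def R_def)
    have \<phi>c: "continuous_on UNIV (\<phi> n)" for n unfolding \<phi>_def by (intro tensor_continuous smooth1_bump)
    have \<phi>01: "0 \<le> \<phi> n x \<and> \<phi> n x \<le> 1" for n x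
      by (auto simp: \<phi>_def tensor_def bump_nonneg bump_le_1 intro!: prod_nonneg prod_le_1)
    have I: "integrable lebesgue (\<lambda>x. g x * \<phi> n x)" "integrable lebesgue (\<lambda>x. g' x * \<phi> n x)" for n
      by (rule locally_integrable_times[OF li(1) \<phi>c \<phi>s], assumption, rule locally_integrable_times[OF li(2) \<phi>c \<phi>s])
    have zero: "(\<integral>x. (g x - g' x) * \<phi> n x \<partial>lebesgue) = 0" for n
      using I[of n] test[OF \<phi>t, of n] by (simp add: left_diff_distrib)
    have G: "integrable lebesgue (\<lambda>x. indicator (cball 0 R) x *\<^sub>R g x)" "integrable lebesgue (\<lambda>x. indicator (cball 0 R) x *\<^sub>R g' x)"
      using li compact_cball unfolding locally_integrable_def set_integrable_def by blast+
    have lim: "(\<lambda>n. \<phi> n x) \<longlonglongrightarrow> indicator (box a b) x" for x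
    proof -
      have "(\<lambda>n. \<phi> n x) \<longlonglongrightarrow> (\<Prod>i\<in>UNIV. indicator {a $ i<..<b $ i} (x $ i))"
        unfolding \<phi>_def tensor_def by (intro tendsto_prod bump_tendsto_indicator)
      also have "(\<Prod>i\<in>UNIV. indicator {a $ i<..<b $ i} (x $ i)) = (indicator (box a b) x :: real)"
        by (auto simp: indicator_def mem_box_cart prod_eq_1_iff intro!: prod.neutral prod_zero)
      finally show ?thesis .
    qed
    have "box a b \<subseteq> cball 0 R"
    proof
      fix x assume "x \<in> box a b"
      then have "(\<lambda>n. \<phi> n x) \<longlonglongrightarrow> 1" using lim[of x] by simp
      then show "x \<in> cball 0 R" using \<phi>s[of x] LIMSEQ_unique[of "\<lambda>n. \<phi> n x" 1 0] by fastforce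
    qed
    then have "(\<lambda>x. indicator (box a b) x * (g x - g' x))
      = (\<lambda>x. indicator (box a b) x * (indicator (cball 0 R) x *\<^sub>R g x - indicator (cball 0 R) x *\<^sub>R g' x))"
      by (auto simp: indicator_def fun_eq_iff)
    moreover have "(\<lambda>x. indicator (box a b) x * (indicator (cball 0 R) x *\<^sub>R g x - indicator (cball 0 R) x *\<^sub>R g' x)) \<in> borel_measurable lebesgue"
      using G by (intro borel_measurable_times borel_measurable_diff borel_measurable_indicator) (auto dest: borel_measurable_integrable)
    ultimately have meas: "(\<lambda>x. indicator (box a b) x * (g x - g' x)) \<in> borel_measurable lebesgue" by simp
    have "(\<lambda>n. \<integral>x. (g x - g' x) * \<phi> n x \<partial>lebesgue) \<longlonglongrightarrow> (\<integral>x. indicator (box a b) x * (g x - g' x) \<partial>lebesgue)"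
    proof (rule integral_dominated_convergence[OF meas])
      show "(\<lambda>x. (g x - g' x) * \<phi> n x) \<in> borel_measurable lebesgue" for n
        using I[of n] borel_measurable_diff[of "\<lambda>x. g x * \<phi> n x" lebesgue "\<lambda>x. g' x * \<phi> n x"]
        by (simp add: left_diff_distrib borel_measurable_integrable)
      show "integrable lebesgue (\<lambda>x. \<bar>indicator (cball 0 R) x *\<^sub>R g x\<bar> + \<bar>indicator (cball 0 R) x *\<^sub>R g' x\<bar>)"
        using G by (intro Bochner_Integration.integrable_add integrable_abs)
      show "AE x in lebesgue. (\<lambda>n. (g x - g' x) * \<phi> n x) \<longlonglongrightarrow> indicator (box a b) x * (g x - g' x)"
        by (intro AE_I2) (subst mult.commute, rule tendsto_mult_left[OF lim])
      show "AE x in lebesgue. norm ((g x - g' x) * \<phi> n x) \<le> \<bar>indicator (cball 0 R) x *\<^sub>R g x\<bar> + \<bar>indicator (cball 0 R) x *\<^sub>R g' x\<bar>" for n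
      proof (rule AE_I2)
        fix x
        show "norm ((g x - g' x) * \<phi> n x) \<le> \<bar>indicator (cball 0 R) x *\<^sub>R g x\<bar> + \<bar>indicator (cball 0 R) x *\<^sub>R g' x\<bar>"
        proof (cases "x \<in> cball 0 R")
          case True
          have "\<bar>g x - g' x\<bar> * \<bar>\<phi> n x\<bar> \<le> \<bar>g x - g' x\<bar> * 1" using \<phi>01[of n x] by (intro mult_left_mono) auto
          then show ?thesis using True by (simp add: abs_mult)
        qed (simp add: \<phi>s)
      qed
    qed
    then show ?thesis unfolding zero by (simp add: LIMSEQ_const_iff)
  qed
  have "AE x in lebesgue. x \<in> box (- (real n *\<^sub>R One)) (real n *\<^sub>R One) \<longrightarrow> g x = g' x" for n
  proof -
    define U where "U = box (- (real n *\<^sub>R One)) (real n *\<^sub>R One :: real ^ 'd)"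
    define h where "h x = indicator U x * (g x - g' x)" for x
    have "integrable lebesgue h"
    proof -
      have "set_integrable lebesgue (closure U) (\<lambda>x. g x - g' x)"
        using li compact_closure[of U] unfolding locally_integrable_def U_def by (auto intro!: set_integral_diff)
      then have "set_integrable lebesgue U (\<lambda>x. g x - g' x)"
        by (rule set_integrable_subset) (auto simp: U_def closure_subset)
      then show ?thesis by (simp add: set_integrable_def h_def[abs_def])
    qed
    then have hm: "h \<in> borel_measurable lebesgue" and hi: "integrable lebesgue h" by (auto dest: borel_measurable_integrable)
    obtain h' where h': "h' \<in> borel_measurable lborel" "AE x in lborel. h x = h' x"
      using completion_ex_borel_measurable_real[OF hm] by blast
    have h'l: "h' \<in> borel_measurable lebesgue" using h'(1) by (rule measurable_completion)
    have AE: "AE x in lebesgue. h x = h' x" using h'(2) by (rule AE_completion)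
    have "integrable lebesgue h'" using integrable_cong_AE_imp[OF hi h'l AE] .
    then have h'i: "integrable lborel h'" using integrable_completion[OF h'(1)] by simp
    have "AE x in lborel. h' x = 0"
    proof (rule AE_zero_if_box_integrals_zero[OF h'i])
      fix a b :: "real ^ 'd"
      obtain a' b' where ab: "box a b \<inter> U = box a' b'" unfolding U_def box_Int_box by blast
      have "(\<integral>x. indicator (box a b) x * h' x \<partial>lborel) = (\<integral>x. indicator (box a b) x * h' x \<partial>lebesgue)"
      proof -
        have [measurable]: "h' \<in> borel_measurable borel" using h'(1) by simp
        show ?thesis by (intro integral_completion[symmetric]) measurable
      qed
      also have "\<dots> = (\<integral>x. indicator (box a b) x * h x \<partial>lebesgue)"
        using AE by (intro Bochner_Integration.integral_cong_AE) (use h'l hm in \<open>auto intro!: borel_measurable_times borel_measurable_indicator\<close>)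
      also have "(\<lambda>x. indicator (box a b) x * h x) = (\<lambda>x. indicator (box a' b') x * (g x - g' x))"
        unfolding ab[symmetric] h_def by (auto simp: indicator_def)
      finally show "(\<integral>x. indicator (box a b) x * h' x \<partial>lborel) = 0" using box by simp
    qed
    then have "AE x in lebesgue. h' x = 0" by (rule AE_completion)
    with AE show ?thesis unfolding U_def[symmetric] by eventually_elim (auto simp: h_def)
  qed
  then have "AE x in lebesgue. \<forall>n. x \<in> box (- (real n *\<^sub>R One)) (real n *\<^sub>R One) \<longrightarrow> g x = g' x"
    by (subst AE_all_countable) blast
  then show ?thesis
  proof eventually_elim
    case (elim x)
    have "x \<in> (\<Union>n. box (- (real n *\<^sub>R One)) (real n *\<^sub>R One))" by (simp add: UN_box_eq_UNIV)
    then show ?case using elim by blast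
  qed
qed

section \<open>Smolyak's quadrature\<close>

lemma deriv_vanishes_abs:
  assumes "\<And>x. \<bar>x\<bar> > u \<Longrightarrow> f x = 0" "\<bar>x\<bar> > u"
  shows "(deriv ^^ k) f x = (0::real)"
proof (rule deriv_vanishes)
  show "x \<notin> {-u..u}" using assms(2) by auto
  show "f y = 0" if "y \<notin> {-u..u}" for y using that by (intro assms(1)) auto
qed

lemma finite_multi_indices: "finite (multi_indices r :: (nat ^ 'd) set)"
proof (rule finite_subset)
  show "multi_indices r \<subseteq> (\<lambda>f. \<chi> i. f i) ` (PiE (UNIV :: 'd set) (\<lambda>_. {..r}))"
  proof
    fix k :: "nat ^ 'd" assume "k \<in> multi_indices r"
    then have "k = (\<chi> i. ($) k i)" "($) k \<in> PiE UNIV (\<lambda>_. {..r})"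
      by (auto simp: multi_indices_def)
    then show "k \<in> (\<lambda>f. \<chi> i. f i) ` (PiE (UNIV :: 'd set) (\<lambda>_. {..r}))" by blast
  qed
  show "finite ((\<lambda>f. \<chi> i. f i) ` (PiE (UNIV :: 'd set) (\<lambda>_. {..r})) :: (nat ^ 'd) set)"
    by (intro finite_imageI finite_PiE) auto
qed

lemma locally_integrable_measurable:
  fixes g :: "real ^ 'd \<Rightarrow> real"
  assumes "locally_integrable g" shows "g \<in> borel_measurable lebesgue"
proof (rule borel_measurable_LIMSEQ_real)
  fix x :: "real ^ 'd"
  have "\<forall>\<^sub>F n in sequentially. norm x \<le> real n"
    using filterlim_real_sequentially by (simp add: filterlim_at_top)
  then have "\<forall>\<^sub>F n in sequentially. indicator (cball 0 (real n)) x *\<^sub>R g x = g x"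
    by eventually_elim (auto simp: indicator_def)
  then show "(\<lambda>n. indicator (cball 0 (real n)) x *\<^sub>R g x) \<longlonglongrightarrow> g x" by (rule tendsto_eventually)
next
  fix n :: nat
  have "integrable lebesgue (\<lambda>x. indicator (cball 0 (real n)) x *\<^sub>R g x)"
    using assms compact_cball unfolding locally_integrable_def set_integrable_def by blast
  then show "(\<lambda>x. indicator (cball 0 (real n)) x *\<^sub>R g x) \<in> borel_measurable lebesgue" by (rule borel_measurable_integrable)
qed

text \<open>
  Membership in the Sobolev space provides some integrable weak derivative; uniqueness transfers the integrability to the one that
  enters the norm.
\<close>

lemma weak_deriv_in_L1w:
  fixes f :: "real ^ 'd \<Rightarrow> real"
  assumes "f \<in> W1w r w" "k \<in> multi_indices r" "w \<in> borel_measurable lebesgue"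
  shows "has_weak_deriv f k (weak_deriv k f)" "integrable lebesgue (\<lambda>x. \<bar>weak_deriv k f x * w x\<bar>)"
proof -
  obtain g where g: "g \<in> L1w w" "has_weak_deriv f k g" using assms by (auto simp: W1w_def)
  show wder: "has_weak_deriv f k (weak_deriv k f)"
    unfolding weak_deriv_def by (rule someI[of "has_weak_deriv f k", OF g(2)])
  have m: "weak_deriv k f \<in> borel_measurable lebesgue"
    using wder by (intro locally_integrable_measurable) (simp add: has_weak_deriv_def)
  have gi: "integrable lebesgue (\<lambda>x. \<bar>g x * w x\<bar>)" using g(1) by (simp add: L1w_def)
  have meas: "(\<lambda>x. \<bar>weak_deriv k f x * w x\<bar>) \<in> borel_measurable lebesgue"
    by (intro borel_measurable_abs borel_measurable_times m assms(3))
  have "AE x in lebesgue. \<bar>g x * w x\<bar> = \<bar>weak_deriv k f x * w x\<bar>"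
    using weak_deriv_unique[OF g(2) wder] by eventually_elim simp
  then show "integrable lebesgue (\<lambda>x. \<bar>weak_deriv k f x * w x\<bar>)"
    by (rule integrable_cong_AE_imp[OF gi meas])
qed

lemma continuous_locally_integrable:
  fixes f :: "real ^ 'd \<Rightarrow> real"
  assumes "continuous_on UNIV f" shows "locally_integrable f"
  unfolding locally_integrable_def set_integrable_def
proof (intro allI impI)
  fix K :: "(real ^ 'd) set" assume "compact K"
  then have "integrable lborel (\<lambda>x. indicator K x *\<^sub>R f x)"
    using assms by (intro borel_integrable_compact) (auto intro: continuous_on_subset)
  then show "integrable lebesgue (\<lambda>x. indicator K x *\<^sub>R f x)"
    by (subst integrable_completion) (auto dest: borel_measurable_integrable)
qed

lemma tensor_continuous':
  fixes u :: "'d::finite \<Rightarrow> real \<Rightarrow> real"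
  assumes "\<And>i. continuous_on UNIV (u i)"
  shows "continuous_on UNIV (tensor u)"
  unfolding tensor_def
proof (rule continuous_on_prod)
  fix i :: 'd
  have "continuous_on UNIV (\<lambda>x :: real ^ 'd. x $ i)" by (intro continuous_intros)
  from continuous_on_compose2[OF assms[of i] this subset_UNIV]
  show "continuous_on UNIV (\<lambda>x :: real ^ 'd. u i (x $ i))" .
qed

text \<open>
  The mollified point masses have integral 1 and shrink to \<open>y\<close>. Continuity of \<open>f\<close> is what identifies the limit.
\<close>

lemma tensor_mollifier_tendsto:
  fixes f :: "real ^ 'd \<Rightarrow> real"
  assumes f: "continuous_on UNIV f" and e: "\<And>n. e n > 0" "e \<longlonglongrightarrow> 0"
  shows "(\<lambda>n. \<integral>x. f x * tensor (\<lambda>i t. mollifier (e n) (t - y $ i)) x \<partial>lebesgue) \<longlonglongrightarrow> f y"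
proof (rule LIMSEQ_I)
  fix \<delta> :: real assume \<delta>: "\<delta> > 0"
  have "isCont f y" using f by (simp add: continuous_on_eq_continuous_at)
  then obtain \<eta> where \<eta>: "\<eta> > 0" "\<And>x. dist x y < \<eta> \<Longrightarrow> dist (f x) (f y) < \<delta> / 2"
    unfolding continuous_at_eps_delta using \<delta> half_gt_zero[of \<delta>] by blast
  have "(\<lambda>n. real CARD('d) * e n) \<longlonglongrightarrow> 0" using tendsto_mult_right_zero[OF e(2)] by blast
  then have "\<forall>\<^sub>F n in sequentially. real CARD('d) * e n < \<eta>" using \<eta>(1) by (rule order_tendstoD(2))
  then obtain n1 where n1: "\<And>n. n \<ge> n1 \<Longrightarrow> real CARD('d) * e n < \<eta>"
    unfolding eventually_sequentially by blast
  have "norm ((\<integral>x. f x * tensor (\<lambda>i t. mollifier (e n) (t - y $ i)) x \<partial>lebesgue) - f y) < \<delta>" if n: "n \<ge> n1" for n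
  proof -
    define T where "T = tensor (\<lambda>i t. mollifier (e n) (t - y $ i))"
    have sm: "smooth1 (\<lambda>t. mollifier (e n) (t - y $ i))" for i
      using smooth1_affine(1)[OF smooth1_mollifier, of 1 "e n" 1 "- y $ i"] by simp
    have Tc: "continuous_on UNIV T" unfolding T_def by (intro tensor_continuous sm)
    have T0: "T x \<ge> 0" for x unfolding T_def tensor_def by (intro prod_nonneg) (simp add: mollifier_nonneg)
    have near: "dist x y < \<eta>" if "T x \<noteq> 0" for x
    proof -
      have "\<bar>x $ i - y $ i\<bar> \<le> e n" for i
      proof (rule ccontr)
        assume "\<not> ?thesis"
        then have "mollifier (e n) (x $ i - y $ i) = 0" by (intro mollifier_eq_0) auto
        then have "T x = 0" unfolding T_def tensor_def by (intro prod_zero) auto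
        then show False using that by simp
      qed
      then have "(\<Sum>i\<in>UNIV. \<bar>(x - y) $ i\<bar>) \<le> (\<Sum>i\<in>(UNIV :: 'd set). e n)" by (intro sum_mono) simp
      then show ?thesis using norm_le_l1_cart[of "x - y"] n1[OF n] by (simp add: dist_norm)
    qed
    have supp: "T x = 0" if "x \<notin> cball 0 (norm y + \<eta>)" for x
    proof (rule ccontr)
      assume "T x \<noteq> 0"
      then have "norm (x - y) < \<eta>" using near by (simp add: dist_norm)
      then show False using that norm_triangle_ineq2[of x y] by simp
    qed
    have one: "has_bochner_integral lborel T 1"
    proof -
      have 1: "integrable lborel (\<lambda>t. mollifier (e n) (t - y $ i))" "(\<integral>t. mollifier (e n) (t - y $ i) \<partial>lborel) = 1" for i
        using lborel_integrable_real_affine[OF mollifier_integrable, of 1 "e n" "- y $ i"]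
          lborel_integral_real_affine[of 1 "mollifier (e n)" "- y $ i"] e(1)[of n] by (simp_all add: mollifier_integral)
      show ?thesis unfolding T_def
        using tensor_integral[of "\<lambda>i t. mollifier (e n) (t - y $ i)"] 1 by (simp add: mollifier_nonneg)
    qed
    have Tm: "T \<in> borel_measurable lborel" using one by (rule borel_measurable_has_bochner_integral)
    have TI: "integrable lebesgue T" "(\<integral>x. T x \<partial>lebesgue) = 1"
      using one integrable_completion[OF Tm] integral_completion[OF Tm]
      by (auto simp: has_bochner_integral_iff)
    have I: "integrable lebesgue (\<lambda>x. f x * T x)"
      by (rule locally_integrable_times[OF continuous_locally_integrable[OF f] Tc supp])
    have "(\<integral>x. f x * T x \<partial>lebesgue) - f y = (\<integral>x. f x * T x - f y * T x \<partial>lebesgue)"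
      using I TI by simp
    also have "norm \<dots> \<le> (\<integral>x. \<delta> / 2 * T x \<partial>lebesgue)"
    proof (rule Bochner_Integration.integral_norm_bound_integral)
      fix x
      show "norm (f x * T x - f y * T x) \<le> \<delta> / 2 * T x"
      proof (cases "T x = 0")
        case False
        then have "\<bar>f x - f y\<bar> \<le> \<delta> / 2" using near \<eta>(2)[of x] by (simp add: dist_real_def)
        then have "\<bar>f x - f y\<bar> * T x \<le> \<delta> / 2 * T x" by (intro mult_right_mono T0)
        then show ?thesis using T0[of x] by (simp add: abs_mult flip: left_diff_distrib)
      qed simp
    qed (use I TI in auto)
    also have "\<dots> < \<delta>" using TI \<delta> by simp
    finally show ?thesis by (simp add: T_def)
  qed
  then show "\<exists>no. \<forall>n\<ge>no. norm ((\<integral>x. f x * tensor (\<lambda>i t. mollifier (e n) (t - y $ i)) x \<partial>lebesgue) - f y) < \<delta>" by blast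
qed

lemma quadrature_of_finite_sum:
  assumes "finite Z" "card Z \<le> n"
  shows "(\<lambda>f. \<Sum>z\<in>Z. c z * f (y z)) \<in> quadratures n"
proof -
  obtain h where h: "bij_betw h {1..card Z} Z" using ex_bij_betw_nat_finite_1[OF assms(1)] by blast
  have eq: "(\<lambda>f. \<Sum>z\<in>Z. c z * f (y z)) = (\<lambda>f. \<Sum>i=1..card Z. c (h i) * f (y (h i)))"
    by (rule ext) (rule sum.reindex_bij_betw[OF h, symmetric])
  show ?thesis unfolding quadratures_def eq
    by (rule CollectI, rule exI[of _ "card Z"], rule conjI[OF assms(2)],
        rule exI[of _ "\<lambda>i. y (h i)"], rule exI[of _ "\<lambda>i. c (h i)"]) (rule refl)
qed

context freud begin

definition weight :: "real ^ 'd \<Rightarrow> real" where "weight = tensor (\<lambda>_. w1)"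

lemma weight_pos: "weight x > 0"
  unfolding weight_def tensor_def by (intro prod_pos) (simp add: w1_pos)

lemma weight_continuous: "continuous_on UNIV weight"
  unfolding weight_def by (intro tensor_continuous' w1_continuous)

lemma weight_measurable: "weight \<in> borel_measurable lebesgue"
  by (rule continuous_imp_lebesgue_measurable[OF weight_continuous])

text \<open>
  Expanding the product, every factor contributes either \<open>A i\<close> or the derivative of \<open>B i\<close>. Each of the
  \<open>2 ^ d\<close> terms is the mixed derivative of a test function of size \<open>\<Prod>i. c i * w1 x\<^sub>i\<close> with a different multi-index
  in \<open>{0, r} ^ d\<close>, so the definition of the weak derivative bounds its pairing with \<open>f\<close> by the corresponding
  summand of the Sobolev norm.
\<close>

lemma tensor_functional_bound:
  fixes f :: "real ^ 'd \<Rightarrow> real"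
  assumes f: "f \<in> W1w_unit_ball r weight" and r: "r \<ge> 1"
    and split: "\<And>i. smooth_split r (\<lambda>x. c i * w1 x) (D i)"
  shows "integrable lebesgue (\<lambda>x. f x * tensor D x)" "\<bar>\<integral>x. f x * tensor D x \<partial>lebesgue\<bar> \<le> (\<Prod>i\<in>UNIV. c i)"
proof -
  obtain A B u0 where ABu: "\<And>i x. D i x = A i x + (deriv ^^ r) (B i) x"
    and sm: "\<And>i. smooth1 (A i)" "\<And>i. smooth1 (B i)"
    and supp0: "\<And>i x. \<bar>x\<bar> > u0 i \<Longrightarrow> A i x = 0 \<and> B i x = 0"
    and bound: "\<And>i x. \<bar>A i x\<bar> \<le> c i * w1 x" "\<And>i x. \<bar>B i x\<bar> \<le> c i * w1 x"
    using split unfolding smooth_split_def by metis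
  define u where "u = (\<Sum>i\<in>UNIV. \<bar>u0 i\<bar>)"
  have u: "u0 i \<le> u" for i
  proof -
    have "\<bar>u0 i\<bar> \<le> u" unfolding u_def by (rule member_le_sum) auto
    then show ?thesis by simp
  qed
  have supp: "A i x = 0" "B i x = 0" if "\<bar>x\<bar> > u" for i x
    using supp0[of i x] u[of i] that by linarith+
  \<comment> \<open>\<open>S\<close> collects the coordinates that contribute \<open>A i\<close>\<close>
  define k where "k S = (\<chi> i. if i \<in> S then 0 else r)" for S :: "'d set"
  define \<phi> where "\<phi> S = tensor (\<lambda>i. if i \<in> S then A i else B i)" for S
  have fW: "f \<in> W1w r weight" and norm: "W1w_norm r weight f \<le> 1" and fc: "continuous_on UNIV f"
    using f by (auto simp: W1w_unit_ball_def)
  have c0: "c i \<ge> 0" for i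
    using bound(1)[of i 0] w1_pos[of 0] by (smt (verit) mult_neg_pos)
  have sm': "smooth1 (if i \<in> S then A i else B i)" for i S using sm by simp
  have supp': "(if i \<in> S then A i else B i) x = 0" if "\<bar>x\<bar> > \<bar>u\<bar>" for i S x using supp that by auto
  have \<phi>t: "\<phi> S \<in> test_functions" for S unfolding \<phi>_def
    by (rule tensor_test_function[OF sm' supp']) auto
  have md: "mixed_deriv (k S) (\<phi> S) = tensor (\<lambda>i. if i \<in> S then A i else (deriv ^^ r) (B i))" for S
    unfolding \<phi>_def mixed_deriv_tensor[OF sm'] k_def by (intro arg_cong[of _ _ tensor] ext) auto
  have exp: "tensor D x = (\<Sum>S\<in>Pow UNIV. mixed_deriv (k S) (\<phi> S) x)" for x
  proof -
    have "tensor D x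
      = (\<Sum>S\<in>Pow UNIV. (\<Prod>i\<in>S. A i (x $ i)) * (\<Prod>i\<in>UNIV - S. (deriv ^^ r) (B i) (x $ i)))"
      unfolding tensor_def ABu by (rule prod_add) simp
    also have "\<dots> = (\<Sum>S\<in>Pow UNIV. mixed_deriv (k S) (\<phi> S) x)"
    proof (rule sum.cong[OF refl])
      fix S :: "'d set"
      have "(\<Prod>i\<in>UNIV. (if i \<in> S then A i else (deriv ^^ r) (B i)) (x $ i))
        = (\<Prod>i\<in>S. (if i \<in> S then A i else (deriv ^^ r) (B i)) (x $ i)) * (\<Prod>i\<in>UNIV - S. (if i \<in> S then A i else (deriv ^^ r) (B i)) (x $ i))"
        by (subst prod.subset_diff[of S UNIV]) (auto simp: mult.commute)
      then show "(\<Prod>i\<in>S. A i (x $ i)) * (\<Prod>i\<in>UNIV - S. (deriv ^^ r) (B i) (x $ i)) = mixed_deriv (k S) (\<phi> S) x"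
        unfolding md tensor_def by simp
    qed
    finally show ?thesis .
  qed
  have I: "integrable lebesgue (\<lambda>x. f x * mixed_deriv (k S) (\<phi> S) x)" for S
  proof (rule locally_integrable_times[OF continuous_locally_integrable[OF fc]])
    show "continuous_on UNIV (mixed_deriv (k S) (\<phi> S))" unfolding md
      by (intro tensor_continuous) (simp add: sm smooth1_derivs)
    have "(deriv ^^ r) (B i) x = 0" if "\<bar>x\<bar> > \<bar>u\<bar>" for i x
      using deriv_vanishes_abs[of "\<bar>u\<bar>" "B i" x r] supp(2)[of _ i] that by auto
    then have s: "(if i \<in> S then A i else (deriv ^^ r) (B i)) x = 0" if "\<bar>x\<bar> > \<bar>u\<bar>" for i x using supp(1) that by auto
    show "mixed_deriv (k S) (\<phi> S) x = 0" if "x \<notin> cball 0 (real CARD('d) * \<bar>u\<bar>)" for x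
      unfolding md by (rule tensor_support[OF s _ that]) auto
  qed
  have kr: "k S \<in> multi_indices r" for S by (auto simp: k_def multi_indices_def)
  have one: "\<bar>\<integral>x. f x * mixed_deriv (k S) (\<phi> S) x \<partial>lebesgue\<bar> \<le> (\<Prod>i\<in>UNIV. c i) * L1w_norm weight (weak_deriv (k S) f)" for S
  proof -
    define g where "g = weak_deriv (k S) f"
    note g = weak_deriv_in_L1w[OF fW kr[of S] weight_measurable, folded g_def]
    have "\<bar>\<integral>x. f x * mixed_deriv (k S) (\<phi> S) x \<partial>lebesgue\<bar> = \<bar>\<integral>x. g x * \<phi> S x \<partial>lebesgue\<bar>"
      using g(1) \<phi>t by (simp add: has_weak_deriv_def abs_mult power_abs)
    moreover have "norm (\<integral>x. g x * \<phi> S x \<partial>lebesgue) \<le> (\<integral>x. (\<Prod>i\<in>UNIV. c i) * \<bar>g x * weight x\<bar> \<partial>lebesgue)"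
    proof (rule Bochner_Integration.integral_norm_bound_integral)
      show "integrable lebesgue (\<lambda>x. g x * \<phi> S x)"
      proof (rule locally_integrable_times)
        show "locally_integrable g" using g(1) by (simp add: has_weak_deriv_def)
        show "continuous_on UNIV (\<phi> S)" unfolding \<phi>_def by (intro tensor_continuous sm')
        show "\<phi> S x = 0" if "x \<notin> cball 0 (real CARD('d) * \<bar>u\<bar>)" for x
          unfolding \<phi>_def by (rule tensor_support[OF supp' _ that]) auto
      qed
      show "integrable lebesgue (\<lambda>x. (\<Prod>i\<in>UNIV. c i) * \<bar>g x * weight x\<bar>)" using g(2) by simp
      fix x
      have "\<bar>\<phi> S x\<bar> \<le> (\<Prod>i\<in>UNIV. c i * w1 (x $ i))"
        unfolding \<phi>_def tensor_def abs_prod using bound by (intro prod_mono) auto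
      also have "\<dots> = (\<Prod>i\<in>UNIV. c i) * weight x" by (simp add: weight_def tensor_def prod.distrib)
      finally have "\<bar>g x\<bar> * \<bar>\<phi> S x\<bar> \<le> \<bar>g x\<bar> * ((\<Prod>i\<in>UNIV. c i) * weight x)" by (intro mult_left_mono) auto
      then show "norm (g x * \<phi> S x) \<le> (\<Prod>i\<in>UNIV. c i) * \<bar>g x * weight x\<bar>"
        using weight_pos[of x] by (simp add: abs_mult mult_ac)
    qed
    ultimately show ?thesis by (simp add: L1w_norm_def g_def)
  qed
  have L0: "L1w_norm weight g \<ge> 0" for g :: "real ^ 'd \<Rightarrow> real" by (simp add: L1w_norm_def)
  show "integrable lebesgue (\<lambda>x. f x * tensor D x)"
    unfolding exp sum_distrib_left by (intro Bochner_Integration.integrable_sum I)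
  have "(\<integral>x. f x * tensor D x \<partial>lebesgue)
     = (\<Sum>S\<in>Pow UNIV. \<integral>x. f x * mixed_deriv (k S) (\<phi> S) x \<partial>lebesgue)"
    unfolding exp sum_distrib_left by (rule Bochner_Integration.integral_sum) (rule I)
  also have "\<bar>\<dots>\<bar> \<le> (\<Sum>S\<in>Pow UNIV. (\<Prod>i\<in>UNIV. c i) * L1w_norm weight (weak_deriv (k S) f))"
    by (rule order_trans[OF sum_abs]) (intro sum_mono one)
  also have "\<dots> = (\<Prod>i\<in>UNIV. c i) * (\<Sum>S\<in>Pow UNIV. L1w_norm weight (weak_deriv (k S) f))"
    by (simp only: sum_distrib_left)
  also have "(\<Sum>S\<in>Pow UNIV. L1w_norm weight (weak_deriv (k S) f)) = (\<Sum>l\<in>k ` Pow UNIV. L1w_norm weight (weak_deriv l f))"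
  proof (rule sum.reindex[symmetric, unfolded o_def])
    show "inj_on k (Pow UNIV)"
    proof (rule inj_onI)
      fix S T assume "k S = k T"
      then have "k S $ i = k T $ i" for i by simp
      then have e: "(if i \<in> S then 0 else r) = (if i \<in> T then 0 else r)" for i by (simp add: k_def)
      have "i \<in> S \<longleftrightarrow> i \<in> T" for i using e[of i] r by (auto split: if_splits)
      then show "S = T" by blast
    qed
  qed
  also have "(\<Prod>i\<in>UNIV. c i) * (\<Sum>l\<in>k ` Pow UNIV. L1w_norm weight (weak_deriv l f)) \<le> (\<Prod>i\<in>UNIV. c i) * 1"
  proof (rule mult_left_mono)
    have "(\<Sum>l\<in>k ` Pow UNIV. L1w_norm weight (weak_deriv l f)) \<le> W1w_norm r weight f"
      unfolding W1w_norm_def using kr by (intro sum_mono2 finite_multi_indices L0) auto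
    then show "(\<Sum>l\<in>k ` Pow UNIV. L1w_norm weight (weak_deriv l f)) \<le> 1" using norm by simp
  qed (simp add: prod_nonneg c0)
  finally show "\<bar>\<integral>x. f x * tensor D x \<partial>lebesgue\<bar> \<le> (\<Prod>i\<in>UNIV. c i)" by simp
qed

text \<open>
  Smolyak's construction. The product of the smoothed weights is the sum of the tensor products of
  \<open>D (k i)\<close> over all \<open>k\<close> in \<open>{0..m + 1} ^ d\<close>. The terms with \<open>sum k UNIV \<le> m\<close> only involve mollified point masses, and
  they tend to a quadrature as the mollification is removed. The remaining terms are the error.
\<close>

lemma smolyak_quadrature:
  assumes r: "r \<ge> 1"
  obtains C where "C > 0"
    "\<And>m. \<exists>Q \<in> quadratures (\<Sum>k | (\<forall>i. k i \<le> m + 1) \<and> sum k UNIV \<le> m. \<Prod>i\<in>(UNIV :: 'd set). 8 * r * 2 ^ k i).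
       \<forall>f \<in> W1w_unit_ball r (weight :: real ^ 'd \<Rightarrow> real). \<bar>(\<integral>x. f x * weight x \<partial>lebesgue) - Q f\<bar> \<le>
           (\<Sum>k | (\<forall>i. k i \<le> m + 1) \<and> m < sum k UNIV. \<Prod>i\<in>(UNIV :: 'd set). C * rate r (k i))"
proof -
  obtain C where C: "C > 0" and scheme:
    "\<And>m. \<exists>(I :: nat \<Rightarrow> (bool \<times> bool \<times> nat \<times> nat) set) Y c c' e n1. smolyak_scheme r C m I Y c c' e n1"
    using smolyak_scheme_exists[OF r] by blast
  show ?thesis
  proof (rule that[OF C])
    fix m :: nat
    obtain I :: "nat \<Rightarrow> (bool \<times> bool \<times> nat \<times> nat) set" and Y c c' e and n1 :: nat
      where "smolyak_scheme r C m I Y c c' e n1" using scheme[of m] by blast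
    then have I: "\<And>j. finite (I j)" "\<And>j. card (I j) \<le> 8 * r * 2 ^ j" and cc: "\<And>j i. (\<lambda>n. c n j i) \<longlonglongrightarrow> c' j i"
      and e: "\<And>n. e n > 0" "e \<longlonglongrightarrow> 0"
      and splits: "\<And>n. n \<ge> n1 \<Longrightarrow> \<exists>D. (\<forall>j\<le>m. \<forall>x. D j x = (\<Sum>i\<in>I j. c n j i * mollifier (e n) (x - Y j i))) \<and>
         (\<forall>j\<le>m + 1. smooth_split r (\<lambda>x. C * rate r j * w1 x) (D j)) \<and> (\<forall>x. (\<Sum>j\<le>m + 1. D j x) = smoothed_weight n (e n) x)"
      and om: "\<And>n x. \<bar>smoothed_weight n (e n) x\<bar> \<le> 2 * w1 x" "\<And>x. (\<lambda>n. smoothed_weight n (e n) x) \<longlonglongrightarrow> w1 x"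
      unfolding smolyak_scheme_def by blast+
    define \<omega> where "\<omega> n = smoothed_weight n (e n)" for n
    define F where "F = PiE (UNIV :: 'd set) (\<lambda>_. {..m + 1})"
    define K where "K = {k \<in> F. sum k UNIV \<le> m}"
    define K' where "K' = {k \<in> F. m < sum k UNIV}"
    have F: "finite F" unfolding F_def by (intro finite_PiE) auto
    have FK: "finite F" "finite K" "finite K'" "F = K \<union> K'" "K \<inter> K' = {}"
      using F by (auto simp: K_def K'_def)
    have Keq: "K = {k. (\<forall>i. k i \<le> m + 1) \<and> sum k UNIV \<le> m}" "K' = {k. (\<forall>i. k i \<le> m + 1) \<and> m < sum k UNIV}"
      by (auto simp: F_def K_def K'_def)
    define E where "E = (\<Sum>k\<in>K'. \<Prod>i\<in>UNIV. C * rate r (k i))"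
    define Z where "Z = (SIGMA k:K. PiE UNIV (\<lambda>i. I (k i)))"
    define y where "y = (\<lambda>(k, z). (\<chi> i. Y (k i) (z i)) :: real ^ 'd)"
    define co where "co n = (\<lambda>(k :: 'd \<Rightarrow> nat, z). \<Prod>i\<in>UNIV. c n (k i) (z i))" for n
    define co' where "co' = (\<lambda>(k :: 'd \<Rightarrow> nat, z). \<Prod>i\<in>UNIV. c' (k i) (z i))"
    define Q where "Q f = (\<Sum>z\<in>Z. co' z * f (y z))" for f :: "real ^ 'd \<Rightarrow> real"
    have finZ: "finite Z" unfolding Z_def using FK I by (intro finite_SigmaI finite_PiE) auto
    have "card Z = (\<Sum>k\<in>K. \<Prod>i\<in>UNIV. card (I (k i)))"
      unfolding Z_def using FK I by (subst card_SigmaI) (auto simp: card_PiE intro!: finite_PiE)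
    also have "\<dots> \<le> (\<Sum>k\<in>K. \<Prod>i\<in>UNIV. 8 * r * 2 ^ k i)" using I by (intro sum_mono prod_mono) auto
    finally have "Q \<in> quadratures (\<Sum>k\<in>K. \<Prod>i\<in>UNIV. 8 * r * 2 ^ k i)"
      unfolding Q_def[abs_def] by (intro quadrature_of_finite_sum finZ)
    moreover have "\<bar>(\<integral>x. f x * weight x \<partial>lebesgue) - Q f\<bar> \<le> E" if f: "f \<in> W1w_unit_ball r (weight :: real ^ 'd \<Rightarrow> real)" for f
    proof -
      have fc: "continuous_on UNIV f" and fL: "f \<in> borel_measurable lebesgue" "integrable lebesgue (\<lambda>x. \<bar>f x * weight x\<bar>)"
        using f by (auto simp: W1w_unit_ball_def W1w_def L1w_def)
      define T where "T n z = tensor (\<lambda>i t. mollifier (e n) (t - y z $ i))" for n z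
      define S where "S n = (\<Sum>z\<in>Z. co n z * (\<integral>x. f x * T n z x \<partial>lebesgue))" for n
      have Slim: "S \<longlonglongrightarrow> Q f"
        unfolding S_def[abs_def] Q_def T_def
      proof (intro tendsto_sum tendsto_mult)
        fix z show "(\<lambda>n. co n z) \<longlonglongrightarrow> co' z"
          unfolding co_def co'_def by (cases z) (auto intro!: tendsto_prod cc)
        show "(\<lambda>n. \<integral>x. f x * tensor (\<lambda>i t. mollifier (e n) (t - y z $ i)) x \<partial>lebesgue) \<longlonglongrightarrow> f (y z)"
          by (rule tensor_mollifier_tendsto[OF fc e])
      qed
      have \<omega>c: "continuous_on UNIV (\<omega> n)" if n: "n \<ge> n1" for n
      proof -
        obtain D where D: "\<And>j. j \<le> m + 1 \<Longrightarrow> smooth_split r (\<lambda>x. C * rate r j * w1 x) (D j)" "\<And>x. (\<Sum>j\<le>m + 1. D j x) = \<omega> n x"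
          using splits[OF n] unfolding \<omega>_def by blast
        have "continuous_on UNIV (D j)" if "j \<le> m + 1" for j
        proof -
          from D(1)[OF that] obtain A B where "D j = (\<lambda>x. A x + (deriv ^^ r) B x)" "smooth1 A" "smooth1 B"
            unfolding smooth_split_def by blast
          then show ?thesis by (simp add: continuous_on_add smooth1_continuous smooth1_derivs)
        qed
        then have "continuous_on UNIV (\<lambda>x. \<Sum>j\<le>m + 1. D j x)" by (intro continuous_on_sum) auto
        then show ?thesis unfolding D(2) by simp
      qed
      have Ilim: "(\<lambda>n. \<integral>x. f x * tensor (\<lambda>_. \<omega> (n + n1)) x \<partial>lebesgue) \<longlonglongrightarrow> (\<integral>x. f x * weight x \<partial>lebesgue)"
      proof (rule integral_dominated_convergence)
        show "(\<lambda>x. f x * weight x) \<in> borel_measurable lebesgue" using fL(1) weight_measurable by (rule borel_measurable_times)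
        show "(\<lambda>x. f x * tensor (\<lambda>_. \<omega> (n + n1)) x) \<in> borel_measurable lebesgue" for n
          by (intro borel_measurable_times fL continuous_imp_lebesgue_measurable tensor_continuous' \<omega>c) simp
        show "integrable lebesgue (\<lambda>x. 2 ^ CARD('d) * \<bar>f x * weight x\<bar>)" using fL(2) by simp
        show "AE x in lebesgue. (\<lambda>n. f x * tensor (\<lambda>_. \<omega> (n + n1)) x) \<longlonglongrightarrow> f x * weight x"
          unfolding tensor_def weight_def \<omega>_def
          by (intro AE_I2 tendsto_mult tendsto_const tendsto_prod LIMSEQ_ignore_initial_segment om)
        show "AE x in lebesgue. norm (f x * tensor (\<lambda>_. \<omega> (n + n1)) x) \<le> 2 ^ CARD('d) * \<bar>f x * weight x\<bar>" for n
        proof (rule AE_I2)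
          fix x :: "real ^ 'd"
          have "\<bar>tensor (\<lambda>_. \<omega> (n + n1)) x\<bar> \<le> (\<Prod>i\<in>UNIV. 2 * w1 (x $ i))"
            unfolding tensor_def abs_prod using om(1)[of "n + n1"] by (intro prod_mono) (auto simp: \<omega>_def)
          also have "\<dots> = 2 ^ CARD('d) * weight x" by (simp add: weight_def tensor_def prod.distrib)
          finally have "\<bar>f x\<bar> * \<bar>tensor (\<lambda>_. \<omega> (n + n1)) x\<bar> \<le> \<bar>f x\<bar> * (2 ^ CARD('d) * weight x)" by (intro mult_left_mono) auto
          then show "norm (f x * tensor (\<lambda>_. \<omega> (n + n1)) x) \<le> 2 ^ CARD('d) * \<bar>f x * weight x\<bar>"
            using weight_pos[of x] by (simp add: abs_mult mult_ac)
        qed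
      qed
      have bound: "\<bar>(\<integral>x. f x * tensor (\<lambda>_. \<omega> n) x \<partial>lebesgue) - S n\<bar> \<le> E" if n: "n \<ge> n1" for n
      proof -
        obtain D where D: "\<And>j x. j \<le> m \<Longrightarrow> D j x = (\<Sum>i\<in>I j. c n j i * mollifier (e n) (x - Y j i))"
           "\<And>j. j \<le> m + 1 \<Longrightarrow> smooth_split r (\<lambda>x. C * rate r j * w1 x) (D j)" "\<And>x. (\<Sum>j\<le>m + 1. D j x) = \<omega> n x"
          using splits[OF n] unfolding \<omega>_def by blast
        define P where "P k = tensor (\<lambda>i. D (k i))" for k :: "'d \<Rightarrow> nat"
        have PI: "integrable lebesgue (\<lambda>x. f x * P k x)"
          and big: "\<bar>\<integral>x. f x * P k x \<partial>lebesgue\<bar> \<le> (\<Prod>i\<in>UNIV. C * rate r (k i))" if "k \<in> F" for k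
        proof -
          have "smooth_split r (\<lambda>x. C * rate r (k i) * w1 x) (D (k i))" for i
            using that by (intro D(2)) (auto simp: F_def)
          from tensor_functional_bound[where D = "\<lambda>i. D (k i)" and c = "\<lambda>i. C * rate r (k i)", OF f r this]
          show "integrable lebesgue (\<lambda>x. f x * P k x)"
            "\<bar>\<integral>x. f x * P k x \<partial>lebesgue\<bar> \<le> (\<Prod>i\<in>UNIV. C * rate r (k i))" unfolding P_def .
        qed
        have all: "tensor (\<lambda>_. \<omega> n) x = (\<Sum>k\<in>F. P k x)" for x
          unfolding tensor_def D(3)[symmetric] P_def F_def by (rule prod_sum_PiE) auto
        have small: "P k x = (\<Sum>z\<in>PiE UNIV (\<lambda>i. I (k i)). co n (k, z) * T n (k, z) x)" if "k \<in> K" for k x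
        proof -
          have km: "k i \<le> m" for i
          proof -
            have "k i \<le> sum k UNIV" by (rule member_le_sum) auto
            then show ?thesis using that by (simp add: K_def)
          qed
          have "P k x = (\<Prod>i\<in>UNIV. \<Sum>z\<in>I (k i). c n (k i) z * mollifier (e n) (x $ i - Y (k i) z))"
            unfolding P_def tensor_def using D(1)[OF km] by simp
          also have "\<dots> = (\<Sum>z\<in>PiE UNIV (\<lambda>i. I (k i)). \<Prod>i\<in>UNIV. c n (k i) (z i) * mollifier (e n) (x $ i - Y (k i) (z i)))"
            using I by (intro prod_sum_PiE) auto
          finally show ?thesis by (simp add: prod.distrib co_def T_def tensor_def y_def)
        qed
        have Tint: "integrable lebesgue (\<lambda>x. f x * T n z x)" for z
        proof (rule locally_integrable_times[OF continuous_locally_integrable[OF fc]])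
          have sm: "smooth1 (\<lambda>t. mollifier (e n) (t - y z $ i))" for i
            using smooth1_affine(1)[OF smooth1_mollifier, of 1 "e n" 1 "- y z $ i"] by simp
          show "continuous_on UNIV (T n z)" unfolding T_def by (intro tensor_continuous sm)
          have s: "mollifier (e n) (t - y z $ i) = 0" if "\<bar>t\<bar> > e n + norm (y z)" for t i
            using that component_le_norm_cart[of "y z" i] by (intro mollifier_eq_0) linarith
          show "T n z x = 0" if "x \<notin> cball 0 (real CARD('d) * (e n + norm (y z)))" for x
            unfolding T_def by (rule tensor_support[OF s _ that]) (use e(1)[of n] in \<open>auto simp: less_imp_le\<close>)
        qed
        have "(\<Sum>k\<in>K. \<integral>x. f x * P k x \<partial>lebesgue) = (\<Sum>k\<in>K. \<Sum>z\<in>PiE UNIV (\<lambda>i. I (k i)). co n (k, z) * (\<integral>x. f x * T n (k, z) x \<partial>lebesgue))"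
        proof (rule sum.cong[OF refl])
          fix k assume k: "k \<in> K"
          have "(\<integral>x. f x * P k x \<partial>lebesgue) = (\<integral>x. (\<Sum>z\<in>PiE UNIV (\<lambda>i. I (k i)). co n (k, z) * (f x * T n (k, z) x)) \<partial>lebesgue)"
            by (simp add: small[OF k] sum_distrib_left mult_ac)
          also have "\<dots> = (\<Sum>z\<in>PiE UNIV (\<lambda>i. I (k i)). (\<integral>x. co n (k, z) * (f x * T n (k, z) x) \<partial>lebesgue))"
            by (rule Bochner_Integration.integral_sum) (simp add: Tint)
          finally show "(\<integral>x. f x * P k x \<partial>lebesgue) = (\<Sum>z\<in>PiE UNIV (\<lambda>i. I (k i)). co n (k, z) * (\<integral>x. f x * T n (k, z) x \<partial>lebesgue))"
            by simp
        qed
        also have "\<dots> = S n"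
          unfolding S_def Z_def by (subst sum.Sigma) (use FK I in \<open>auto intro!: finite_PiE simp: split_def\<close>)
        finally have SK: "(\<Sum>k\<in>K. \<integral>x. f x * P k x \<partial>lebesgue) = S n" .
        have "(\<integral>x. f x * tensor (\<lambda>_. \<omega> n) x \<partial>lebesgue) = (\<Sum>k\<in>F. \<integral>x. f x * P k x \<partial>lebesgue)"
          unfolding all sum_distrib_left by (rule Bochner_Integration.integral_sum) (rule PI)
        also have "\<dots> = S n + (\<Sum>k\<in>K'. \<integral>x. f x * P k x \<partial>lebesgue)"
          unfolding FK(4) SK[symmetric] by (rule sum.union_disjoint[OF FK(2,3,5)])
        finally have "\<bar>(\<integral>x. f x * tensor (\<lambda>_. \<omega> n) x \<partial>lebesgue) - S n\<bar> = \<bar>\<Sum>k\<in>K'. \<integral>x. f x * P k x \<partial>lebesgue\<bar>" by simp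
        also have "\<dots> \<le> E" unfolding E_def
          by (rule order_trans[OF sum_abs]) (intro sum_mono big, auto simp: K'_def)
        finally show ?thesis .
      qed
      have "(\<lambda>n. \<bar>(\<integral>x. f x * tensor (\<lambda>_. \<omega> (n + n1)) x \<partial>lebesgue) - S (n + n1)\<bar>) \<longlonglongrightarrow> \<bar>(\<integral>x. f x * weight x \<partial>lebesgue) - Q f\<bar>"
        by (intro tendsto_rabs tendsto_diff Ilim LIMSEQ_ignore_initial_segment Slim)
      then show ?thesis by (rule LIMSEQ_le_const2) (use bound in auto)
    qed
    ultimately show "\<exists>Q \<in> quadratures (\<Sum>k | (\<forall>i. k i \<le> m + 1) \<and> sum k UNIV \<le> m. \<Prod>i\<in>(UNIV :: 'd set). 8 * r * 2 ^ k i).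
       \<forall>f \<in> W1w_unit_ball r (weight :: real ^ 'd \<Rightarrow> real). \<bar>(\<integral>x. f x * weight x \<partial>lebesgue) - Q f\<bar> \<le>
           (\<Sum>k | (\<forall>i. k i \<le> m + 1) \<and> m < sum k UNIV. \<Prod>i\<in>(UNIV :: 'd set). C * rate r (k i))"
      unfolding E_def Keq by blast
  qed
qed

end

section \<open>Integration by parts and fooling functions\<close>

text \<open>
  By translation invariance, every difference quotient of \<open>G\<close> has integral 0. The mean value theorem dominates these quotients,
  so the same holds for their limit.
\<close>

lemma integral_partial_eq_0:
  fixes G :: "real ^ 'd \<Rightarrow> real"
  assumes diff: "\<And>x. G differentiable (at x)" and cont: "continuous_on UNIV (partial i G)"
    and supp: "\<And>x. x \<notin> cball 0 R \<Longrightarrow> G x = 0"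
  shows "(\<integral>x. partial i G x \<partial>lebesgue) = 0"
proof -
  define e :: "real ^ 'd" where "e = axis i 1"
  have ne: "norm e = 1" by (simp add: e_def)
  have Gc: "continuous_on UNIV G"
    by (simp add: continuous_at_imp_continuous_on diff differentiable_imp_continuous_within)
  have Gm: "G \<in> borel_measurable borel" by (rule borel_measurable_continuous_onI[OF Gc])
  have GI: "integrable lborel G"
  proof -
    have "integrable lborel (\<lambda>x. indicator (cball 0 R) x *\<^sub>R G x)"
      by (rule borel_integrable_compact) (auto intro: continuous_on_subset[OF Gc])
    also have "(\<lambda>x. indicator (cball 0 R) x *\<^sub>R G x) = G" using supp by (auto simp: indicator_def fun_eq_iff)
    finally show ?thesis .
  qed
  have line: "((\<lambda>t. G (x + t *\<^sub>R e)) has_real_derivative partial i G (x + t *\<^sub>R e)) (at t within T)" for x t T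
  proof -
    have "(G has_derivative frechet_derivative G (at (x + t *\<^sub>R e))) (at (x + t *\<^sub>R e))"
      using diff frechet_derivative_works by blast
    moreover have "((\<lambda>t. x + t *\<^sub>R e) has_derivative (\<lambda>t. t *\<^sub>R e)) (at t within T)"
      by (auto intro!: derivative_eq_intros)
    ultimately have D: "((\<lambda>t. G (x + t *\<^sub>R e)) has_derivative (\<lambda>s. frechet_derivative G (at (x + t *\<^sub>R e)) (s *\<^sub>R e))) (at t within T)"
      by (rule has_derivative_compose[rotated])
    have "linear (frechet_derivative G (at (x + t *\<^sub>R e)))" using diff by (rule linear_frechet_derivative)
    then have "frechet_derivative G (at (x + t *\<^sub>R e)) (s *\<^sub>R e) = partial i G (x + t *\<^sub>R e) * s" for s
      by (simp add: linear_cmul partial_def e_def)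
    then show ?thesis using D by (simp add: has_field_derivative_def)
  qed
  define s where "s n = inverse (real (Suc n))" for n
  have s: "s n > 0" "s n \<le> 1" for n by (auto simp: s_def field_simps)
  have s0: "s \<longlonglongrightarrow> 0" unfolding s_def by (rule LIMSEQ_inverse_real_of_nat)
  have "compact (partial i G ` cball 0 (R + 2))"
    by (intro compact_continuous_image continuous_on_subset[OF cont]) auto
  then obtain M where M: "\<And>x. x \<in> cball 0 (R + 2) \<Longrightarrow> \<bar>partial i G x\<bar> \<le> M"
    by (metis compact_imp_bounded bounded_iff imageI real_norm_def)
  define dq where "dq n x = (G (x + s n *\<^sub>R e) - G x) / s n" for n x
  have dq0: "(\<integral>x. dq n x \<partial>lborel) = 0" for n
  proof -
    have "(\<integral>x. G (s n *\<^sub>R e + x) \<partial>lborel) = (\<integral>x. G x \<partial>distr lborel borel ((+) (s n *\<^sub>R e)))"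
      by (rule integral_distr[symmetric]) (use Gm in auto)
    then have 1: "(\<integral>x. G (x + s n *\<^sub>R e) \<partial>lborel) = (\<integral>x. G x \<partial>lborel)"
      by (simp add: lborel_distr_plus add.commute)
    have "integrable lborel G \<longleftrightarrow> integrable lborel (\<lambda>x. G (s n *\<^sub>R e + x))"
      using integrable_distr_eq[of "(+) (s n *\<^sub>R e)" lborel borel G] Gm by (simp add: lborel_distr_plus)
    then have 2: "integrable lborel (\<lambda>x. G (x + s n *\<^sub>R e))" using GI by (simp add: add.commute)
    show ?thesis unfolding dq_def using 1 2 GI by simp
  qed
  have dqb: "\<bar>dq n x\<bar> \<le> indicator (cball 0 (R + 1)) x * \<bar>M\<bar>" for n x
  proof (cases "x \<in> cball 0 (R + 1)")
    case True
    have "norm (G (x + s n *\<^sub>R e) - G (x + 0 *\<^sub>R e)) \<le> \<bar>M\<bar> * norm (s n - 0)"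
    proof (rule field_differentiable_bound[where S = "{0..s n}" and f = "\<lambda>t. G (x + t *\<^sub>R e)" and f' = "\<lambda>t. partial i G (x + t *\<^sub>R e)"])
      show "((\<lambda>t. G (x + t *\<^sub>R e)) has_field_derivative partial i G (x + t *\<^sub>R e)) (at t within {0..s n})" for t
        by (rule line)
      fix t assume t: "t \<in> {0..s n}"
      have "norm (x + t *\<^sub>R e) \<le> norm x + \<bar>t\<bar> * norm e" using norm_triangle_ineq[of x "t *\<^sub>R e"] by simp
      then have "norm (x + t *\<^sub>R e) \<le> R + 2" using True t s(2)[of n] ne by simp
      then show "norm (partial i G (x + t *\<^sub>R e)) \<le> \<bar>M\<bar>" using M[of "x + t *\<^sub>R e"] by simp
    qed (use s[of n] in auto)
    then have "\<bar>G (x + s n *\<^sub>R e) - G x\<bar> \<le> \<bar>M\<bar> * s n" using s[of n] by simp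
    then show ?thesis using True s(1)[of n] by (simp add: dq_def field_simps)
  next
    case False
    have "norm x \<le> norm (x + s n *\<^sub>R e) + norm (s n *\<^sub>R e)" using norm_triangle_ineq4[of "x + s n *\<^sub>R e" "s n *\<^sub>R e"] by simp
    then have "norm x \<le> norm (x + s n *\<^sub>R e) + 1" using s[of n] ne by simp
    then have "x + s n *\<^sub>R e \<notin> cball 0 R" "x \<notin> cball 0 R" using False by auto
    then show ?thesis using False by (simp add: dq_def supp)
  qed
  have pm: "partial i G \<in> borel_measurable borel" by (rule borel_measurable_continuous_onI[OF cont])
  have "(\<lambda>n. \<integral>x. dq n x \<partial>lborel) \<longlonglongrightarrow> (\<integral>x. partial i G x \<partial>lborel)"
  proof (rule integral_dominated_convergence)
    show "partial i G \<in> borel_measurable lborel" using pm by simp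
    show "(\<lambda>x. dq n x) \<in> borel_measurable lborel" for n unfolding dq_def using Gm by measurable
    have "integrable lborel (\<lambda>x. indicator (cball 0 (R + 1)) x *\<^sub>R \<bar>M\<bar>)" by (rule borel_integrable_compact) auto
    then show "integrable lborel (\<lambda>x. indicator (cball 0 (R + 1)) x * \<bar>M\<bar>)" by simp
    show "AE x in lborel. (\<lambda>n. dq n x) \<longlonglongrightarrow> partial i G x"
    proof (rule AE_I2)
      fix x
      have "((\<lambda>t. G (x + t *\<^sub>R e)) has_real_derivative partial i G (x + 0 *\<^sub>R e)) (at 0)" by (rule line)
      then have "((\<lambda>h. (G (x + h *\<^sub>R e) - G x) / h) \<longlongrightarrow> partial i G x) (at 0)" by (simp add: DERIV_def)
      moreover have "filterlim s (at 0) sequentially"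
        using s0 s(1) by (auto simp: filterlim_at intro!: always_eventually) (metis less_irrefl)
      ultimately show "(\<lambda>n. dq n x) \<longlonglongrightarrow> partial i G x" unfolding dq_def by (rule filterlim_compose)
    qed
    show "AE x in lborel. norm (dq n x) \<le> indicator (cball 0 (R + 1)) x * \<bar>M\<bar>" for n
      using dqb by simp
  qed
  then have "(\<integral>x. partial i G x \<partial>lborel) = 0" unfolding dq0 by (simp add: LIMSEQ_const_iff)
  then show ?thesis using integral_completion[of "partial i G" lborel] pm by simp
qed

lemma smooth_differentiable: "smooth f \<Longrightarrow> f differentiable (at x)"
  unfolding smooth_def by (metis foldr.simps(1) id_apply)

lemma tensor_parts:
  fixes u :: "'d::finite \<Rightarrow> real \<Rightarrow> real"
  assumes u: "\<And>i. smooth1 (u i)" "\<And>i x. \<bar>x\<bar> > B \<Longrightarrow> u i x = 0" "B \<ge> 0" and P: "smooth P"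
  shows "(\<integral>x. tensor u x * partial i P x \<partial>lebesgue) = - (\<integral>x. tensor (u(i := deriv (u i))) x * P x \<partial>lebesgue)"
proof -
  let ?u' = "u(i := deriv (u i))"
  have u': "smooth1 (?u' j)" "\<bar>x\<bar> > B \<Longrightarrow> ?u' j x = 0" for j x
    using u(1) smooth1_deriv deriv_vanishes_abs[of B "u i" x 1] u(2) by auto
  define G where "G x = tensor u x * P x" for x
  have Ps: "smooth (partial i P)" using smooth_partials[OF P, of "[i]"] by simp
  have part: "partial i G x = tensor u x * partial i P x + tensor ?u' x * P x"
    and diff: "G differentiable (at x)" for x
  proof -
    have dt: "tensor u differentiable (at x)" by (intro smooth_differentiable smooth_tensor u)
    have D: "(G has_derivative (\<lambda>h. tensor u x * frechet_derivative P (at x) h + frechet_derivative (tensor u) (at x) h * P x)) (at x)"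
      unfolding G_def using smooth_differentiable[OF P] dt
      by (intro has_derivative_mult) (simp_all add: frechet_derivative_works[symmetric])
    then show "G differentiable (at x)" by (rule differentiableI)
    have "partial i G x = tensor u x * partial i P x + partial i (tensor u) x * P x"
      using frechet_derivative_at[OF D, symmetric] by (simp add: partial_def)
    then show "partial i G x = tensor u x * partial i P x + tensor ?u' x * P x" by (simp add: partial_tensor[where u = u, OF u(1)])
  qed
  have c: "continuous_on UNIV (tensor u)" "continuous_on UNIV (tensor ?u')" "continuous_on UNIV P" "continuous_on UNIV (partial i P)"
    using smooth_continuous[OF Ps] smooth_continuous[OF P] tensor_continuous[where u = u, OF u(1)] tensor_continuous[where u = ?u', OF u'(1)] by blast+
  let ?R = "real CARD('d) * B"
  have s: "tensor u x = 0" "tensor ?u' x = 0" if "x \<notin> cball 0 ?R" for x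
    using tensor_support[where u = u, OF u(2,3) that] tensor_support[where u = ?u', OF u'(2) u(3) that] by blast+
  have "(\<integral>x. partial i G x \<partial>lebesgue) = 0"
    by (rule integral_partial_eq_0[OF diff, where R = ?R])
       (auto simp: part[abs_def] G_def s intro!: continuous_intros c)
  moreover have "integrable lebesgue (\<lambda>x. tensor u x * partial i P x)" "integrable lebesgue (\<lambda>x. tensor ?u' x * P x)"
    using locally_integrable_times[OF continuous_locally_integrable[OF c(4)] c(1) s(1)]
      locally_integrable_times[OF continuous_locally_integrable[OF c(3)] c(2) s(2)] by (auto simp: mult.commute)
  ultimately show ?thesis unfolding part by simp
qed

text \<open>
  The derivatives are moved from \<open>P\<close> to the tensor product one by one. There they only accumulate as
  a count for each direction, which is why the enumeration of the directions does not show in the result.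
\<close>

lemma tensor_partials_parts:
  fixes u :: "'d::finite \<Rightarrow> real \<Rightarrow> real"
  assumes "\<And>i. smooth1 (u i)" "\<And>i x. \<bar>x\<bar> > B \<Longrightarrow> u i x = 0" "B \<ge> 0" and "smooth P"
  shows "(\<integral>x. tensor u x * partials is P x \<partial>lebesgue)
    = (-1) ^ length is * (\<integral>x. tensor (\<lambda>i. (deriv ^^ count_list is i) (u i)) x * P x \<partial>lebesgue)"
  using assms
proof (induction "is" arbitrary: u)
  case (Cons a "is")
  let ?u' = "u(a := deriv (u a))"
  have u': "smooth1 (?u' j)" "\<bar>x\<bar> > B \<Longrightarrow> ?u' j x = 0" for j x
    using Cons(2) smooth1_deriv deriv_vanishes_abs[of B "u a" x 1] Cons(3) by auto
  have "(\<integral>x. tensor u x * partials (a # is) P x \<partial>lebesgue) = - (\<integral>x. tensor ?u' x * partials is P x \<partial>lebesgue)"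
    using tensor_parts[where u = u, OF Cons(2,3,4) smooth_partials[OF Cons(5)], of a "is"] by simp
  also have "\<dots> = - ((-1) ^ length is * (\<integral>x. tensor (\<lambda>i. (deriv ^^ count_list is i) (?u' i)) x * P x \<partial>lebesgue))"
    by (subst Cons(1)[where u = ?u', OF u' Cons(4,5)]) simp_all
  also have "(\<lambda>i. (deriv ^^ count_list is i) (?u' i)) = (\<lambda>i. (deriv ^^ count_list (a # is) i) (u i))"
    by (auto simp: fun_eq_iff funpow_swap1)
  finally show ?case by simp
qed simp

lemma has_weak_deriv_tensor:
  fixes u :: "'d::finite \<Rightarrow> real \<Rightarrow> real"
  assumes u: "\<And>i. smooth1 (u i)" "\<And>i x. \<bar>x\<bar> > B \<Longrightarrow> u i x = 0" "B \<ge> 0"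
  shows "has_weak_deriv (\<lambda>x. c * tensor u x) k (\<lambda>x. c * tensor (\<lambda>i. (deriv ^^ (k $ i)) (u i)) x)"
  unfolding has_weak_deriv_def
proof (intro conjI ballI)
  show "locally_integrable (\<lambda>x. c * tensor u x)" "locally_integrable (\<lambda>x. c * tensor (\<lambda>i. (deriv ^^ (k $ i)) (u i)) x)"
    by (intro continuous_locally_integrable continuous_intros tensor_continuous smooth1_derivs u)+
  fix \<phi> :: "real ^ 'd \<Rightarrow> real" assume "\<phi> \<in> test_functions"
  then have \<phi>: "smooth \<phi>" by (simp add: test_functions_def)
  define is0 where "is0 = (SOME is. \<forall>i. count_list is i = k $ i)"
  have cnt: "\<forall>i. count_list is0 i = k $ i" unfolding is0_def by (rule someI_ex[OF exists_enumeration])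
  have len: "length is0 = (\<Sum>i\<in>UNIV. k $ i)" proof -
    have "sum (count_list is0) UNIV = length is0" by (rule sum_count_set) auto
    then show ?thesis using cnt by simp
  qed
  show "(\<integral>x. c * tensor u x * mixed_deriv k \<phi> x \<partial>lebesgue)
    = (- 1) ^ (\<Sum>i\<in>UNIV. k $ i) * (\<integral>x. c * tensor (\<lambda>i. (deriv ^^ (k $ i)) (u i)) x * \<phi> x \<partial>lebesgue)"
    using tensor_partials_parts[where u = u, OF u \<phi>, of is0] cnt
    unfolding mixed_deriv_def is0_def[symmetric] len[symmetric] by (simp add: mult.assoc)
qed

context freud begin

definition slow_box :: "real \<Rightarrow> ('d \<Rightarrow> real) \<Rightarrow> ('d \<Rightarrow> real) \<Rightarrow> bool" where
  "slow_box \<rho> c h \<longleftrightarrow> (\<forall>i. 0 \<le> c i \<and> 0 < h i \<and> h i \<le> 1 \<and> \<rho> * w1 (c i) \<le> w1 (c i + h i))"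

definition fools :: "nat \<Rightarrow> real \<Rightarrow> ('d::finite \<Rightarrow> real) \<Rightarrow> ('d \<Rightarrow> real) \<Rightarrow> bool" where
  "fools r \<delta> c h \<longleftrightarrow> (\<exists>f \<in> W1w_unit_ball r (weight :: real ^ 'd \<Rightarrow> real).
    (\<forall>x. f x \<noteq> 0 \<longrightarrow> (\<forall>i. c i < x $ i \<and> x $ i < c i + h i)) \<and> \<delta> * (\<Prod>i\<in>UNIV. h i ^ r) \<le> (\<integral>x. f x * weight x \<partial>lebesgue))"

text \<open>
  The function is a multiple of a tensor product of bumps scaled to the sides of the box. On a slow box the weight
  is constant up to a factor, so the Sobolev norm and the integral only differ by the powers of the sides
  produced by differentiation; since the sides are at most 1, the largest is \<open>\<Prod>i. h i ^ (- r)\<close>.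
\<close>

lemma fooling_function:
  assumes \<rho>: "\<rho> > 0"
  obtains \<delta> where "\<delta> > 0" "\<And>c h :: 'd::finite \<Rightarrow> real. slow_box \<rho> c h \<Longrightarrow> fools r \<delta> c h"
proof -
  define \<phi> where "\<phi> = bump 1 0 1"
  have \<phi>: "smooth1 \<phi>" "\<And>t. t \<notin> {0..1} \<Longrightarrow> \<phi> t = 0" "\<And>t. \<phi> t \<ge> 0"
    by (auto simp: \<phi>_def smooth1_bump bump_nonneg intro!: bump_eq_0)
  define I0 where "I0 = (\<integral>t. \<phi> t \<partial>lborel)"
  have I0: "I0 > 0" unfolding I0_def \<phi>_def by (rule bump_integral_pos) auto
  have "\<exists>M. \<forall>k. M k > 0 \<and> (\<forall>t. \<bar>(deriv ^^ k) \<phi> t\<bar> \<le> M k)"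
    by (rule choice_iff[THEN iffD1], rule allI) (use smooth1_bounded[OF \<phi>(1,2)] in metis)
  then obtain Mk where Mk: "\<And>k. Mk k > 0" "\<And>k t. \<bar>(deriv ^^ k) \<phi> t\<bar> \<le> Mk k" by blast
  define M where "M = (\<Sum>k\<le>r. Mk k)"
  have M: "\<bar>(deriv ^^ k) \<phi> t\<bar> \<le> M" if "k \<le> r" for k t
    using order_trans[OF Mk(2) member_le_sum[of k "{..r}" Mk]] that Mk(1) by (simp add: M_def less_imp_le)
  have M0: "M > 0" unfolding M_def using Mk(1) by (intro sum_pos) auto
  define N where "N = real (card (multi_indices r :: (nat ^ 'd) set))"
  have "(\<chi> i. 0) \<in> (multi_indices r :: (nat ^ 'd) set)" by (simp add: multi_indices_def)
  then have N: "N > 0" unfolding N_def using finite_multi_indices card_gt_0_iff by fastforce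
  define \<delta> where "\<delta> = (I0 * \<rho> / M) ^ CARD('d) / N"
  show ?thesis
  proof (rule that[of \<delta>])
    show "\<delta> > 0" unfolding \<delta>_def using I0 \<rho> M0 N by simp
    fix c h :: "'d \<Rightarrow> real"
    assume "slow_box \<rho> c h"
    then have c: "\<And>i. 0 \<le> c i" and h: "\<And>i. 0 < h i" "\<And>i. h i \<le> 1" and wr: "\<And>i. \<rho> * w1 (c i) \<le> w1 (c i + h i)"
      by (auto simp: slow_box_def)
    define u where "u i t = \<phi> ((t - c i) / h i)" for i t
    have ueq: "u i = (\<lambda>t. 1 * \<phi> ((1 / h i) * t + (- c i / h i)))" for i
      by (auto simp: u_def diff_divide_distrib)
    have us: "smooth1 (u i)" for i unfolding ueq by (rule smooth1_affine(1)[OF \<phi>(1)])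
    have ud: "(deriv ^^ k) (u i) t = (1 / h i) ^ k * (deriv ^^ k) \<phi> ((t - c i) / h i)" for k i t
      unfolding ueq smooth1_affine(2)[OF \<phi>(1)] by (simp add: diff_divide_distrib)
    have u0: "(deriv ^^ k) (u i) t = 0" if "t \<notin> {c i..c i + h i}" for k i t
    proof -
      have "(t - c i) / h i \<notin> {0..1}" using that h(1)[of i] by (auto simp: field_simps)
      then have "(deriv ^^ k) \<phi> ((t - c i) / h i) = 0" by (rule deriv_vanishes[rotated]) (rule \<phi>(2))
      then show ?thesis by (simp add: ud)
    qed
    have upos: "u i t \<ge> 0" for i t by (simp add: u_def \<phi>)
    have uin: "c i < t \<and> t < c i + h i" if "u i t \<noteq> 0" for i t
    proof -
      have "0 < (t - c i) / h i \<and> (t - c i) / h i < 1"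
        using that bump_eq_0[of 1 "(t - c i) / h i" 0 1] unfolding u_def \<phi>_def by linarith
      then show ?thesis using h(1)[of i] by (auto simp: field_simps)
    qed
    define B where "B = (\<Sum>i\<in>UNIV. c i + h i)"
    have Bi: "c i + h i \<le> B" for i
      unfolding B_def using c h by (intro member_le_sum) (auto intro: add_nonneg_nonneg less_imp_le)
    have B0: "B \<ge> 0" unfolding B_def using c h by (intro sum_nonneg) (auto intro: add_nonneg_nonneg less_imp_le)
    have supp: "(deriv ^^ k) (u i) t = 0" if "\<bar>t\<bar> > B" for k i t
      using that Bi[of i] c[of i] h(1)[of i] by (intro u0) auto
    have supp0: "u i t = 0" if "\<bar>t\<bar> > B" for i t using supp[OF that, of 0 i] by simp
    define V where "V i = w1 (c i) * h i / h i ^ r" for i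
    have V: "V i > 0" for i using w1_pos h(1) by (simp add: V_def)
    have int1: "integrable lborel (\<lambda>t. \<bar>(deriv ^^ k) (u i) t\<bar> * w1 t)" for k i
    proof -
      have "integrable lborel (\<lambda>t. indicator {-B..B} t *\<^sub>R (\<bar>(deriv ^^ k) (u i) t\<bar> * w1 t))"
        by (intro borel_integrable_compact continuous_on_mult continuous_on_rabs w1_continuous smooth1_continuous smooth1_derivs us) auto
      also have "(\<lambda>t. indicator {-B..B} t *\<^sub>R (\<bar>(deriv ^^ k) (u i) t\<bar> * w1 t)) = (\<lambda>t. \<bar>(deriv ^^ k) (u i) t\<bar> * w1 t)"
      proof
        fix t show "indicator {-B..B} t *\<^sub>R (\<bar>(deriv ^^ k) (u i) t\<bar> * w1 t) = \<bar>(deriv ^^ k) (u i) t\<bar> * w1 t"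
        proof (cases "\<bar>t\<bar> > B")
          case False
          then have "t \<in> {-B..B}" by auto
          then show ?thesis by simp
        qed (simp add: supp)
      qed
      finally show ?thesis .
    qed
    have norm1: "(\<integral>t. \<bar>(deriv ^^ k) (u i) t\<bar> * w1 t \<partial>lborel) \<le> M * V i" if "k \<le> r" for k i
    proof -
      have "(\<integral>t. \<bar>(deriv ^^ k) (u i) t\<bar> * w1 t \<partial>lborel) \<le> (\<integral>t. indicator {c i..c i + h i} t *\<^sub>R (M / h i ^ r * w1 (c i)) \<partial>lborel)"
      proof (rule integral_mono[OF int1])
        show "integrable lborel (\<lambda>t. indicator {c i..c i + h i} t *\<^sub>R (M / h i ^ r * w1 (c i)))"
          by (rule borel_integrable_compact) auto
        fix t
        show "\<bar>(deriv ^^ k) (u i) t\<bar> * w1 t \<le> indicator {c i..c i + h i} t *\<^sub>R (M / h i ^ r * w1 (c i))"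
        proof (cases "t \<in> {c i..c i + h i}")
          case True
          have "h i ^ r \<le> h i ^ k" using h[of i] that by (intro power_decreasing) (auto simp: less_imp_le)
          then have "(1 / h i) ^ k \<le> 1 / h i ^ r" using h(1)[of i] by (simp add: power_divide frac_le)
          then have "(1 / h i) ^ k * \<bar>(deriv ^^ k) \<phi> ((t - c i) / h i)\<bar> \<le> (1 / h i ^ r) * M"
            using h(1)[of i] M[OF that] by (intro mult_mono) (auto simp: less_imp_le)
          moreover have "\<bar>(deriv ^^ k) (u i) t\<bar> = (1 / h i) ^ k * \<bar>(deriv ^^ k) \<phi> ((t - c i) / h i)\<bar>"
            using h(1)[of i] unfolding ud by (simp add: abs_mult)
          ultimately have "\<bar>(deriv ^^ k) (u i) t\<bar> \<le> 1 / h i ^ r * M" by simp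
          moreover have "w1 t \<le> w1 (c i)" using True c[of i] by (intro w1_decreasing) auto
          ultimately have "\<bar>(deriv ^^ k) (u i) t\<bar> * w1 t \<le> (1 / h i ^ r * M) * w1 (c i)"
            using w1_pos[of t] h(1)[of i] M0 by (intro mult_mono) (auto simp: less_imp_le)
          then show ?thesis using True by simp
        next
          case False
          then show ?thesis using u0[OF False] by simp
        qed
      qed
      also have "\<dots> = M * V i" using h(1)[of i] by (simp add: V_def)
      finally show ?thesis .
    qed
    \<comment> \<open>the normalisation: each of the \<open>N\<close> derivatives has norm at most \<open>1 / N\<close>\<close>
    define A where "A = 1 / (N * M ^ CARD('d) * (\<Prod>i\<in>UNIV. V i))"
    have PV: "(\<Prod>i\<in>UNIV. V i) > 0" by (intro prod_pos V)
    have A: "A > 0" unfolding A_def using N M0 PV by simp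
    define f where "f x = A * tensor u x" for x
    define g where "g k x = A * tensor (\<lambda>i. (deriv ^^ (k $ i)) (u i)) x" for k :: "nat ^ 'd" and x
    have g0: "g 0 = f" by (simp add: g_def[abs_def] f_def[abs_def])
    have wdg: "has_weak_deriv f k (g k)" for k
      using has_weak_deriv_tensor[where u = u and c = A and k = k, OF us supp0 B0] unfolding f_def[abs_def] g_def[abs_def] .
    have gc: "continuous_on UNIV (g k)" for k unfolding g_def
      by (intro continuous_intros tensor_continuous smooth1_derivs us)
    have gm: "g k \<in> borel_measurable lebesgue" for k by (rule continuous_imp_lebesgue_measurable[OF gc])
    have absg: "\<bar>g k x * weight x\<bar> = A * tensor (\<lambda>i t. \<bar>(deriv ^^ (k $ i)) (u i) t\<bar> * w1 t) x" for k x
      using A weight_pos[of x] by (simp add: g_def abs_mult weight_def tensor_def abs_prod prod.distrib abs_of_pos[OF w1_pos])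
    have hb: "has_bochner_integral lborel (tensor (\<lambda>i t. \<bar>(deriv ^^ (k $ i)) (u i) t\<bar> * w1 t))
        (\<Prod>i\<in>UNIV. \<integral>t. \<bar>(deriv ^^ (k $ i)) (u i) t\<bar> * w1 t \<partial>lborel)" for k
      by (rule tensor_integral) (auto intro!: int1 mult_nonneg_nonneg less_imp_le[OF w1_pos])
    have hbl: "integrable lebesgue (\<lambda>x. \<bar>g k x * weight x\<bar>)"
      "(\<integral>x. \<bar>g k x * weight x\<bar> \<partial>lebesgue) = A * (\<Prod>i\<in>UNIV. \<integral>t. \<bar>(deriv ^^ (k $ i)) (u i) t\<bar> * w1 t \<partial>lborel)" for k
    proof -
      have m: "tensor (\<lambda>i t. \<bar>(deriv ^^ (k $ i)) (u i) t\<bar> * w1 t) \<in> borel_measurable lborel"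
        using hb[of k] by (rule borel_measurable_has_bochner_integral)
      show "integrable lebesgue (\<lambda>x. \<bar>g k x * weight x\<bar>)"
        unfolding absg using integrable_completion[OF m] hb[of k] by (simp add: has_bochner_integral_iff)
      show "(\<integral>x. \<bar>g k x * weight x\<bar> \<partial>lebesgue) = A * (\<Prod>i\<in>UNIV. \<integral>t. \<bar>(deriv ^^ (k $ i)) (u i) t\<bar> * w1 t \<partial>lborel)"
        unfolding absg using integral_completion[OF m] hb[of k] by (simp add: has_bochner_integral_iff)
    qed
    have gL: "g k \<in> L1w weight" for k using gm hbl(1) by (simp add: L1w_def)
    have norm: "L1w_norm weight (weak_deriv k f) \<le> 1 / N" if "k \<in> multi_indices r" for k
    proof -
      have wdf: "has_weak_deriv f k (weak_deriv k f)" unfolding weak_deriv_def by (rule someI[of "has_weak_deriv f k", OF wdg])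
      have m: "weak_deriv k f \<in> borel_measurable lebesgue"
        using wdf by (intro locally_integrable_measurable) (simp add: has_weak_deriv_def)
      have "L1w_norm weight (weak_deriv k f) = (\<integral>x. \<bar>g k x * weight x\<bar> \<partial>lebesgue)"
        unfolding L1w_norm_def
      proof (rule Bochner_Integration.integral_cong_AE)
        show "AE x in lebesgue. \<bar>weak_deriv k f x * weight x\<bar> = \<bar>g k x * weight x\<bar>"
          using weak_deriv_unique[OF wdf wdg] by eventually_elim simp
      qed (intro borel_measurable_abs borel_measurable_times m gm weight_measurable)+
      also have "\<dots> \<le> A * (\<Prod>i\<in>UNIV. M * V i)"
        unfolding hbl(2) using A that w1_pos
        by (intro mult_left_mono prod_mono conjI norm1) (auto simp: multi_indices_def less_imp_le)
      also have "\<dots> = 1 / N" using N M0 PV by (simp add: A_def prod.distrib less_imp_neq[OF V, symmetric])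
      finally show ?thesis .
    qed
    have "W1w_norm r weight f \<le> (\<Sum>k\<in>(multi_indices r :: (nat ^ 'd) set). 1 / N)"
      unfolding W1w_norm_def by (intro sum_mono norm)
    also have "\<dots> = 1" using N by (simp add: N_def)
    finally have "W1w_norm r weight f \<le> 1" .
    moreover have "f \<in> W1w r weight" unfolding W1w_def using gL[of 0] wdg gL by (auto simp: g0)
    ultimately have fin: "f \<in> W1w_unit_ball r weight" using gc[of 0] by (simp add: W1w_unit_ball_def g0)
    have zero: "\<forall>i. c i < x $ i \<and> x $ i < c i + h i" if "f x \<noteq> 0" for x
      using that uin by (auto simp: f_def tensor_def)
    have ui: "(\<integral>t. u i t * w1 t \<partial>lborel) \<ge> I0 * h i * (\<rho> * w1 (c i))" for i
    proof -
      have i1: "integrable lborel \<phi>" unfolding \<phi>_def by (rule bump_integrable) simp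
      have sc: "integrable lborel (u i)" "(\<integral>t. u i t \<partial>lborel) = h i * I0"
        using lborel_integrable_real_affine[OF i1, of "1 / h i" "- c i / h i"] lborel_integral_real_affine[of "1 / h i" \<phi> "- c i / h i"] h(1)[of i]
        by (simp_all add: ueq I0_def add.commute)
      have "I0 * h i * (\<rho> * w1 (c i)) \<le> I0 * h i * w1 (c i + h i)"
        using I0 h(1)[of i] wr by (intro mult_left_mono) (auto simp: less_imp_le)
      also have "\<dots> = (\<integral>t. u i t * w1 (c i + h i) \<partial>lborel)" by (simp add: sc mult_ac)
      also have "\<dots> \<le> (\<integral>t. u i t * w1 t \<partial>lborel)"
      proof (rule integral_mono)
        show "integrable lborel (\<lambda>t. u i t * w1 (c i + h i))" using sc by simp
        show "integrable lborel (\<lambda>t. u i t * w1 t)" using int1[of 0 i] upos by simp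
        fix t show "u i t * w1 (c i + h i) \<le> u i t * w1 t"
        proof (cases "u i t = 0")
          case False
          then show ?thesis using uin[OF False] c[of i] by (intro mult_left_mono w1_decreasing upos) auto
        qed simp
      qed
      finally show ?thesis .
    qed
    have "\<delta> * (\<Prod>i\<in>UNIV. h i ^ r) = A * (\<Prod>i\<in>UNIV. I0 * h i * (\<rho> * w1 (c i)))"
    proof -
      have "(\<Prod>i\<in>UNIV. I0 * h i * (\<rho> * w1 (c i))) = (\<Prod>i\<in>UNIV. (I0 * \<rho>) * (V i * h i ^ r))"
        using h(1) by (intro prod.cong refl) (simp add: V_def less_imp_neq[symmetric])
      also have "\<dots> = (I0 * \<rho>) ^ CARD('d) * ((\<Prod>i\<in>UNIV. V i) * (\<Prod>i\<in>UNIV. h i ^ r))"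
        by (simp only: prod.distrib prod_constant power_mult_distrib)
      finally show ?thesis using PV N M0 by (simp add: A_def \<delta>_def power_divide less_imp_neq[OF V, symmetric])
    qed
    also have "\<dots> \<le> A * (\<Prod>i\<in>UNIV. \<integral>t. u i t * w1 t \<partial>lborel)"
      using A I0 \<rho> h(1) w1_pos ui by (intro mult_left_mono prod_mono conjI) (auto simp: less_imp_le)
    also have "\<dots> = (\<integral>x. f x * weight x \<partial>lebesgue)"
    proof -
      have "(\<lambda>x. f x * weight x) = (\<lambda>x. \<bar>g 0 x * weight x\<bar>)"
        using A upos by (simp add: g0 f_def tensor_def abs_mult abs_prod abs_of_pos[OF weight_pos])
      then show ?thesis using hbl(2)[of 0] upos by simp
    qed
    finally have "\<delta> * (\<Prod>i\<in>UNIV. h i ^ r) \<le> (\<integral>x. f x * weight x \<partial>lebesgue)" .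
    then show "fools r \<delta> c h" using fin zero unfolding fools_def by blast
  qed
qed

end

section \<open>Counting multi-indices of given length\<close>

lemma finite_sum_eq: "finite {k :: 'd::finite \<Rightarrow> nat. sum k UNIV = s}"
proof (rule finite_subset)
  show "{k :: 'd \<Rightarrow> nat. sum k UNIV = s} \<subseteq> PiE UNIV (\<lambda>_. {..s})"
    by (auto intro: member_le_sum)
qed (auto intro: finite_PiE)

text \<open>
  All coordinates but one determine the remaining one.
\<close>

lemma card_sum_eq_le: "card {k :: 'd::finite \<Rightarrow> nat. sum k UNIV = s} \<le> (s + 1) ^ (CARD('d) - 1)"
proof -
  define i0 :: 'd where "i0 = undefined"
  let ?S = "UNIV - {i0}"
  have "card {k :: 'd \<Rightarrow> nat. sum k UNIV = s} \<le> card (PiE ?S (\<lambda>_. {..s}))"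
  proof (rule card_inj_on_le[of "\<lambda>k. restrict k ?S"])
    show "inj_on (\<lambda>k. restrict k ?S) {k :: 'd \<Rightarrow> nat. sum k UNIV = s}"
    proof (rule inj_onI)
      fix k l :: "'d \<Rightarrow> nat"
      assume k: "k \<in> {k. sum k UNIV = s}" "l \<in> {k. sum k UNIV = s}" and eq: "restrict k ?S = restrict l ?S"
      have e: "k i = l i" if "i \<noteq> i0" for i using fun_cong[OF eq, of i] that by simp
      have "sum k ?S = sum l ?S" using e by (intro sum.cong) auto
      moreover have "sum k UNIV = k i0 + sum k ?S" "sum l UNIV = l i0 + sum l ?S"
        by (rule sum.remove; simp)+
      ultimately have "k i0 = l i0" using k by simp
      then show "k = l" using e by (metis ext)
    qed
    have le: "k i \<le> sum k UNIV" for k :: "'d \<Rightarrow> nat" and i by (rule member_le_sum) auto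
    show "(\<lambda>k. restrict k ?S) ` {k :: 'd \<Rightarrow> nat. sum k UNIV = s} \<subseteq> PiE ?S (\<lambda>_. {..s})"
    proof (rule image_subsetI)
      fix k :: "'d \<Rightarrow> nat" assume "k \<in> {k. sum k UNIV = s}"
      then show "restrict k ?S \<in> PiE ?S (\<lambda>_. {..s})" using le[of k] by (auto simp: restrict_PiE_iff)
    qed
  qed (intro finite_PiE, auto)
  also have "\<dots> = (s + 1) ^ (CARD('d) - 1)" by (subst card_PiE) (auto simp: card_Diff_singleton)
  finally show ?thesis .
qed

text \<open>
  All coordinates but one can be chosen freely in \<open>{0..M div d}\<close>; the remaining one completes the sum.
\<close>

lemma card_sum_eq_ge: "(M div CARD('d) + 1) ^ (CARD('d) - 1) \<le> card {k :: 'd::finite \<Rightarrow> nat. sum k UNIV = M}"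
proof -
  define i0 :: 'd where "i0 = undefined"
  let ?S = "UNIV - {i0}"
  define q where "q = M div CARD('d)"
  define F where "F g i = (if i = i0 then M - sum g ?S else g i)" for g :: "'d \<Rightarrow> nat" and i
  have "(q + 1) ^ (CARD('d) - 1) = card (PiE ?S (\<lambda>_. {..q}))" by (subst card_PiE) (auto simp: card_Diff_singleton)
  also have "\<dots> \<le> card {k :: 'd \<Rightarrow> nat. sum k UNIV = M}"
  proof (rule card_inj_on_le[of F])
    show "inj_on F (PiE ?S (\<lambda>_. {..q}))"
    proof (rule inj_onI)
      fix g g' assume g: "g \<in> PiE ?S (\<lambda>_. {..q})" "g' \<in> PiE ?S (\<lambda>_. {..q})" and eq: "F g = F g'"
      show "g = g'"
      proof (rule PiE_ext[OF g])
        fix i assume "i \<in> ?S"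
        then show "g i = g' i" using fun_cong[OF eq, of i] by (simp add: F_def)
      qed
    qed
    show "F ` PiE ?S (\<lambda>_. {..q}) \<subseteq> {k. sum k UNIV = M}"
    proof safe
      fix g assume g: "g \<in> PiE ?S (\<lambda>_. {..q})"
      have "sum g ?S \<le> (\<Sum>i\<in>?S. q)" using g by (intro sum_mono) auto
      also have "\<dots> \<le> CARD('d) * q" by (simp add: card_Diff_singleton)
      also have "\<dots> \<le> M" by (simp add: q_def)
      finally have "sum g ?S \<le> M" .
      moreover have "sum (F g) UNIV = F g i0 + sum (F g) ?S" by (rule sum.remove) auto
      moreover have "sum (F g) ?S = sum g ?S" by (intro sum.cong) (auto simp: F_def)
      ultimately show "sum (F g) UNIV = M" by (simp add: F_def)
    qed
  qed (rule finite_sum_eq)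
  finally show ?thesis by (simp add: q_def)
qed

text \<open>
  Sums over multi-indices in the sequel only depend on the length \<open>sum k UNIV\<close>. Grouping by length reduces them to
  sums over natural numbers with polynomial factors.
\<close>

lemma sum_over_lengths:
  fixes G :: "nat \<Rightarrow> real"
  assumes "finite K" "\<And>k. k \<in> K \<Longrightarrow> sum k UNIV \<in> S" "finite S" "\<And>s. s \<in> S \<Longrightarrow> G s \<ge> 0"
  shows "(\<Sum>k\<in>K. G (sum k (UNIV :: 'd::finite set))) \<le> (\<Sum>s\<in>S. real ((s + 1) ^ (CARD('d) - 1)) * G s)"
proof -
  have "(\<Sum>k\<in>K. G (sum k UNIV)) = (\<Sum>s\<in>S. \<Sum>k\<in>{k \<in> K. sum k UNIV = s}. G (sum k UNIV))"
    by (rule sum.group[symmetric]) (use assms in auto)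
  also have "\<dots> = (\<Sum>s\<in>S. real (card {k \<in> K. sum k UNIV = s}) * G s)"
    by (intro sum.cong refl) simp
  also have "\<dots> \<le> (\<Sum>s\<in>S. real ((s + 1) ^ (CARD('d) - 1)) * G s)"
  proof (intro sum_mono mult_right_mono)
    fix s
    have "card {k \<in> K. sum k UNIV = s} \<le> card {k :: 'd \<Rightarrow> nat. sum k UNIV = s}"
      by (intro card_mono finite_sum_eq) auto
    then show "real (card {k \<in> K. sum k UNIV = s}) \<le> real ((s + 1) ^ (CARD('d) - 1))"
      using card_sum_eq_le[where 'd = 'd, of s] by (simp only: of_nat_le_iff)
  qed (use assms in auto)
  finally show ?thesis .
qed

lemma poly_geometric_bound:
  assumes "(p::real) > 0"
  obtains C where "C > 0" "\<And>T. (\<Sum>t\<le>T. real ((t + 1) ^ D) * 2 powr (- p * real t)) \<le> C"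
proof -
  define c where "c = p * ln 2 / 2"
  have c: "c > 0" using assms by (simp add: c_def)
  obtain K where K: "K > 0" "\<And>u. u \<ge> 0 \<Longrightarrow> \<bar>poly ([:1, 1:] ^ D) u\<bar> \<le> K * exp (c * u)"
    using poly_le_exp[OF c] by blast
  define y where "y = exp (- c)"
  have y: "0 < y" "y < 1" using c by (auto simp: y_def)
  show ?thesis
  proof (rule that[of "K / (1 - y)"])
    show "K / (1 - y) > 0" using K y by simp
    fix T
    have "(\<Sum>t\<le>T. real ((t + 1) ^ D) * 2 powr (- p * real t)) \<le> (\<Sum>t\<le>T. K * y ^ t)"
    proof (rule sum_mono)
      fix t :: nat
      have "real ((t + 1) ^ D) \<le> K * exp (c * real t)"
        using K(2)[of "real t"] by (simp add: poly_power add.commute)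
      then have "real ((t + 1) ^ D) * 2 powr (- p * real t) \<le> K * exp (c * real t) * 2 powr (- p * real t)"
        by (intro mult_right_mono) auto
      also have "\<dots> = K * y ^ t"
      proof -
        have "2 powr (- p * real t) = exp (- (2 * c) * real t)" by (simp add: powr_def c_def)
        then have "K * exp (c * real t) * 2 powr (- p * real t) = K * exp (- c * real t)"
          by (simp add: mult.assoc flip: exp_add)
        also have "exp (- c * real t) = y ^ t" by (simp add: y_def mult.commute flip: exp_of_nat_mult)
        finally show ?thesis .
      qed
      finally show "real ((t + 1) ^ D) * 2 powr (- p * real t) \<le> K * y ^ t" .
    qed
    also have "\<dots> = K * ((1 - y ^ Suc T) / (1 - y))"
      using y by (simp add: sum_gp0 flip: sum_distrib_left)
    also have "\<dots> \<le> K * (1 / (1 - y))"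
      using K y by (intro mult_left_mono divide_right_mono) auto
    finally show "(\<Sum>t\<le>T. real ((t + 1) ^ D) * 2 powr (- p * real t)) \<le> K / (1 - y)" by simp
  qed
qed

text \<open>
  The bound \<open>t + m + 1 \<le> (m + 1) * (t + 1)\<close> separates \<open>m\<close> from the distance \<open>t\<close> to the critical length \<open>m\<close>. What remains
  is a geometric series with a polynomial factor in \<open>t\<close>.
\<close>

lemma smolyak_error_sum:
  assumes "(p::real) > 0" "C > 0"
  obtains C' where "C' > 0"
    "\<And>m. (\<Sum>k | (\<forall>i. k i \<le> m + 1) \<and> m < sum k UNIV. \<Prod>i\<in>(UNIV :: 'd::finite set). C * 2 powr (- p * real (k i)))
      \<le> C' * real (m + 1) ^ (CARD('d) - 1) * 2 powr (- p * real m)"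
proof -
  define D where "D = CARD('d) - 1"
  obtain G where G: "G > 0" "\<And>T. (\<Sum>t\<le>T. real ((t + 1) ^ D) * 2 powr (- p * real t)) \<le> G"
    using poly_geometric_bound[OF assms(1)] by blast
  show ?thesis
  proof (rule that[of "C ^ CARD('d) * G"])
    show "C ^ CARD('d) * G > 0" using assms G by simp
    fix m :: nat
    define K where "K = {k :: 'd \<Rightarrow> nat. (\<forall>i. k i \<le> m + 1) \<and> m < sum k UNIV}"
    define T where "T = CARD('d) * (m + 1)"
    define H where "H s = C ^ CARD('d) * 2 powr (- p * real s)" for s :: nat
    have fK: "finite K"
      by (rule finite_subset[of _ "PiE UNIV (\<lambda>_. {..m + 1})"]) (auto simp: K_def intro: finite_PiE)
    have "(\<Sum>k\<in>K. \<Prod>i\<in>UNIV. C * 2 powr (- p * real (k i))) = (\<Sum>k\<in>K. H (sum k UNIV))"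
      by (intro sum.cong refl) (simp add: H_def prod.distrib sum_distrib_left flip: powr_sum)
    also have "\<dots> \<le> (\<Sum>s\<in>{m<..m + T}. real ((s + 1) ^ D) * H s)"
      unfolding D_def
    proof (rule sum_over_lengths[OF fK])
      fix k assume k: "k \<in> K"
      have "sum k UNIV \<le> (\<Sum>i\<in>(UNIV :: 'd set). m + 1)" using k by (intro sum_mono) (auto simp: K_def)
      then have "sum k UNIV \<le> T" by (simp add: T_def)
      then show "sum k UNIV \<in> {m<..m + T}" using k by (auto simp: K_def)
    qed (use assms in \<open>auto simp: H_def\<close>)
    also have "\<dots> \<le> (\<Sum>s\<in>{m..m + T}. real ((s + 1) ^ D) * H s)"
      using assms by (intro sum_mono2) (auto simp: H_def)
    also have "\<dots> = (\<Sum>t\<le>T. real ((t + m + 1) ^ D) * H (t + m))"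
      using sum.shift_bounds_cl_nat_ivl[of "\<lambda>s. real ((s + 1) ^ D) * H s" 0 m T] by (simp add: atMost_atLeast0 add.commute)
    also have "\<dots> \<le> (\<Sum>t\<le>T. (C ^ CARD('d) * real (m + 1) ^ D * 2 powr (- p * real m)) * (real ((t + 1) ^ D) * 2 powr (- p * real t)))"
    proof (rule sum_mono)
      fix t :: nat
      have "t + m + 1 \<le> (m + 1) * (t + 1)" by simp
      then have "(t + m + 1) ^ D \<le> ((m + 1) * (t + 1)) ^ D" by (rule power_mono) simp
      then have "real ((t + m + 1) ^ D) \<le> real (((m + 1) * (t + 1)) ^ D)" by (simp only: of_nat_le_iff)
      then have "real ((t + m + 1) ^ D) \<le> real (m + 1) ^ D * real ((t + 1) ^ D)"
        by (simp only: power_mult_distrib of_nat_mult of_nat_power)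
      then have "real ((t + m + 1) ^ D) * H (t + m) \<le> (real (m + 1) ^ D * real ((t + 1) ^ D)) * H (t + m)"
        using assms by (intro mult_right_mono) (auto simp: H_def)
      also have "\<dots> = (C ^ CARD('d) * real (m + 1) ^ D * 2 powr (- p * real m)) * (real ((t + 1) ^ D) * 2 powr (- p * real t))"
      proof -
        have "H (t + m) = C ^ CARD('d) * (2 powr (- p * real m) * 2 powr (- p * real t))"
          by (simp add: H_def algebra_simps flip: powr_add)
        then show ?thesis by (simp only: mult_ac)
      qed
      finally show "real ((t + m + 1) ^ D) * H (t + m) \<le> (C ^ CARD('d) * real (m + 1) ^ D * 2 powr (- p * real m)) * (real ((t + 1) ^ D) * 2 powr (- p * real t))" .
    qed
    also have "\<dots> = (C ^ CARD('d) * real (m + 1) ^ D * 2 powr (- p * real m)) * (\<Sum>t\<le>T. real ((t + 1) ^ D) * 2 powr (- p * real t))"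
      by (simp only: sum_distrib_left)
    also have "\<dots> \<le> (C ^ CARD('d) * real (m + 1) ^ D * 2 powr (- p * real m)) * G"
      using assms by (intro mult_left_mono G) auto
    finally show "(\<Sum>k | (\<forall>i. k i \<le> m + 1) \<and> m < sum k UNIV. \<Prod>i\<in>(UNIV :: 'd::finite set). C * 2 powr (- p * real (k i)))
      \<le> C ^ CARD('d) * G * real (m + 1) ^ (CARD('d) - 1) * 2 powr (- p * real m)"
      by (simp add: K_def D_def mult_ac)
  qed
qed

lemma smolyak_node_sum:
  "(\<Sum>k | (\<forall>i. k i \<le> m + 1) \<and> sum k UNIV \<le> m. \<Prod>i\<in>(UNIV :: 'd::finite set). c * 2 ^ k i)
    \<le> c ^ CARD('d) * (m + 1) ^ (CARD('d) - 1) * 2 ^ (m + 1)" for c :: nat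
proof -
  define D where "D = CARD('d) - 1"
  define K where "K = {k :: 'd \<Rightarrow> nat. (\<forall>i. k i \<le> m + 1) \<and> sum k UNIV \<le> m}"
  have fK: "finite K"
    by (rule finite_subset[of _ "PiE UNIV (\<lambda>_. {..m + 1})"]) (auto simp: K_def intro: finite_PiE)
  have "real (\<Sum>k\<in>K. \<Prod>i\<in>UNIV. c * 2 ^ k i) = (\<Sum>k\<in>K. real (c ^ CARD('d) * 2 ^ sum k UNIV))"
    by (simp add: prod.distrib power_sum)
  also have "\<dots> \<le> (\<Sum>s\<le>m. real ((s + 1) ^ D) * real (c ^ CARD('d) * 2 ^ s))"
    unfolding D_def by (rule sum_over_lengths[OF fK, where G = "\<lambda>s. real (c ^ CARD('d) * 2 ^ s)"]) (auto simp: K_def)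
  also have "\<dots> \<le> (\<Sum>s\<le>m. real ((m + 1) ^ D * c ^ CARD('d)) * 2 ^ s)"
  proof (rule sum_mono)
    fix s assume "s \<in> {..m}"
    then have "(s + 1) ^ D * (c ^ CARD('d) * 2 ^ s) \<le> (m + 1) ^ D * c ^ CARD('d) * 2 ^ s"
      unfolding mult.assoc by (intro mult_right_mono power_mono) auto
    then have "real ((s + 1) ^ D * (c ^ CARD('d) * 2 ^ s)) \<le> real ((m + 1) ^ D * c ^ CARD('d) * 2 ^ s)" by (simp only: of_nat_le_iff)
    then show "real ((s + 1) ^ D) * real (c ^ CARD('d) * 2 ^ s) \<le> real ((m + 1) ^ D * c ^ CARD('d)) * 2 ^ s"
      by (simp only: of_nat_mult of_nat_power of_nat_numeral)
  qed
  also have "\<dots> = real ((m + 1) ^ D * c ^ CARD('d)) * (\<Sum>s\<le>m. 2 ^ s)" by (simp only: sum_distrib_left)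
  also have "(\<Sum>s\<le>m. 2 ^ s :: real) = 2 ^ (m + 1) - 1" by (induction m) auto
  also have "real ((m + 1) ^ D * c ^ CARD('d)) * (2 ^ (m + 1) - 1) \<le> real ((m + 1) ^ D * c ^ CARD('d)) * 2 ^ (m + 1)"
    by (intro mult_left_mono) auto
  also have "\<dots> = real (c ^ CARD('d) * (m + 1) ^ D * 2 ^ (m + 1))" by simp
  finally show ?thesis unfolding of_nat_le_iff K_def D_def .
qed

section \<open>Bounds for the optimal error\<close>

lemma Int_opt_le:
  assumes "Q \<in> quadratures n'" "n' \<le> n" "\<And>f. f \<in> F \<Longrightarrow> \<bar>(\<integral>x. f x * w x \<partial>lebesgue) - Q f\<bar> \<le> E"
  shows "Int_opt w F n \<le> ennreal E"
proof -
  have "Q \<in> quadratures n" using assms(1,2) unfolding quadratures_def by (auto intro: order_trans)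
  then show ?thesis unfolding Int_opt_def
    by (rule INF_lower2) (intro SUP_least ennreal_leI assms)
qed

context freud begin

text \<open>
  The zero quadrature has error at most 1 on the unit ball, since \<open>f\<close> is its own weak derivative of order 0. This settles the finitely
  many \<open>n\<close> that are too small for Smolyak's construction.
\<close>

lemma unit_ball_integral_le_1:
  fixes f :: "real ^ 'd \<Rightarrow> real"
  assumes "f \<in> W1w_unit_ball r weight"
  shows "\<bar>\<integral>x. f x * weight x \<partial>lebesgue\<bar> \<le> 1"
proof -
  have f: "f \<in> W1w r weight" "W1w_norm r weight f \<le> 1" "continuous_on UNIV f" using assms by (auto simp: W1w_unit_ball_def)
  have fL: "f \<in> borel_measurable lebesgue" "integrable lebesgue (\<lambda>x. \<bar>f x * weight x\<bar>)"
    using f(1) by (auto simp: W1w_def L1w_def)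
  have k0: "0 \<in> (multi_indices r :: (nat ^ 'd) set)" by (simp add: multi_indices_def)
  have "mixed_deriv 0 \<phi> = \<phi>" for \<phi> :: "real ^ 'd \<Rightarrow> real"
  proof -
    define l where "l = (SOME is. \<forall>i. count_list is i = (0 :: nat ^ 'd) $ i)"
    have "\<forall>i. count_list l i = (0 :: nat ^ 'd) $ i" unfolding l_def by (rule someI_ex[OF exists_enumeration])
    then have cnt: "count_list l i = 0" for i by simp
    have "l = []"
    proof (cases l)
      case (Cons x xs)
      then show ?thesis using cnt[of x] by simp
    qed
    then show ?thesis unfolding mixed_deriv_def l_def[symmetric] by simp
  qed
  then have wf: "has_weak_deriv f 0 f"
    using continuous_locally_integrable[OF f(3)] by (simp add: has_weak_deriv_def)
  have wd0: "has_weak_deriv f 0 (weak_deriv 0 f)" by (rule weak_deriv_in_L1w[OF f(1) k0 weight_measurable])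
  have m: "weak_deriv 0 f \<in> borel_measurable lebesgue"
    using wd0 by (intro locally_integrable_measurable) (simp add: has_weak_deriv_def)
  have "\<bar>\<integral>x. f x * weight x \<partial>lebesgue\<bar> \<le> (\<integral>x. \<bar>f x * weight x\<bar> \<partial>lebesgue)" by (rule integral_abs_bound)
  also have "\<dots> = L1w_norm weight (weak_deriv 0 f)"
    unfolding L1w_norm_def
  proof (rule Bochner_Integration.integral_cong_AE)
    show "AE x in lebesgue. \<bar>f x * weight x\<bar> = \<bar>weak_deriv 0 f x * weight x\<bar>"
      using weak_deriv_unique[OF wf wd0] by eventually_elim simp
  qed (intro borel_measurable_abs borel_measurable_times m fL weight_measurable)+
  also have "\<dots> \<le> W1w_norm r weight f"
    unfolding W1w_norm_def by (rule member_le_sum[OF k0 _ finite_multi_indices]) (simp add: L1w_norm_def)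
  finally show ?thesis using f(2) by simp
qed

text \<open>
  The level \<open>m\<close> is the largest whose number \<open>N m\<close> of nodes does not exceed \<open>n\<close>. Then \<open>n < N (m + 1)\<close> bounds \<open>2 powr (- m)\<close> by a
  multiple of \<open>(m + 2) ^ (d - 1) / n\<close>, and \<open>2 ^ (m + 1) \<le> n\<close> bounds \<open>m + 2\<close> by a multiple of \<open>ln n\<close>.
\<close>

lemma upper_bound:
  assumes r: "r \<ge> 1" and p: "p = (1 - 1 / lam) * real r"
  shows "\<exists>C::real. C > 0 \<and> (\<forall>n::nat. n \<ge> 2 \<longrightarrow>
        Int_opt (weight :: real ^ 'd \<Rightarrow> real) (W1w_unit_ball r weight) n
          \<le> ennreal C * ennreal (real n powr (- p) * ln (real n) powr ((p + 1) * (real CARD('d) - 1))))"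
proof -
  define D where "D = CARD('d) - 1"
  have D: "real CARD('d) - 1 = real D" by (simp add: D_def of_nat_diff)
  have p0: "p > 0" using r lam by (simp add: p)
  have pp: "- (1 - 1 / lam) * real r = - p" by (simp only: p mult_minus_left)
  obtain C where C: "C > 0" and quad: "\<And>m. \<exists>Q \<in> quadratures (\<Sum>k | (\<forall>i. k i \<le> m + 1) \<and> sum k UNIV \<le> m. \<Prod>i\<in>(UNIV :: 'd set). 8 * r * 2 ^ k i).
       \<forall>f \<in> W1w_unit_ball r (weight :: real ^ 'd \<Rightarrow> real).
         \<bar>(\<integral>x. f x * weight x \<partial>lebesgue) - Q f\<bar> \<le>
           (\<Sum>k | (\<forall>i. k i \<le> m + 1) \<and> m < sum k UNIV. \<Prod>i\<in>(UNIV :: 'd set). C * 2 powr (- p * real (k i)))"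
    by (rule smolyak_quadrature[OF r, where 'd = 'd]) (unfold rate_def pp, blast)
  obtain C1 where C1: "C1 > 0"
    "\<And>m. (\<Sum>k | (\<forall>i. k i \<le> m + 1) \<and> m < sum k UNIV. \<Prod>i\<in>(UNIV :: 'd set). C * 2 powr (- p * real (k i)))
      \<le> C1 * real (m + 1) ^ D * 2 powr (- p * real m)"
    unfolding D_def using smolyak_error_sum[OF p0 C, where 'd = 'd] by blast
  define N where "N m = (8 * r) ^ CARD('d) * (m + 1) ^ D * 2 ^ (m + 1)" for m
  have Int_m: "Int_opt (weight :: real ^ 'd \<Rightarrow> real) (W1w_unit_ball r weight) n \<le> ennreal (C1 * real (m + 1) ^ D * 2 powr (- p * real m))"
    if n: "N m \<le> n" for m n
  proof -
    obtain Q where Q: "Q \<in> quadratures (\<Sum>k | (\<forall>i. k i \<le> m + 1) \<and> sum k UNIV \<le> m. \<Prod>i\<in>(UNIV :: 'd set). 8 * r * 2 ^ k i)"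
       "\<And>f. f \<in> W1w_unit_ball r (weight :: real ^ 'd \<Rightarrow> real) \<Longrightarrow>
         \<bar>(\<integral>x. f x * weight x \<partial>lebesgue) - Q f\<bar> \<le>
           (\<Sum>k | (\<forall>i. k i \<le> m + 1) \<and> m < sum k UNIV. \<Prod>i\<in>(UNIV :: 'd set). C * 2 powr (- p * real (k i)))"
      using quad[of m] by blast
    have "(\<Sum>k | (\<forall>i. k i \<le> m + 1) \<and> sum k UNIV \<le> m. \<Prod>i\<in>(UNIV :: 'd set). 8 * r * 2 ^ k i) \<le> n"
      using smolyak_node_sum[where 'd = 'd and m = m and c = "8 * r"] n unfolding N_def D_def by (rule order_trans)
    then show ?thesis by (rule Int_opt_le[OF Q(1)]) (rule order_trans[OF Q(2) C1(2)])
  qed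
  have N2: "2 ^ (m + 1) \<le> N m" for m
  proof -
    have "1 \<le> (8 * r) ^ CARD('d) * (m + 1) ^ D" using r by simp
    from mult_right_mono[OF this, of "2 ^ (m + 1)"] show ?thesis by (simp add: N_def)
  qed
  have Int_1: "Int_opt (weight :: real ^ 'd \<Rightarrow> real) (W1w_unit_ball r weight) n \<le> ennreal 1" for n
  proof (rule Int_opt_le[of "\<lambda>_. 0" 0])
    show "(\<lambda>_. 0) \<in> (quadratures 0 :: ((real ^ 'd \<Rightarrow> real) \<Rightarrow> real) set)"
      unfolding quadratures_def by auto
  qed (use unit_ball_integral_le_1 in auto)
  define X where "X n = real n powr (- p) * ln (real n) powr ((p + 1) * real D)" for n :: nat
  define A where "A = real ((8 * r) ^ CARD('d))"
  have "1 \<le> (8 * r) ^ CARD('d)" using r by (intro one_le_power) simp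
  then have A: "A \<ge> 1" unfolding A_def by linarith
  \<comment> \<open>\<open>C2\<close> serves \<open>n \<ge> N 0\<close> and \<open>C3\<close>, below, the finitely many smaller \<open>n\<close>\<close>
  define C2 where "C2 = C1 * (4 * A) powr p * (2 / ln 2) powr ((p + 1) * real D)"
  have C2: "C2 > 0" unfolding C2_def using C1 A by (intro mult_pos_pos) auto
  define C3 where "C3 = real (N 0) powr p * (ln 2) powr (- ((p + 1) * real D))"
  have N0: "N 0 \<ge> 2" using N2[of 0] by simp
  have C3: "C3 > 0" unfolding C3_def using N0 by simp
  have large: "C1 * real (m + 1) ^ D * 2 powr (- p * real m) \<le> C2 * X n" if m: "N m \<le> n" "n < N (m + 1)" for m n
  proof -
    have n2: "2 ^ (m + 1) \<le> n" using N2[of m] m by simp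
    then have "real (2 ^ (m + 1)) \<le> real n" by (simp only: of_nat_le_iff)
    then have n: "real n \<ge> 2 powr real (m + 1)" using powr_realpow[of "2::real" "m + 1"] by simp
    have "(1::real) < 2 powr real (m + 1)" by simp
    then have n1: "real n > 1" using n by linarith
    have lnn: "real (m + 1) * ln 2 \<le> ln (real n)"
    proof -
      have "ln (2 powr real (m + 1)) \<le> ln (real n)" using n n1 by (subst ln_le_cancel_iff) auto
      then show ?thesis by (simp add: ln_powr)
    qed
    define L where "L = 2 / ln 2 * ln (real n)"
    have L: "real (m + 2) \<le> L"
    proof -
      have "real (m + 2) \<le> 2 * real (m + 1)" by simp
      also have "\<dots> = 2 / ln 2 * (real (m + 1) * ln 2)" by simp
      also have "\<dots> \<le> L" unfolding L_def using lnn by (intro mult_left_mono) auto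
      finally show ?thesis .
    qed
    have L0: "L > 0" using L by simp
    have "real n \<le> real (N (m + 1))" using m by simp
    also have "real (N (m + 1)) = A * real (m + 2) ^ D * (4 * 2 powr real m)"
      by (simp add: N_def A_def powr_realpow)
    also have "\<dots> \<le> A * L powr real D * (4 * 2 powr real m)"
    proof -
      have "real (m + 2) ^ D \<le> L ^ D" using L by (intro power_mono) auto
      then show ?thesis using A L0 by (intro mult_right_mono mult_left_mono) (auto simp: powr_realpow)
    qed
    finally have "real n * 2 powr (- real m) \<le> A * L powr real D * (4 * 2 powr real m) * 2 powr (- real m)"
      by (intro mult_right_mono) auto
    then have "2 powr (- real m) \<le> (4 * A) * L powr real D * real n powr (- 1)"
      using n1 by (simp add: powr_minus field_simps)
    then have "(2 powr (- real m)) powr p \<le> ((4 * A) * L powr real D * real n powr (- 1)) powr p"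
      using p0 by (intro powr_mono2) auto
    then have e: "2 powr (- p * real m) \<le> (4 * A) powr p * L powr (p * real D) * real n powr (- p)"
    proof -
      have gen: "(x * y * z) powr p = x powr p * y powr p * z powr p" if "x \<ge> 0" "y \<ge> 0" "z \<ge> 0" for x y z :: real
        using that by (simp add: powr_mult)
      have "((4 * A) * L powr real D * real n powr (- 1)) powr p = (4 * A) powr p * (L powr real D) powr p * (real n powr (- 1)) powr p"
        using A by (intro gen) auto
      then show ?thesis using \<open>(2 powr (- real m)) powr p \<le> _\<close> unfolding powr_powr by (simp add: mult.commute)
    qed
    have "real (m + 1) ^ D \<le> L powr real D"
      using L L0 by (simp add: powr_realpow) (intro power_mono, auto)
    then have "C1 * real (m + 1) ^ D * 2 powr (- p * real m) \<le> C1 * L powr real D * ((4 * A) powr p * L powr (p * real D) * real n powr (- p))"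
      using C1 e by (intro mult_mono) auto
    also have "\<dots> = C1 * (4 * A) powr p * (L powr real D * L powr (p * real D)) * real n powr (- p)" by simp
    also have "L powr real D * L powr (p * real D) = (2 / ln 2) powr ((p + 1) * real D) * ln (real n) powr ((p + 1) * real D)"
      using n1 unfolding L_def by (simp add: algebra_simps flip: powr_add powr_mult)
    finally show ?thesis by (simp add: C2_def X_def mult_ac)
  qed
  have small: "1 \<le> C3 * X n" if n: "2 \<le> n" "n < N 0" for n
  proof -
    have "real (N 0) powr (- p) \<le> real n powr (- p)" using n p0 by (intro powr_mono2') auto
    moreover have "ln 2 powr ((p + 1) * real D) \<le> ln (real n) powr ((p + 1) * real D)"
      using n p0 by (intro powr_mono2) auto
    ultimately have "real (N 0) powr (- p) * ln 2 powr ((p + 1) * real D) \<le> X n"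
      unfolding X_def by (intro mult_mono) auto
    then have "C3 * (real (N 0) powr (- p) * ln 2 powr ((p + 1) * real D)) \<le> C3 * X n"
      using C3 by (intro mult_left_mono) auto
    moreover have "C3 * (real (N 0) powr (- p) * ln 2 powr ((p + 1) * real D)) = 1"
    proof -
      define q where "q = (p + 1) * real D"
      have "real (N 0) powr p * real (N 0) powr (- p) = 1" "ln 2 powr (- q) * ln 2 powr q = (1::real)"
        using N0 by (simp_all flip: powr_add)
      moreover have "C3 * (real (N 0) powr (- p) * ln 2 powr q)
          = (real (N 0) powr p * real (N 0) powr (- p)) * (ln 2 powr (- q) * ln 2 powr q)"
        by (simp only: C3_def q_def mult_ac)
      ultimately show ?thesis by (simp add: q_def)
    qed
    ultimately show ?thesis by simp
  qed
  have X0: "X n \<ge> 0" for n by (simp add: X_def)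
  have "Int_opt (weight :: real ^ 'd \<Rightarrow> real) (W1w_unit_ball r weight) n \<le> ennreal (C2 + C3) * ennreal (X n)" if n: "n \<ge> 2" for n
  proof -
    have "\<exists>E. Int_opt (weight :: real ^ 'd \<Rightarrow> real) (W1w_unit_ball r weight) n \<le> ennreal E \<and> E \<le> (C2 + C3) * X n"
    proof (cases "N 0 \<le> n")
      case False
      have "1 \<le> (C2 + C3) * X n"
        using small[of n] n False mult_right_mono[OF _ X0[of n], of C3 "C2 + C3"] C2 by simp
      then show ?thesis using Int_1[of n] by blast
    next
      case True
      have fin: "finite {m. N m \<le> n}"
      proof (rule finite_subset[of _ "{..n}"])
        show "{m. N m \<le> n} \<subseteq> {..n}"
        proof
          fix m assume "m \<in> {m. N m \<le> n}"
          then have "2 ^ (m + 1) \<le> n" using order_trans[OF N2[of m], of n] by blast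
          moreover have "m \<le> 2 ^ m" by (rule less_imp_le[OF less_exp])
          moreover have "(2::nat) ^ m \<le> 2 ^ (m + 1)" by (rule power_increasing) auto
          ultimately have "m \<le> n" by linarith
          then show "m \<in> {..n}" by simp
        qed
      qed simp
      define m where "m = Max {m. N m \<le> n}"
      have "m \<in> {m. N m \<le> n}" unfolding m_def using fin True by (intro Max_in) auto
      moreover have "n < N (m + 1)"
      proof (rule ccontr)
        assume "\<not> ?thesis"
        then have "m + 1 \<le> m" unfolding m_def using fin by (intro Max_ge) (auto simp: m_def)
        then show False by simp
      qed
      ultimately have "C1 * real (m + 1) ^ D * 2 powr (- p * real m) \<le> C2 * X n" and "N m \<le> n" using large by auto
      moreover have "C2 * X n \<le> (C2 + C3) * X n" using X0 C3 by (intro mult_right_mono) auto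
      ultimately show ?thesis using Int_m by (meson order_trans)
    qed
    then obtain E where E: "Int_opt (weight :: real ^ 'd \<Rightarrow> real) (W1w_unit_ball r weight) n \<le> ennreal E" "E \<le> (C2 + C3) * X n" by blast
    have "ennreal E \<le> ennreal ((C2 + C3) * X n)" using E(2) by (rule ennreal_leI)
    also have "\<dots> = ennreal (C2 + C3) * ennreal (X n)" using C2 C3 X0 by (intro ennreal_mult) auto
    finally show ?thesis using E(1) by (rule order_trans[rotated])
  qed
  then show ?thesis using C2 C3 unfolding D X_def by (intro exI[of _ "C2 + C3"]) auto
qed

end

section \<open>The lower bound\<close>

context freud begin
definition dyadic_ratio :: real where
  "dyadic_ratio = exp (- (a * lam * 2 powr (lam - 1)))"

text \<open>
  At distance about \<open>2 ^ j\<close> from the origin the weight varies at the scale \<open>2 powr (- (lam - 1) * j)\<close>. Intervals of this length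
  starting at \<open>2 ^ j\<close> fill \<open>{2 ^ j..2 ^ (j + 1)}\<close> with about \<open>2 powr (lam * j)\<close> cells.
\<close>

lemma cell_geometry:
  fixes j l :: nat
  assumes "real l + 1 \<le> 2 powr (lam * real j)"
  defines "h \<equiv> 2 powr (- (lam - 1) * real j)"
  shows "h > 0" "h \<le> 1" "2 ^ j + real l * h + h \<le> 2 ^ (j + 1)"
    "dyadic_ratio * w1 (2 ^ j + real l * h) \<le> w1 (2 ^ j + real l * h + h)"
proof -
  show h: "h > 0" by (simp add: h_def)
  show "h \<le> 1" using powr_mono[of "- (lam - 1) * real j" 0 2] lam by (simp add: h_def mult_le_0_iff)
  have "(real l + 1) * h \<le> 2 powr (lam * real j) * h" using assms(1) h by (intro mult_right_mono) auto
  also have "\<dots> = 2 powr real j" unfolding h_def by (simp add: algebra_simps flip: powr_add)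
  also have "\<dots> = 2 ^ j" by (simp add: powr_realpow)
  finally show top: "2 ^ j + real l * h + h \<le> 2 ^ (j + 1)" by (simp add: algebra_simps)
  let ?c = "2 ^ j + real l * h"
  have "w1 ?c \<le> exp (a * lam * 2 powr (lam - 1)) * w1 (?c + h)"
  proof (rule w1_ratio_le)
    have "h * (?c + h) powr (lam - 1) \<le> h * (2 ^ (j + 1)) powr (lam - 1)"
      using h lam top by (intro mult_left_mono powr_mono2) (auto intro!: add_nonneg_nonneg)
    also have "\<dots> = 2 powr (lam - 1)"
    proof -
      have "(2::real) ^ (j + 1) = 2 powr (real j + 1)" by (simp add: powr_add powr_realpow)
      then show ?thesis unfolding h_def by (simp add: powr_powr algebra_simps flip: powr_add)
    qed
    finally show "h * (?c + h) powr (lam - 1) \<le> 2 powr (lam - 1)" .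
  qed (use h in \<open>auto intro!: add_nonneg_nonneg\<close>)
  then have "exp (- (a * lam * 2 powr (lam - 1))) * w1 ?c \<le> exp (- (a * lam * 2 powr (lam - 1))) * (exp (a * lam * 2 powr (lam - 1)) * w1 (?c + h))"
    by (intro mult_left_mono) auto
  then show "dyadic_ratio * w1 ?c \<le> w1 (?c + h)" by (simp add: dyadic_ratio_def exp_minus field_simps)
qed

text \<open>
  The products of dyadic cells with \<open>sum j UNIV = M\<close> are disjoint boxes, all with the same value of \<open>\<Prod>i. h i ^ r\<close>. If there
  are more than \<open>n\<close> of them, then one contains no node, and the quadrature vanishes at its fooling function.
\<close>

lemma Int_opt_ge:
  assumes \<delta>: "\<delta> > 0" and fool: "\<And>c h :: 'd::finite \<Rightarrow> real. slow_box dyadic_ratio c h \<Longrightarrow> fools r \<delta> c h"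
    and n: "real n < real ((M div CARD('d) + 1) ^ (CARD('d) - 1)) * 2 powr (lam * real M) / 2 ^ CARD('d)"
  shows "ennreal (\<delta> * 2 powr (- (lam - 1) * real r * real M)) \<le> Int_opt (weight :: real ^ 'd \<Rightarrow> real) (W1w_unit_ball r weight) n"
  unfolding Int_opt_def
proof (rule INF_greatest)
  fix Q assume "Q \<in> (quadratures n :: ((real ^ 'd \<Rightarrow> real) \<Rightarrow> real) set)"
  then obtain k and xs :: "nat \<Rightarrow> real ^ 'd" and cs :: "nat \<Rightarrow> real"
    where k: "k \<le> n" and Q: "Q = (\<lambda>f. \<Sum>i=1..k. cs i * f (xs i))"
    unfolding quadratures_def by blast
  define h where "h j = 2 powr (- (lam - 1) * real j)" for j :: nat
  define L where "L j = nat \<lfloor>2 powr (lam * real j)\<rfloor>" for j :: nat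
  have one: "1 \<le> 2 powr (lam * real j)" for j using lam by (intro ge_one_powr_ge_zero) auto
  have L: "real (L j) \<le> 2 powr (lam * real j)" "2 powr (lam * real j) / 2 \<le> real (L j)" for j
  proof -
    have "1 \<le> \<lfloor>2 powr (lam * real j)\<rfloor>" using one[of j] by (simp add: le_floor_iff)
    moreover from this have "real (L j) = of_int \<lfloor>2 powr (lam * real j)\<rfloor>" by (simp add: L_def)
    ultimately show "real (L j) \<le> 2 powr (lam * real j)" "2 powr (lam * real j) / 2 \<le> real (L j)"
      by linarith+
  qed
  define Z where "Z = (SIGMA j:{j :: 'd \<Rightarrow> nat. sum j UNIV = M}. PiE UNIV (\<lambda>i. {..<L (j i)}))"
  define low where "low = (\<lambda>(j :: 'd \<Rightarrow> nat, l :: 'd \<Rightarrow> nat) i. 2 ^ j i + real (l i) * h (j i))"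
  define cell where "cell z = {x :: real ^ 'd. \<forall>i. low z i < x $ i \<and> x $ i < low z i + h (fst z i)}" for z
  have geo: "h (j i) > 0" "h (j i) \<le> 1" "2 ^ j i + real (l i) * h (j i) + h (j i) \<le> 2 ^ (j i + 1)"
    "dyadic_ratio * w1 (2 ^ j i + real (l i) * h (j i)) \<le> w1 (2 ^ j i + real (l i) * h (j i) + h (j i))"
    if "(j, l) \<in> Z" for j l i
  proof -
    have "l i < L (j i)" using that by (auto simp: Z_def)
    then have "real (l i) + 1 \<le> real (L (j i))" by simp
    then have "real (l i) + 1 \<le> 2 powr (lam * real (j i))" using L(1)[of "j i"] by linarith
    from cell_geometry[OF this] show "h (j i) > 0" "h (j i) \<le> 1" "2 ^ j i + real (l i) * h (j i) + h (j i) \<le> 2 ^ (j i + 1)"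
      "dyadic_ratio * w1 (2 ^ j i + real (l i) * h (j i)) \<le> w1 (2 ^ j i + real (l i) * h (j i) + h (j i))"
      unfolding h_def by auto
  qed
  have hp: "h j > 0" for j by (simp add: h_def)
  have disj: "z = z'" if z: "z \<in> Z" "z' \<in> Z" "x \<in> cell z" "x \<in> cell z'" for z z' x
  proof -
    obtain j l j' l' where zz: "z = (j, l)" "z' = (j', l')" by fastforce
    have in1: "2 ^ j i + real (l i) * h (j i) < x $ i" "x $ i < 2 ^ j i + real (l i) * h (j i) + h (j i)" for i
      using z(3) by (auto simp: cell_def low_def zz)
    have in2: "2 ^ j' i + real (l' i) * h (j' i) < x $ i" "x $ i < 2 ^ j' i + real (l' i) * h (j' i) + h (j' i)" for i
      using z(4) by (auto simp: cell_def low_def zz)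
    have aux: "\<not> p < q" if "2 ^ q + real m * h q < t" "t < 2 ^ (p + 1)" for p q m :: nat and t :: real
    proof
      assume "p < q"
      then have "(2::real) ^ (p + 1) \<le> 2 ^ q" by (intro power_increasing) auto
      moreover have "0 \<le> real m * h q" using hp[of q] by simp
      ultimately show False using that by linarith
    qed
    have jj: "j i = j' i" for i
    proof -
      have "x $ i < 2 ^ (j i + 1)" "x $ i < 2 ^ (j' i + 1)"
        using in1(2)[of i] in2(2)[of i] geo(3)[of j l i] geo(3)[of j' l' i] z(1,2) unfolding zz by linarith+
      then show ?thesis using aux[OF in2(1)[of i], of "j i"] aux[OF in1(1)[of i], of "j' i"] by simp
    qed
    have aux2: "\<not> p < q" if "2 ^ m + real q * h m < t" "t < 2 ^ m + real p * h m + h m" for p q m :: nat and t :: real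
    proof
      assume "p < q"
      then have "(real p + 1) * h m \<le> real q * h m" using hp[of m] by (intro mult_right_mono) auto
      then show False using that by (simp add: algebra_simps)
    qed
    have "l i = l' i" for i
      using aux2[OF in2(1)[of i], of "l i"] aux2[OF in1(1)[of i], of "l' i"] in1(2)[of i] in2(2)[of i] jj[of i] by simp
    then show ?thesis using jj by (auto simp: zz fun_eq_iff)
  qed
  have finZ: "finite Z" unfolding Z_def by (intro finite_SigmaI finite_sum_eq finite_PiE) auto
  have "real n < real (card Z)"
  proof -
    have "real (card Z) = (\<Sum>j | sum j UNIV = M. \<Prod>i\<in>(UNIV :: 'd set). real (L (j i)))"
      unfolding Z_def by (subst card_SigmaI) (auto simp: finite_sum_eq card_PiE intro!: finite_PiE)
    moreover have "(\<Sum>j | sum j UNIV = M. \<Prod>i\<in>(UNIV :: 'd set). real (L (j i))) \<ge> (\<Sum>j | sum j (UNIV :: 'd set) = M. 2 powr (lam * real M) / 2 ^ CARD('d))"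
    proof (rule sum_mono)
      fix j :: "'d \<Rightarrow> nat" assume "j \<in> {j. sum j UNIV = M}"
      then have "(\<Sum>i\<in>UNIV. real (j i)) = real M" by auto
      then have "2 powr (lam * real M) / 2 ^ CARD('d) = (\<Prod>i\<in>UNIV. 2 powr (lam * real (j i)) / 2)"
        by (simp add: prod_dividef flip: powr_sum sum_distrib_left)
      also have "\<dots> \<le> (\<Prod>i\<in>UNIV. real (L (j i)))" using L(2) by (intro prod_mono) auto
      finally show "2 powr (lam * real M) / 2 ^ CARD('d) \<le> (\<Prod>i\<in>UNIV. real (L (j i)))" .
    qed
    moreover have "real ((M div CARD('d) + 1) ^ (CARD('d) - 1)) * (2 powr (lam * real M) / 2 ^ CARD('d))
        \<le> real (card {j :: 'd \<Rightarrow> nat. sum j UNIV = M}) * (2 powr (lam * real M) / 2 ^ CARD('d))"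
      using card_sum_eq_ge[where 'd = 'd, of M] by (intro mult_right_mono) (simp_all only: of_nat_le_iff, simp)
    ultimately show ?thesis using n by simp
  qed
  then have nZ: "n < card Z" by simp
  have "\<exists>z\<in>Z. \<forall>i\<in>{1..k}. xs i \<notin> cell z"
  proof (rule ccontr)
    assume "\<not> ?thesis"
    then have "\<forall>z\<in>Z. \<exists>i. i \<in> {1..k} \<and> xs i \<in> cell z" by blast
    then obtain s where s: "\<And>z. z \<in> Z \<Longrightarrow> s z \<in> {1..k} \<and> xs (s z) \<in> cell z" by metis
    have "inj_on s Z"
    proof (rule inj_onI)
      fix z z' assume "z \<in> Z" "z' \<in> Z" "s z = s z'"
      then show "z = z'" using disj[of z z' "xs (s z)"] s[of z] s[of z'] by simp
    qed
    then have "card Z \<le> card {1..k}" by (rule card_inj_on_le) (use s in auto)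
    then show False using nZ k by simp
  qed
  then obtain j l where z: "(j, l) \<in> Z" "\<And>i. i \<in> {1..k} \<Longrightarrow> xs i \<notin> cell (j, l)" by fastforce
  have "fools r \<delta> (low (j, l)) (\<lambda>i. h (j i))"
  proof (rule fool)
    have "0 \<le> low (j, l) i" for i using hp[of "j i"] by (simp add: low_def)
    then show "slow_box dyadic_ratio (low (j, l)) (\<lambda>i. h (j i))"
      unfolding slow_box_def using geo[OF z(1)] by (simp add: low_def)
  qed
  then obtain f where f: "f \<in> W1w_unit_ball r (weight :: real ^ 'd \<Rightarrow> real)" "\<And>x. f x \<noteq> 0 \<Longrightarrow> x \<in> cell (j, l)"
    "\<delta> * (\<Prod>i\<in>UNIV. h (j i) ^ r) \<le> (\<integral>x. f x * weight x \<partial>lebesgue)"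
    unfolding cell_def fools_def by auto
  have "sum j UNIV = M" using z(1) by (simp add: Z_def)
  then have M: "(\<Sum>i\<in>UNIV. real (j i)) = real M" by auto
  have "(\<Prod>i\<in>UNIV. h (j i) ^ r) = (\<Prod>i\<in>UNIV. 2 powr (- (lam - 1) * real r * real (j i)))"
    unfolding h_def by (intro prod.cong refl) (simp add: powr_powr mult_ac flip: powr_realpow)
  also have "\<dots> = 2 powr (- (lam - 1) * real r * real M)"
    unfolding M[symmetric] sum_distrib_left by (rule powr_sum[symmetric]) auto
  finally have H: "(\<Prod>i\<in>UNIV. h (j i) ^ r) = 2 powr (- (lam - 1) * real r * real M)" .
  have "f (xs i) = 0" if "i \<in> {1..k}" for i using z(2)[OF that] f(2) by blast
  then have "Q f = 0" unfolding Q by (intro sum.neutral) auto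
  then have "\<delta> * 2 powr (- (lam - 1) * real r * real M) \<le> \<bar>(\<integral>x. f x * weight x \<partial>lebesgue) - Q f\<bar>"
    using f(3) H by simp
  then have "ennreal (\<delta> * 2 powr (- (lam - 1) * real r * real M)) \<le> ennreal \<bar>(\<integral>x. f x * weight x \<partial>lebesgue) - Q f\<bar>"
    by (rule ennreal_leI)
  also have "\<dots> \<le> (SUP f\<in>W1w_unit_ball r weight. ennreal \<bar>(\<integral>x. f x * weight x \<partial>lebesgue) - Q f\<bar>)"
    by (rule SUP_upper[OF f(1)])
  finally show "ennreal (\<delta> * 2 powr (- (lam - 1) * real r * real M)) \<le> (SUP f\<in>W1w_unit_ball r weight. ennreal \<bar>(\<integral>x. f x * weight x \<partial>lebesgue) - Q f\<bar>)" .
qed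

text \<open>
  \<open>M\<close> is the least length for which the lower bound \<open>Z M\<close> for the number of boxes exceeds \<open>n\<close>. Minimality bounds \<open>2 powr (- lam * M)\<close> from
  below by a multiple of \<open>M ^ (d - 1) / n\<close>, and \<open>n < Z M\<close> bounds \<open>M\<close> from below by a multiple of \<open>ln n\<close>.
\<close>

lemma lower_bound:
  assumes p: "p = (1 - 1 / lam) * real r"
  shows "\<exists>C::real. C > 0 \<and> (\<forall>n::nat. n \<ge> 2 \<longrightarrow>
        ennreal (real n powr (- p) * ln (real n) powr (p * (real CARD('d) - 1)))
          \<le> ennreal C * Int_opt (weight :: real ^ 'd::finite \<Rightarrow> real) (W1w_unit_ball r weight) n)"
proof -
  define d where "d = CARD('d)"
  define D where "D = d - 1"
  have d: "d \<ge> 1" unfolding d_def by (simp add: Suc_leI)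
  have D: "real CARD('d) - 1 = real D" using d by (simp add: D_def d_def of_nat_diff)
  have p0: "p \<ge> 0" using lam by (simp add: p)
  have "lam * (1 - 1 / lam) = lam - 1" using lam by (simp add: right_diff_distrib)
  then have lp: "(lam - 1) * real r = lam * p" by (simp add: p flip: mult.assoc)
  obtain \<delta> where \<delta>: "\<delta> > 0" "\<And>c h :: 'd \<Rightarrow> real. slow_box dyadic_ratio c h \<Longrightarrow> fools r \<delta> c h"
    by (rule fooling_function[where 'd = 'd and r = r and \<rho> = dyadic_ratio]) (simp add: dyadic_ratio_def, blast)
  define Z where "Z M = real ((M div d + 1) ^ D) * 2 powr (lam * real M) / 2 ^ d" for M
  define B where "B = real d * (real D + lam)"
  have B: "B > 0" unfolding B_def using d lam by (intro mult_pos_pos) auto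
  define c where "c = 2 powr (- lam * p) * (1 / (B ^ D * 2 ^ d)) powr p"
  have c: "c > 0" using B by (simp add: c_def)
  have main: "real n powr (- p) * ln (real n) powr (p * real D) * c \<le> 2 powr (- (lam - 1) * real r * real M)"
    if M: "real n < Z M" "\<And>M'. M' < M \<Longrightarrow> Z M' \<le> real n" and n: "n \<ge> 2" for M n
  proof -
    have "M \<noteq> 0"
    proof
      assume "M = 0"
      then have "Z M \<le> 1" by (simp add: Z_def)
      then show False using M(1) n by simp
    qed
    then obtain K where K: "M = Suc K" using not0_implies_Suc by blast
    have ln0: "ln (real n) > 0" using n by simp
    have "real n < (real M + 1) ^ D * 2 powr (lam * real M)"
    proof -
      have "M div d \<le> M" by simp
      then have "real (M div d + 1) \<le> real M + 1" by linarith
      then have "real (M div d + 1) ^ D \<le> (real M + 1) ^ D" by (intro power_mono) auto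
      then have "real ((M div d + 1) ^ D) * 2 powr (lam * real M) \<le> (real M + 1) ^ D * 2 powr (lam * real M)"
        by (intro mult_right_mono) (simp_all only: of_nat_power, simp)
      moreover have "Z M \<le> real ((M div d + 1) ^ D) * 2 powr (lam * real M)"
        unfolding Z_def using divide_left_mono[of 1 "2 ^ d" "real ((M div d + 1) ^ D) * 2 powr (lam * real M)"] by simp
      ultimately show ?thesis using M(1) by linarith
    qed
    then have "ln (real n) < ln ((real M + 1) ^ D * 2 powr (lam * real M))" using n by (subst ln_less_cancel_iff) auto
    also have "\<dots> = real D * ln (real M + 1) + lam * real M * ln 2"
      by (simp add: ln_mult ln_realpow ln_powr)
    also have "\<dots> \<le> real D * real M + lam * real M * 1"
      using lam ln_add_one_self_le_self[of "real M"] ln_2_less_1 by (intro add_mono mult_left_mono) (auto simp: add.commute)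
    also have "\<dots> = (real D + lam) * real M" by (simp add: algebra_simps)
    finally have lnM: "ln (real n) \<le> (real D + lam) * real M" by simp
    have "real M \<le> real d * real (K div d + 1)"
    proof -
      have "K = d * (K div d) + K mod d" "K mod d < d" using d by simp_all
      then have "M \<le> d * (K div d) + d" using K by linarith
      then have "M \<le> d * (K div d + 1)" by simp
      then have "real M \<le> real (d * (K div d + 1))" by (simp only: of_nat_le_iff)
      then show ?thesis by (simp only: of_nat_mult)
    qed
    then have "(real D + lam) * real M \<le> (real D + lam) * (real d * real (K div d + 1))"
      using lam by (intro mult_left_mono) auto
    then have "ln (real n) \<le> B * real (K div d + 1)" using lnM by (simp add: B_def mult_ac)
    then have "ln (real n) / B \<le> real (K div d + 1)" using B by (simp add: pos_divide_le_eq mult.commute)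
    then have "(ln (real n) / B) ^ D \<le> real (K div d + 1) ^ D" using ln0 B by (intro power_mono) auto
    then have "(ln (real n) / B) ^ D * 2 powr (lam * real K) / 2 ^ d \<le> Z K"
      unfolding Z_def by (intro divide_right_mono mult_right_mono) (simp_all only: of_nat_power, simp_all)
    also have "\<dots> \<le> real n" using M(2)[of K] K by simp
    finally have le: "(ln (real n) / B) ^ D * 2 powr (lam * real K) / 2 ^ d \<le> real n" .
    have "ln (real n) ^ D * (1 / (B ^ D * 2 ^ d)) * real n powr (- 1) \<le> 2 powr (- (lam * real K))"
    proof -
      have "(ln (real n) / B) ^ D * 2 powr (lam * real K) / 2 ^ d * (2 powr (- (lam * real K)) * real n powr (- 1))
          \<le> real n * (2 powr (- (lam * real K)) * real n powr (- 1))"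
        using le by (intro mult_right_mono) auto
      moreover have "2 powr (lam * real K) * 2 powr (- (lam * real K)) = 1" by (simp flip: powr_add)
      moreover have "real n * real n powr (- 1) = 1" using n by (simp add: powr_minus)
      ultimately show ?thesis using n by (simp add: power_divide field_simps)
    qed
    then have "(ln (real n) ^ D * (1 / (B ^ D * 2 ^ d)) * real n powr (- 1)) powr p \<le> (2 powr (- (lam * real K))) powr p"
      using p0 ln0 B by (intro powr_mono2) auto
    moreover have "(ln (real n) ^ D * (1 / (B ^ D * 2 ^ d)) * real n powr (- 1)) powr p
      = ln (real n) powr (p * real D) * (1 / (B ^ D * 2 ^ d)) powr p * real n powr (- p)"
    proof -
      have "(ln (real n) ^ D) powr p = ln (real n) powr (p * real D)"
        using ln0 by (simp add: powr_powr mult.commute flip: powr_realpow)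
      moreover have "(real n powr (- 1)) powr p = real n powr (- p)" unfolding powr_powr by simp
      moreover have "0 \<le> 1 / (B ^ D * 2 ^ d)" using B by simp
      ultimately show ?thesis using ln0 by (simp only: powr_mult zero_le_power less_imp_le mult_nonneg_nonneg powr_ge_zero)
    qed
    moreover have "(2 powr (- (lam * real K))) powr p * 2 powr (- lam * p) = 2 powr (- (lam - 1) * real r * real M)"
    proof -
      have e: "- (lam - 1) * real r * real M = - (lam * p) * (1 + real K)" by (simp only: mult_minus_left lp K of_nat_Suc)
      show ?thesis unfolding e powr_powr by (simp add: algebra_simps flip: powr_add)
    qed
    ultimately have "ln (real n) powr (p * real D) * (1 / (B ^ D * 2 ^ d)) powr p * real n powr (- p) * 2 powr (- lam * p)
        \<le> 2 powr (- (lam - 1) * real r * real M)"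
      using mult_right_mono[of _ _ "2 powr (- lam * p)"] by fastforce
    then show ?thesis by (simp add: c_def mult_ac)
  qed
  have ex: "\<exists>M. real n < Z M" for n
  proof -
    define M where "M = n * 2 ^ d"
    have "real n * 2 ^ d < 2 powr (lam * real M)"
    proof -
      have "real M < 2 ^ M" by (rule of_nat_less_two_power)
      also have "\<dots> = 2 powr real M" by (simp add: powr_realpow)
      also have "\<dots> \<le> 2 powr (lam * real M)" using lam by (intro powr_mono) (auto simp: mult_le_cancel_right1)
      finally show ?thesis by (simp add: M_def)
    qed
    also have "2 powr (lam * real M) \<le> real ((M div d + 1) ^ D) * 2 powr (lam * real M)"
    proof -
      have "1 \<le> (M div d + 1) ^ D" by simp
      then have "1 \<le> real ((M div d + 1) ^ D)" by linarith
      then show ?thesis by (simp only: mult_le_cancel_right1) simp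
    qed
    finally have "real n < Z M" by (simp add: Z_def pos_less_divide_eq)
    then show ?thesis ..
  qed
  have "ennreal (real n powr (- p) * ln (real n) powr (p * real D)) \<le> ennreal (1 / (c * \<delta>)) * Int_opt (weight :: real ^ 'd \<Rightarrow> real) (W1w_unit_ball r weight) n"
    if n: "n \<ge> 2" for n
  proof -
    define M where "M = (LEAST M. real n < Z M)"
    have M: "real n < Z M" "\<And>M'. M' < M \<Longrightarrow> Z M' \<le> real n"
      unfolding M_def using LeastI_ex[OF ex[of n]] not_less_Least by force+
    let ?e = "2 powr (- (lam - 1) * real r * real M)"
    have "real n powr (- p) * ln (real n) powr (p * real D) \<le> 1 / (c * \<delta>) * (\<delta> * ?e)"
      using main[OF M n] c \<delta>(1) by (simp add: field_simps)
    then have "ennreal (real n powr (- p) * ln (real n) powr (p * real D)) \<le> ennreal (1 / (c * \<delta>) * (\<delta> * ?e))"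
      by (rule ennreal_leI)
    also have "\<dots> = ennreal (1 / (c * \<delta>)) * ennreal (\<delta> * ?e)" using c \<delta>(1) by (intro ennreal_mult) auto
    also have "\<dots> \<le> ennreal (1 / (c * \<delta>)) * Int_opt (weight :: real ^ 'd \<Rightarrow> real) (W1w_unit_ball r weight) n"
      by (intro mult_left_mono Int_opt_ge[OF \<delta>(1)] \<delta>(2)) (use M(1) in \<open>auto simp: Z_def d_def D_def\<close>)
    finally show ?thesis .
  qed
  then show ?thesis unfolding D using c \<delta>(1) by (intro exI[of _ "1 / (c * \<delta>)"]) auto
qed

end

theorem theorem3p8:
  fixes r :: nat and lam a b r_lam :: real and w :: "real ^ 'd \<Rightarrow> real"
  assumes "r \<ge> 1" and "lam > 1" and "a > 0"
    and "w = (\<lambda>x. \<Prod>i\<in>UNIV. exp (- a * \<bar>x $ i\<bar> powr lam + b))"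
    and "r_lam = (1 - 1 / lam) * real r"
  shows
    "(\<exists>C::real. C > 0 \<and> (\<forall>n::nat. n \<ge> 2 \<longrightarrow>
        ennreal (real n powr (- r_lam) * ln (real n) powr (r_lam * (real CARD('d) - 1)))
          \<le> ennreal C * Int_opt w (W1w_unit_ball r w) n)) \<and>
     (\<exists>C::real. C > 0 \<and> (\<forall>n::nat. n \<ge> 2 \<longrightarrow>
        Int_opt w (W1w_unit_ball r w) n
          \<le> ennreal C * ennreal (real n powr (- r_lam) *
              ln (real n) powr ((r_lam + 1) * (real CARD('d) - 1)))))"
proof -
  interpret freud a b lam by unfold_locales (use assms in auto)
  have "w = weight" unfolding assms(4) weight_def tensor_def w1_def by simp
  then show ?thesis using lower_bound[OF assms(5)] upper_bound[OF assms(1,5)] by simp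
qed

end
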